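(* Let $G=(A\cup B,E)$ be a bipartite graph with $|A|=|B|$, $n$ vertices and $m$ edges, where each agent has a strict partial order over her neighbors. For any positive integer $\kappa$, the $(\kappa+1)$-level truncation of Algorithm 1 (described in the context) finds an assignment that is popular with penalty $\kappa$, if such an assignment exists. Its running time is $O(\kappa\cdot m\cdot n^{3/2})$.
   Context: An assignment is a perfect matching of $G$. For matchings $N,M$ and $a\in A$, $\mathsf{vote}^\kappa_a(N,M)$ equals $1$ if $a$ is matched in both and $N(a)\succ_aM(a)$; $-1$ if matched in both and $M(a)\succ_aN(a)$; $\kappa$ if $a$ is matched in $N$ but not $M$; $-\kappa$ if matched in $M$ but not $N$; $0$ otherwise. A matching $M$ is popular with penalty $\kappa$ if $\sum_{a\in A}\mathsf{vote}^\kappa_a(N,M)\le0$ for every matching $N$ of $G$ (not necessarily perfect). For $\ell:B\to\mathbb{N}$ and $a\in A$, $\ell^*(a)=\max_{b\in\mathsf{Nbr}(a)}\ell(b)$; $G_\ell=(A\cup B,E_\ell)$ contains $(a,b)\in E$ iff (i) $\ell(b)=\ell^*(a)$ and no neighbor $b'$ of $a$ with $\ell(b')=\ell^*(a)$ has $b'\succ_ab$; or (ii) $\ell(b)=\ell^*(a)-1$, $b\succ_ab'$ for all neighbors $b'$ with $\ell(b')=\ell^*(a)$, and no neighbor $b''$ with $\ell(b'')=\ell^*(a)-1$ has $b''\succ_ab$. Algorithm 1: set $\ell\equiv0$; repeatedly compute a maximum matching $M$ in $G_\ell$, return $M$ if it is perfect, and otherwise increase $\ell(b)$ by 1 for every $b\in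 B$ unmatched in $M$. Its $(\kappa+1)$-level truncation runs the loop only while $\ell(b)<\kappa+1$ for all $b\in B$, terminating with rejection as soon as some object reaches level $\kappa+1$. *)

theory Defs
  imports Complex_Main
begin

section \<open>Assignments and popularity with penalty\<close>

text \<open>
  A bipartite graph is a finite edge set \<open>E \<subseteq> A \<times> B\<close>; agents and objects have different types, so
  the two sides are disjoint.  \<open>pref a b b'\<close> reads \<open>b \<succ>\<^sub>a b'\<close>, and is only relevant for neighbours
  \<open>b, b'\<close> of \<open>a\<close>.
\<close>

type_synonym ('a, 'b) pref = "'a \<Rightarrow> 'b \<Rightarrow> 'b \<Rightarrow> bool"

definition nbr :: "('a \<times> 'b) set \<Rightarrow> 'a \<Rightarrow> 'b set" where
  "nbr E a = {b. (a, b) \<in> E}"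

definition assignment_instance ::
  "'a set \<Rightarrow> 'b set \<Rightarrow> ('a \<times> 'b) set \<Rightarrow> ('a, 'b) pref \<Rightarrow> bool" where
  "assignment_instance A B E pref \<longleftrightarrow>
     finite A \<and> finite B \<and> card A = card B \<and> E \<subseteq> A \<times> B \<and>
     (\<forall>a\<in>A. irreflp_on (nbr E a) (pref a) \<and> transp_on (nbr E a) (pref a))"

definition matching :: "('a \<times> 'b) set \<Rightarrow> ('a \<times> 'b) set \<Rightarrow> bool" where
  "matching E M \<longleftrightarrow>
     M \<subseteq> E \<and> (\<forall>(a, b)\<in>M. \<forall>(a', b')\<in>M. a = a' \<longleftrightarrow> b = b')"

definition perfect :: "'a set \<Rightarrow> 'b set \<Rightarrow> ('a \<times> 'b) set \<Rightarrow> bool" where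
  "perfect A B M \<longleftrightarrow> Domain M = A \<and> Range M = B"

definition maximum_matching :: "('a \<times> 'b) set \<Rightarrow> ('a \<times> 'b) set \<Rightarrow> bool" where
  "maximum_matching E M \<longleftrightarrow>
     matching E M \<and> (\<forall>M'. matching E M' \<longrightarrow> card M' \<le> card M)"

definition assignment ::
  "'a set \<Rightarrow> 'b set \<Rightarrow> ('a \<times> 'b) set \<Rightarrow> ('a \<times> 'b) set \<Rightarrow> bool" where
  "assignment A B E M \<longleftrightarrow> matching E M \<and> perfect A B M"

text \<open>The partner of a matched agent; unspecified for unmatched agents.\<close>

definition partner :: "('a \<times> 'b) set \<Rightarrow> 'a \<Rightarrow> 'b" where
  "partner M a = (THE b. (a, b) \<in> M)"

definition vote ::
  "('a, 'b) pref \<Rightarrow> nat \<Rightarrow> ('a \<times> 'b) set \<Rightarrow> ('a \<times> 'b) set \<Rightarrow> 'a \<Rightarrow> int" where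
  "vote pref \<kappa> N M a =
     (if a \<in> Domain N \<and> a \<in> Domain M then
        (if pref a (partner N a) (partner M a) then 1
         else if pref a (partner M a) (partner N a) then -1
         else 0)
      else if a \<in> Domain N then int \<kappa>
      else if a \<in> Domain M then - int \<kappa>
      else 0)"

definition popular_with_penalty ::
  "'a set \<Rightarrow> ('a \<times> 'b) set \<Rightarrow> ('a, 'b) pref \<Rightarrow> nat \<Rightarrow> ('a \<times> 'b) set \<Rightarrow> bool" where
  "popular_with_penalty A E pref \<kappa> M \<longleftrightarrow>
     matching E M \<and> (\<forall>N. matching E N \<longrightarrow> (\<Sum>a\<in>A. vote pref \<kappa> N M a) \<le> 0)"


section \<open>The level-based algorithm and its truncation\<close>

text \<open>\<open>top_level E l a\<close> is \<open>l\<^sup>*(a)\<close>; it is unspecified, and never used, for isolated agents.\<close>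

definition top_level :: "('a \<times> 'b) set \<Rightarrow> ('b \<Rightarrow> nat) \<Rightarrow> 'a \<Rightarrow> nat" where
  "top_level E l a = Max (l ` nbr E a)"

text \<open>The condition \<open>l b = l\<^sup>*(a) - 1\<close> is written with \<open>Suc\<close> since subtraction on \<open>nat\<close> truncates.\<close>

definition level_graph ::
  "('a \<times> 'b) set \<Rightarrow> ('a, 'b) pref \<Rightarrow> ('b \<Rightarrow> nat) \<Rightarrow> ('a \<times> 'b) set" where
  "level_graph E pref l = {(a, b). (a, b) \<in> E \<and>
     ((l b = top_level E l a \<and>
       \<not> (\<exists>b'\<in>nbr E a. l b' = top_level E l a \<and> pref a b' b)) \<or>
      (Suc (l b) = top_level E l a \<and>
       (\<forall>b'\<in>nbr E a. l b' = top_level E l a \<longrightarrow> pref a b b') \<and>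
       \<not> (\<exists>b''\<in>nbr E a. Suc (l b'') = top_level E l a \<and> pref a b'' b)))}"

definition raise_unmatched ::
  "'b set \<Rightarrow> ('a \<times> 'b) set \<Rightarrow> ('b \<Rightarrow> nat) \<Rightarrow> 'b \<Rightarrow> nat" where
  "raise_unmatched B M l = (\<lambda>b. if b \<in> B \<and> b \<notin> Range M then l b + 1 else l b)"

text \<open>
  One transition is one evaluation of the loop guard together with, if it holds, one iteration of
  the loop body.  The relation is nondeterministic because any maximum matching may be chosen.
\<close>

datatype ('a, 'b) config =
  Running "'b \<Rightarrow> nat"
| Returned "('a \<times> 'b) set"
| Rejected

inductive trunc_step ::
  "'a set \<Rightarrow> 'b set \<Rightarrow> ('a \<times> 'b) set \<Rightarrow> ('a, 'b) pref \<Rightarrow> nat \<Rightarrow>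
   ('a, 'b) config \<Rightarrow> ('a, 'b) config \<Rightarrow> bool"
  for A B E pref \<kappa> where
  accept: "\<forall>b\<in>B. l b < \<kappa> + 1 \<Longrightarrow> maximum_matching (level_graph E pref l) M \<Longrightarrow> perfect A B M \<Longrightarrow>
    trunc_step A B E pref \<kappa> (Running l) (Returned M)"
| raise: "\<forall>b\<in>B. l b < \<kappa> + 1 \<Longrightarrow> maximum_matching (level_graph E pref l) M \<Longrightarrow> \<not> perfect A B M \<Longrightarrow>
    trunc_step A B E pref \<kappa> (Running l) (Running (raise_unmatched B M l))"
| reject: "\<exists>b\<in>B. l b \<ge> \<kappa> + 1 \<Longrightarrow>
    trunc_step A B E pref \<kappa> (Running l) Rejected"

definition initial :: "('a, 'b) config" where
  "initial = Running (\<lambda>_. 0)"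

definition final_config ::
  "'a set \<Rightarrow> 'b set \<Rightarrow> ('a \<times> 'b) set \<Rightarrow> ('a, 'b) pref \<Rightarrow> nat \<Rightarrow> ('a, 'b) config \<Rightarrow> bool" where
  "final_config A B E pref \<kappa> c \<longleftrightarrow> \<not> (\<exists>c'. trunc_step A B E pref \<kappa> c c')"


section \<open>A random access machine\<close>

text \<open>
  Running time is measured on a unit-cost machine with zero-initialised arrays of natural numbers,
  addressed by tuples whose length is fixed by the program text (scalars have the empty tuple).
  Numbers can only be incremented, decremented and compared, so in \<open>t\<close> steps a fixed program can
  increase the largest number present by \<open>O(t)\<close> only: unit cost cannot be abused by packing data
  into huge numbers.
  Expressions are evaluated in one step, whatever their size; as the program is fixed,
  this affects the running time by a constant factor only.
\<close>

type_synonym store = "string \<Rightarrow> nat list \<Rightarrow> nat"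

datatype aexp =
  Const nat
| Loc string "aexp list"
| Inc aexp
| Dec aexp

datatype bexp =
  Less aexp aexp
| Not bexp
| And bexp bexp

datatype com =
  Skip
| Assign string "aexp list" aexp
| Seq com com
| If bexp com com
| While bexp com

fun aval :: "store \<Rightarrow> aexp \<Rightarrow> nat" where
  "aval s (Const k) = k"
| "aval s (Loc x is) = s x (map (aval s) is)"
| "aval s (Inc e) = aval s e + 1"
| "aval s (Dec e) = aval s e - 1"

fun bval :: "store \<Rightarrow> bexp \<Rightarrow> bool" where
  "bval s (Less e1 e2) = (aval s e1 < aval s e2)"
| "bval s (Not b) = (\<not> bval s b)"
| "bval s (And b1 b2) = (bval s b1 \<and> bval s b2)"

fun ram_step :: "com \<times> store \<Rightarrow> com \<times> store" where
  "ram_step (Skip, s) = (Skip, s)"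
| "ram_step (Assign x is e, s) = (Skip, s(x := (s x)(map (aval s) is := aval s e)))"
| "ram_step (Seq c1 c2, s) =
     (if c1 = Skip then (c2, s) else (case ram_step (c1, s) of (c1', s') \<Rightarrow> (Seq c1' c2, s')))"
| "ram_step (If b c1 c2, s) = ((if bval s b then c1 else c2), s)"
| "ram_step (While b c, s) = ((if bval s b then Seq c (While b c) else Skip), s)"

definition ram_at :: "com \<Rightarrow> store \<Rightarrow> nat \<Rightarrow> com \<times> store" where
  "ram_at P s t = (ram_step ^^ t) (P, s)"

definition halted_at :: "com \<Rightarrow> store \<Rightarrow> nat \<Rightarrow> bool" where
  "halted_at P s t \<longleftrightarrow> fst (ram_at P s t) = Skip"

text \<open>
  On the machine, agents and objects are both numbered \<open>0, \<dots>, k - 1\<close>.  The graph is given by an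
  adjacency list for every agent, in an arbitrary order, and the preferences by a table that
  answers a single comparison in one access.
\<close>

definition encodes ::
  "nat \<Rightarrow> (nat \<times> nat) set \<Rightarrow> (nat, nat) pref \<Rightarrow> nat \<Rightarrow> store \<Rightarrow> bool" where
  "encodes k E pref \<kappa> s \<longleftrightarrow>
     s ''size'' [] = k \<and>
     s ''kappa'' [] = \<kappa> \<and>
     (\<forall>a<k. s ''deg'' [a] = card (nbr E a) \<and>
            bij_betw (\<lambda>i. s ''adj'' [a, i]) {..<card (nbr E a)} (nbr E a) \<and>
            (\<forall>b\<in>nbr E a. \<forall>b'\<in>nbr E a. s ''pref'' [a, b, b'] = (if pref a b b' then 1 else 0))) \<and>
     (\<forall>x. x \<notin> {''size'', ''kappa'', ''deg'', ''adj'', ''pref''} \<longrightarrow> (\<forall>is. s x is = 0))"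

fun represents :: "nat \<Rightarrow> store \<Rightarrow> (nat, nat) config \<Rightarrow> bool" where
  "represents k s (Running l) \<longleftrightarrow> s ''status'' [] = 0 \<and> (\<forall>b<k. s ''level'' [b] = l b)"
| "represents k s (Returned M) \<longleftrightarrow> s ''status'' [] = 1 \<and> M = {(a, s ''mate'' [a]) |a. a < k}"
| "represents k s Rejected \<longleftrightarrow> s ''status'' [] = 2"

text \<open>
  Started on \<open>s\<close>, the program \<open>P\<close> halts within \<open>T\<close> steps and carries out the truncated algorithm:
  there is a complete run \<open>c 0, \<dots>, c r\<close> of the algorithm whose configurations appear in memory in
  this order, the last one when \<open>P\<close> has halted.
\<close>

definition executes_within ::
  "com \<Rightarrow> nat \<Rightarrow> (nat \<times> nat) set \<Rightarrow> (nat, nat) pref \<Rightarrow> nat \<Rightarrow> store \<Rightarrow> nat \<Rightarrow> bool" where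
  "executes_within P k E pref \<kappa> s T \<longleftrightarrow>
     halted_at P s T \<and>
     (\<exists>r c \<tau>.
        c 0 = initial \<and>
        (\<forall>i<r. trunc_step {..<k} {..<k} E pref \<kappa> (c i) (c (Suc i))) \<and>
        final_config {..<k} {..<k} E pref \<kappa> (c r) \<and>
        (\<forall>i<r. \<tau> i < \<tau> (Suc i)) \<and> \<tau> r = T \<and>
        (\<forall>i\<le>r. represents k (snd (ram_at P s (\<tau> i))) (c i)))"

end

(*
  Write w a b b' in {-1, 0, 1} for the vote of a between b and b'.  An edge (a, b) belongs to G_l iff
  w a b' b + l b' <= l b for all neighbours b' of a, which is dual feasibility for popularity: summing
  over the agents shows that a perfect matching in G_l with l <= kappa is popular with penalty kappa.
  Conversely, if M is such an assignment, giving agents the partners of other agents along a path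
  gains at most kappa votes and along a cycle at most 0, so the maximum gain h of a path is a
  potential with values in {0, ..., kappa}, and M is contained in G_h.  The levels never exceed h: if
  l <= h and an object b with l b = h b is unmatched, swapping a maximum matching of G_l with M along
  the alternating path from b gives a larger matching of G_l.

  For the running time, note that the relation w a b' b + l b' > l b is monotone in l b'.  A flag per
  edge therefore has to be updated only when one of two objects is raised, which takes time
  O(kappa * m * n) altogether.  A maximum matching of G_l is found in time O(m * sqrt n) by an auction
  that stops at price sqrt n and leaves a deficiency of at most sqrt n, followed by augmentations
  along paths found by breadth-first search.  There are O(kappa * n) rounds, and only O(kappa) of
  them if m < n / 2, because then an isolated object is raised in every round.
*)

theory Submission
  imports Defs
begin

section \<open>Matchings and level graphs\<close>

text \<open>The flags answer an obstacle: with partial orders an agent has no single best neighbour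
  to test against, so building the level graph afresh compares pairs of neighbours and costs up to
  the sum of squared degrees, of order m * n. Over \<kappa> * n rounds this exceeds the claimed
  bound by a factor sqrt n. Hence the flags outlive the round, and each raise of an object pays for
  its own comparisons. The matching, in contrast, is rebuilt from nothing in every round. The price
  limit sqrt n balances its two phases: the auction costs O(m + n) for each unit of the limit, and
  each edge still missing afterwards, at most n divided by the limit, costs one search of O(m + n).
  The bound \<kappa> on the potential comes from the penalty itself: shifting partners along a path
  leaves just its last agent unmatched, so popularity caps the votes gained by \<kappa>, while a
  cycle leaves nobody unmatched. The machine can only increment, decrement and compare, so even the
  square root is found by counting.\<close>

definition pref_sign :: "('a, 'b) pref \<Rightarrow> 'a \<Rightarrow> 'b \<Rightarrow> 'b \<Rightarrow> int" where
  "pref_sign pref a b' b = (if pref a b' b then 1 else if pref a b b' then -1 else 0)"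

lemma matching_subset: "matching E M \<Longrightarrow> M \<subseteq> E"
  by (simp add: matching_def)

lemma matching_left_unique: "matching E M \<Longrightarrow> (a, b) \<in> M \<Longrightarrow> (a, b') \<in> M \<Longrightarrow> b = b'"
  unfolding matching_def by blast

lemma matching_right_unique: "matching E M \<Longrightarrow> (a, b) \<in> M \<Longrightarrow> (a', b) \<in> M \<Longrightarrow> a = a'"
  unfolding matching_def by blast

lemma matchingI:
  assumes "M \<subseteq> E" "\<And>a b b'. (a, b) \<in> M \<Longrightarrow> (a, b') \<in> M \<Longrightarrow> b = b'"
    "\<And>a a' b. (a, b) \<in> M \<Longrightarrow> (a', b) \<in> M \<Longrightarrow> a = a'"
  shows "matching E M"
  using assms unfolding matching_def by blast

lemma matching_subset_matching: "matching E M \<Longrightarrow> M' \<subseteq> M \<Longrightarrow> matching E M'"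
  unfolding matching_def by blast

lemma matching_mono: "matching E M \<Longrightarrow> E \<subseteq> E' \<Longrightarrow> matching E' M"
  unfolding matching_def by blast

lemma partner_eq: "matching E M \<Longrightarrow> (a, b) \<in> M \<Longrightarrow> partner M a = b"
  unfolding partner_def by (blast intro: matching_left_unique)

lemma partner_in: "matching E M \<Longrightarrow> a \<in> Domain M \<Longrightarrow> (a, partner M a) \<in> M"
  by (auto simp: partner_eq)

lemma card_Domain_matching: "matching E M \<Longrightarrow> card (Domain M) = card M"
  unfolding Domain_fst
  by (rule card_image) (auto simp: inj_on_def dest: matching_left_unique)

lemma card_Range_matching: "matching E M \<Longrightarrow> card (Range M) = card M"
  unfolding Range_snd
  by (rule card_image) (auto simp: inj_on_def dest: matching_right_unique)

lemma bij_betw_partner: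
  assumes "matching E M"
  shows "bij_betw (partner M) (Domain M) (Range M)"
proof (rule bij_betw_imageI)
  show "inj_on (partner M) (Domain M)"
    using assms by (auto intro!: inj_onI simp: partner_eq dest: matching_right_unique)
  show "partner M ` Domain M = Range M"
    using assms by (force simp: partner_eq image_iff)
qed

text \<open>The easy half of Koenig's theorem: every edge is charged to one of its ends in the
  cover, and the edges of a matching share no end. It is the optimality certificate of both the
  auction and the search.\<close>

lemma card_matching_le_cover:
  assumes M: "matching E M" and fin: "finite X" "finite Y"
    and cover: "\<And>a b. (a, b) \<in> M \<Longrightarrow> a \<in> X \<or> b \<in> Y"
  shows "card M \<le> card X + card Y"
proof -
  let ?f = "\<lambda>(a, b). if a \<in> X then Inl a else Inr b"
  have "inj_on ?f M"
    using M by (auto simp: inj_on_def split: if_splits dest: matching_left_unique matching_right_unique)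
  moreover have "?f ` M \<subseteq> X <+> Y"
    by (auto split: if_splits dest: cover)
  ultimately have "card M \<le> card (X <+> Y)"
    using fin by (intro card_inj_on_le[of ?f]) auto
  then show ?thesis
    using fin by (simp add: card_Plus)
qed

locale bipartite_prefs =
  fixes A :: "'a set" and B :: "'b set" and E :: "('a \<times> 'b) set" and pref :: "('a, 'b) pref"
  assumes instance_ok: "assignment_instance A B E pref"
begin

lemma finite_A [simp]: "finite A" and finite_B [simp]: "finite B" and card_A: "card A = card B"
  and E_subset: "E \<subseteq> A \<times> B"
  using instance_ok by (auto simp: assignment_instance_def)

lemma finite_E [simp]: "finite E"
  using E_subset by (rule finite_subset) simp

lemma nbr_subset: "nbr E a \<subseteq> B"
  using E_subset by (auto simp: nbr_def)

lemma finite_nbr [simp]: "finite (nbr E a)"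
  using nbr_subset by (rule finite_subset) simp

lemma pref_irrefl: "b \<in> nbr E a \<Longrightarrow> \<not> pref a b b"
  using instance_ok E_subset unfolding assignment_instance_def irreflp_on_def nbr_def by blast

lemma pref_asym:
  assumes "b \<in> nbr E a" "b' \<in> nbr E a" "pref a b b'"
  shows "\<not> pref a b' b"
proof -
  have "a \<in> A" using assms(1) E_subset by (auto simp: nbr_def)
  then have "transp_on (nbr E a) (pref a)"
    using instance_ok by (auto simp: assignment_instance_def)
  then show ?thesis
    using assms pref_irrefl[of b a] unfolding transp_on_def by blast
qed

lemma pref_sign_antisym: "b \<in> nbr E a \<Longrightarrow> b' \<in> nbr E a \<Longrightarrow> pref_sign pref a b' b = - pref_sign pref a b b'"
  using pref_asym by (auto simp: pref_sign_def)

text \<open>In this form membership is the dual feasibility constraint of the popularity program.\<close>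

lemma level_graph_iff:
  "(a, b) \<in> level_graph E pref l \<longleftrightarrow>
     (a, b) \<in> E \<and> (\<forall>b'\<in>nbr E a. pref_sign pref a b' b + int (l b') \<le> int (l b))"
proof (cases "(a, b) \<in> E")
  case True
  then have b: "b \<in> nbr E a" by (simp add: nbr_def)
  define t where "t = top_level E l a"
  have ub: "l b' \<le> t" if "b' \<in> nbr E a" for b'
    using that unfolding t_def top_level_def by simp
  obtain c where c: "c \<in> nbr E a" "l c = t"
    using Max_in[of "l ` nbr E a"] b unfolding t_def top_level_def by fastforce
  have lg: "(a, b) \<in> level_graph E pref l \<longleftrightarrow>
      ((l b = t \<and> \<not> (\<exists>b'\<in>nbr E a. l b' = t \<and> pref a b' b)) \<or>
      (Suc (l b) = t \<and> (\<forall>b'\<in>nbr E a. l b' = t \<longrightarrow> pref a b b') \<and>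
       \<not> (\<exists>b''\<in>nbr E a. Suc (l b'') = t \<and> pref a b'' b)))" (is "_ \<longleftrightarrow> ?R")
    using True by (simp add: level_graph_def t_def)
  have "?R \<longleftrightarrow> (\<forall>b'\<in>nbr E a. pref_sign pref a b' b + int (l b') \<le> int (l b))" (is "_ \<longleftrightarrow> ?S")
  proof
    assume R: ?R
    show ?S
    proof
      fix b' assume b': "b' \<in> nbr E a"
      have "l b' \<le> t" using ub b' .
      from R show "pref_sign pref a b' b + int (l b') \<le> int (l b)"
      proof
        assume "l b = t \<and> \<not> (\<exists>b'\<in>nbr E a. l b' = t \<and> pref a b' b)"
        with b' \<open>l b' \<le> t\<close> show ?thesis
          by (cases "l b' = t") (auto simp: pref_sign_def)
      next
        assume *: "Suc (l b) = t \<and> (\<forall>b'\<in>nbr E a. l b' = t \<longrightarrow> pref a b b') \<and>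
          \<not> (\<exists>b''\<in>nbr E a. Suc (l b'') = t \<and> pref a b'' b)"
        consider "l b' = t" | "Suc (l b') = t" | "Suc (Suc (l b')) \<le> t"
          using \<open>l b' \<le> t\<close> by linarith
        then show ?thesis
          using * b' pref_asym[OF b b'] by cases (auto simp: pref_sign_def)
      qed
    qed
  next
    assume S: ?S
    \<comment> \<open>A sign is at least -1, so the constraint against the top neighbour
      \<open>c\<close> leaves \<open>b\<close> at most one level below it; the two cases are the two
      clauses of the definition.\<close>
    have "l b \<le> t" "t \<le> Suc (l b)"
      using ub b S c by (auto simp: pref_sign_def split: if_splits)
    then consider "l b = t" | "Suc (l b) = t" by linarith
    then show ?R
      using S by cases (fastforce simp: pref_sign_def split: if_splits)+
  qed
  with lg show ?thesis using True by simp
next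
  case False
  then show ?thesis by (simp add: level_graph_def)
qed

lemma level_graph_subset: "level_graph E pref l \<subseteq> E"
  by (auto simp: level_graph_def)

lemma finite_matching: "matching E M \<Longrightarrow> finite M"
  using finite_E finite_subset matching_subset by blast

lemma Domain_matching: "matching E M \<Longrightarrow> Domain M \<subseteq> A"
  and Range_matching: "matching E M \<Longrightarrow> Range M \<subseteq> B"
  using matching_subset E_subset by blast+

lemma card_unmatched:
  assumes "matching E M"
  shows "card (A - Domain M) = card (B - Range M)"
proof -
  have "finite (Domain M)" "finite (Range M)"
    using finite_subset[OF Domain_matching[OF assms]] finite_subset[OF Range_matching[OF assms]] by simp_all
  then show ?thesis
    using assms by (simp add: card_Diff_subset Domain_matching Range_matching
        card_Domain_matching card_Range_matching card_A)
qed

lemma perfect_iff_Range: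
  assumes "matching E M"
  shows "perfect A B M \<longleftrightarrow> B \<subseteq> Range M"
proof -
  have "A - Domain M = {} \<longleftrightarrow> B - Range M = {}"
    using card_unmatched[OF assms] by (metis card_0_eq finite_A finite_B finite_Diff)
  then show ?thesis
    using Domain_matching[OF assms] Range_matching[OF assms] unfolding perfect_def by blast
qed

text \<open>The levels cancel except on the objects that \<open>N\<close> misses. These are as many
  as the agents that \<open>N\<close> leaves unmatched, so their levels, each at most \<kappa>, are
  paid for by the votes -\<kappa> of those agents.\<close>

lemma level_matching_popular:
  assumes M: "matching (level_graph E pref l) M" and "perfect A B M"
    and le: "\<And>b. b \<in> B \<Longrightarrow> l b \<le> \<kappa>"
  shows "popular_with_penalty A E pref \<kappa> M"
  unfolding popular_with_penalty_def
proof (intro conjI allI impI)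
  show ME: "matching E M" using M level_graph_subset by (rule matching_mono)
  have dom: "Domain M = A" "Range M = B"
    using \<open>perfect A B M\<close> by (auto simp: perfect_def)
  fix N assume N: "matching E N"
  define D where "D = Domain N"
  have D: "D \<subseteq> A" "finite D" using Domain_matching[OF N] finite_subset[OF Domain_matching[OF N]] unfolding D_def by simp_all
  have R: "Range N \<subseteq> B" using Range_matching[OF N] .
  have v1: "vote pref \<kappa> N M a \<le> int (l (partner M a)) - int (l (partner N a))" if "a \<in> D" for a
  proof -
    have aN: "(a, partner N a) \<in> E"
      using partner_in[OF N] that N matching_subset D_def by blast
    have aM: "(a, partner M a) \<in> level_graph E pref l"
      using partner_in[OF M] that D dom M matching_subset by blast
    have "pref_sign pref a (partner N a) (partner M a) + int (l (partner N a)) \<le> int (l (partner M a))"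
      using aM aN by (auto simp: level_graph_iff nbr_def)
    then show ?thesis
      using that D dom by (auto simp: vote_def pref_sign_def D_def split: if_splits)
  qed
  have v2: "vote pref \<kappa> N M a = - int \<kappa>" if "a \<in> A - D" for a
    using that dom by (auto simp: vote_def D_def)
  have "(\<Sum>a\<in>A. vote pref \<kappa> N M a) = (\<Sum>a\<in>D. vote pref \<kappa> N M a) + (\<Sum>a\<in>A - D. vote pref \<kappa> N M a)"
    using sum.subset_diff[OF D(1), of "vote pref \<kappa> N M"] by simp
  also have "(\<Sum>a\<in>D. vote pref \<kappa> N M a) \<le> (\<Sum>a\<in>D. int (l (partner M a)) - int (l (partner N a)))"
    by (rule sum_mono) (rule v1)
  also have "(\<Sum>a\<in>A - D. vote pref \<kappa> N M a) = - int \<kappa> * int (card (A - D))"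
    using v2 by simp
  also have "(\<Sum>a\<in>D. int (l (partner M a)) - int (l (partner N a)))
      = (\<Sum>a\<in>D. int (l (partner M a))) - (\<Sum>b\<in>Range N. int (l b))"
    using sum.reindex_bij_betw[OF bij_betw_partner[OF N], of "\<lambda>b. int (l b)"]
    by (simp add: sum_subtractf D_def)
  also have "(\<Sum>a\<in>D. int (l (partner M a))) \<le> (\<Sum>a\<in>A. int (l (partner M a)))"
    by (rule sum_mono2) (use D in auto)
  also have "\<dots> = (\<Sum>b\<in>B. int (l b))"
    using sum.reindex_bij_betw[OF bij_betw_partner[OF ME], of "\<lambda>b. int (l b)"] dom by simp
  also have "\<dots> = (\<Sum>b\<in>B - Range N. int (l b)) + (\<Sum>b\<in>Range N. int (l b))"
    using sum.subset_diff[OF R, of "\<lambda>b. int (l b)"] by simp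
  also have "(\<Sum>b\<in>B - Range N. int (l b)) \<le> (\<Sum>b\<in>B - Range N. int \<kappa>)"
    by (rule sum_mono) (use le in auto)
  finally show "(\<Sum>a\<in>A. vote pref \<kappa> N M a) \<le> 0"
    using card_unmatched[OF N] by (simp add: D_def)
qed

lemma tight_raised:
  assumes M: "maximum_matching (level_graph E pref l) M"
    and S: "matching (level_graph E pref h) S" and pS: "perfect A B S"
    and le: "\<And>b. b \<in> B \<Longrightarrow> l b \<le> h b"
    and b0: "b0 \<in> B" "b0 \<notin> Range M"
  shows "l b0 < h b0"
proof (rule ccontr)
  assume "\<not> l b0 < h b0"
  then have tight0: "l b0 = h b0" using le[OF b0(1)] by simp
  have MM: "matching (level_graph E pref l) M" using M by (simp add: maximum_matching_def)
  have ME: "matching E M" and SE: "matching E S"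
    using MM S level_graph_subset matching_mono by blast+
  \<comment> \<open>Everything reachable from \<open>b0\<close> is swapped instead of a single path.
    Inside \<open>R\<close> the matching \<open>S\<close> covers every object, whereas
    \<open>M\<close> misses \<open>b0\<close>; this is where the extra edge comes from.\<close>
  define R where "R = {b. (b0, b) \<in> {(b, b'). \<exists>a. (a, b) \<in> S \<and> (a, b') \<in> M}\<^sup>*}"
  have R0: "b0 \<in> R" by (simp add: R_def)
  have Rstep: "b' \<in> R" if "b \<in> R" "(a, b) \<in> S" "(a, b') \<in> M" for a b b'
    using that unfolding R_def by (auto intro: rtrancl.rtrancl_into_rtrancl)
  have Rtight: "b \<in> B \<and> l b = h b" if "b \<in> R" for b
  proof -
    from that have "(b0, b) \<in> {(b, b'). \<exists>a. (a, b) \<in> S \<and> (a, b') \<in> M}\<^sup>*" by (simp add: R_def)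
    then show ?thesis
    proof induction
      case base
      then show ?case using b0 tight0 by simp
    next
      case (step b b')
      then obtain a where a: "(a, b) \<in> S" "(a, b') \<in> M" by blast
      have aS: "(a, b) \<in> level_graph E pref h" using a S matching_subset by blast
      have aM: "(a, b') \<in> level_graph E pref l" using a MM matching_subset by blast
      have nb: "b \<in> nbr E a" "b' \<in> nbr E a"
        using aS aM level_graph_subset by (auto simp: nbr_def)
      \<comment> \<open>Tightness travels along the alternating step: the two signs are opposite, so
        adding the inequalities gives \<open>h b' - l b' \<le> h b - l b\<close>, which is
        0.\<close>
      have "pref_sign pref a b' b + int (h b') \<le> int (h b)" "pref_sign pref a b b' + int (l b) \<le> int (l b')"
        using aS aM nb by (auto simp: level_graph_iff)
      then have "h b' \<le> l b'" using step.IH pref_sign_antisym[OF nb] by auto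
      moreover have "b' \<in> B" using nb nbr_subset by blast
      ultimately show ?case using le[of b'] by simp
    qed
  qed
  define M1 where "M1 = {(a, b) \<in> M. b \<notin> R}"
  define M2 where "M2 = {(a, b) \<in> S. b \<in> R}"
  \<comment> \<open>At a tight object the right side of the constraint is the same for
    \<open>h\<close> and \<open>l\<close>, and the left side can only shrink when \<open>h\<close>
    is replaced by \<open>l\<close>.\<close>
  have "M2 \<subseteq> level_graph E pref l"
  proof
    fix e assume "e \<in> M2"
    then obtain a b where e: "e = (a, b)" "(a, b) \<in> S" "b \<in> R" by (auto simp: M2_def)
    have aS: "(a, b) \<in> level_graph E pref h" using e S matching_subset by blast
    have "pref_sign pref a b' b + int (l b') \<le> int (l b)" if "b' \<in> nbr E a" for b'
    proof -
      have "pref_sign pref a b' b + int (h b') \<le> int (h b)" using aS that by (auto simp: level_graph_iff)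
      moreover have "l b' \<le> h b'" using le that nbr_subset by blast
      ultimately show ?thesis using Rtight[OF e(3)] by simp
    qed
    then show "e \<in> level_graph E pref l" using aS e by (simp add: level_graph_iff)
  qed
  moreover have "M1 \<subseteq> level_graph E pref l" using MM matching_subset unfolding M1_def by blast
  \<comment> \<open>No agent is used twice: if \<open>S\<close> gives it an object of
    \<open>R\<close>, then by \<open>Rstep\<close> its partner in \<open>M\<close> lies in
    \<open>R\<close> as well and has been dropped.\<close>
  ultimately have "matching (level_graph E pref l) (M1 \<union> M2)"
    using matching_left_unique[OF MM] matching_right_unique[OF MM]
      matching_left_unique[OF S] matching_right_unique[OF S] Rstep
    by (intro matchingI) (auto simp: M1_def M2_def)
  then have "card (M1 \<union> M2) \<le> card M" using M by (simp add: maximum_matching_def)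
  moreover have "card (M1 \<union> M2) = card M1 + card M2"
    using finite_matching[OF ME] finite_matching[OF SE]
    by (intro card_Un_disjoint) (auto simp: M1_def M2_def intro: finite_subset)
  moreover have "card M = card M1 + card (M - M1)"
  proof -
    have "M1 \<subseteq> M" by (auto simp: M1_def)
    then show ?thesis
      using finite_matching[OF ME] card_mono[of M M1]
      by (simp add: card_Diff_subset finite_subset[of M1 M])
  qed
  moreover have "card (M - M1) < card M2"
  proof -
    have mm: "matching E (M - M1)" "matching E M2"
      using ME SE by (auto simp: M2_def intro: matching_subset_matching)
    have "Range (M - M1) \<subseteq> R - {b0}" using b0 by (auto simp: M1_def)
    moreover have "Range M2 = R"
      using pS Rtight by (auto simp: M2_def perfect_def Range_iff set_eq_iff)
    moreover have "finite R" using Rtight finite_subset[of R B] by auto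
    ultimately have "finite (Range M2)" "Range (M - M1) \<subset> Range M2"
      using R0 by blast+
    then have "card (Range (M - M1)) < card (Range M2)"
      by (rule psubset_card_mono)
    then show ?thesis by (simp add: card_Range_matching[OF mm(1)] card_Range_matching[OF mm(2)])
  qed
  ultimately show False by linarith
qed

section \<open>Correctness of the truncated algorithm\<close>

lemma finite_level_graph: "finite (level_graph E pref l)"
  using level_graph_subset by (rule finite_subset) simp

lemma maximum_matching_exists: "\<exists>M. maximum_matching (level_graph E pref l) M"
proof -
  let ?P = "\<lambda>n. \<exists>M. matching (level_graph E pref l) M \<and> card M = n"
  have "?P (card {})" by (auto simp: matching_def intro!: exI[of _ "{}"])
  moreover have bound: "n \<le> card (level_graph E pref l)" if "?P n" for n
    using that finite_level_graph by (auto intro: card_mono dest: matching_subset)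
  ultimately have "?P (Greatest ?P)" by (rule GreatestI_nat)
  then obtain M where M: "matching (level_graph E pref l) M" "card M = Greatest ?P" by blast
  have "card M' \<le> card M" if "matching (level_graph E pref l) M'" for M'
    unfolding M(2) using that bound by (intro Greatest_le_nat) auto
  then show ?thesis using M(1) unfolding maximum_matching_def by blast
qed

lemma not_final_Running: "\<not> final_config A B E pref \<kappa> (Running l)"
proof (cases "\<forall>b\<in>B. l b < \<kappa> + 1")
  case True
  obtain M where M: "maximum_matching (level_graph E pref l) M"
    using maximum_matching_exists by blast
  then show ?thesis
    using M trunc_step.accept[OF True, of E pref M A] trunc_step.raise[OF True, of E pref M A]
    unfolding final_config_def by blast
next
  case False
  then show ?thesis
    using trunc_step.reject[of B \<kappa> l A E pref] unfolding final_config_def by (auto simp: not_less)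
qed

lemma final_Returned: "final_config A B E pref \<kappa> (Returned M)"
  and final_Rejected: "final_config A B E pref \<kappa> Rejected"
  by (auto simp: final_config_def elim: trunc_step.cases)

lemma unmatched_object:
  assumes "matching E M" "\<not> perfect A B M"
  obtains b where "b \<in> B" "b \<notin> Range M"
  using assms perfect_iff_Range by blast

text \<open>The termination measure. The loop guard keeps every summand positive, so truncated
  subtraction cannot hide the raise of \<open>b\<close>.\<close>

lemma level_deficit_decreases:
  assumes le: "\<forall>b\<in>B. l b < \<kappa> + 1" and b: "b \<in> B" "b \<notin> Range M"
  shows "(\<Sum>b\<in>B. \<kappa> + 1 - raise_unmatched B M l b) < (\<Sum>b\<in>B. \<kappa> + 1 - l b)"
  using le b by (intro sum_strict_mono_ex1) (auto simp: raise_unmatched_def intro!: bexI[of _ b])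

lemma termip_trunc_step: "termip (trunc_step A B E pref \<kappa>) c"
proof -
  let ?r = "(trunc_step A B E pref \<kappa>)\<inverse>\<inverse>"
  have ret: "Wellfounded.accp ?r (Returned M)" for M
    by (rule accpI) (auto elim: trunc_step.cases)
  have rej: "Wellfounded.accp ?r Rejected"
    by (rule accpI) (auto elim: trunc_step.cases)
  have run: "Wellfounded.accp ?r (Running l)" for l
  proof (induction "\<Sum>b\<in>B. \<kappa> + 1 - l b" arbitrary: l rule: less_induct)
    case less
    show ?case
    proof (rule accpI)
      fix c assume "?r c (Running l)"
      then have "trunc_step A B E pref \<kappa> (Running l) c" by simp
      then show "Wellfounded.accp ?r c"
      proof cases
        case (raise M)
        have "matching E M"
          using raise(3) level_graph_subset matching_mono unfolding maximum_matching_def by blast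
        then obtain b where b: "b \<in> B" "b \<notin> Range M" using raise(4) unmatched_object by blast
        show ?thesis
          unfolding raise(1) by (rule less.hyps) (rule level_deficit_decreases[OF raise(2) b])
      qed (use ret rej in auto)
    qed
  qed
  show ?thesis using ret rej run by (cases c) auto
qed

section \<open>Levels obtained from a popular assignment\<close>

definition gain :: "('a \<times> 'b) set \<Rightarrow> 'a \<Rightarrow> 'a \<Rightarrow> int" where
  "gain M a a' = pref_sign pref a (partner M a') (partner M a)"

text \<open>The exchange digraph of \<open>M\<close>: contracting the matched edges turns
  alternating paths and cycles into paths and cycles of agents, weighted by
  \<open>gain\<close>.\<close>

definition arc :: "('a \<times> 'b) set \<Rightarrow> 'a \<Rightarrow> 'a \<Rightarrow> bool" where
  "arc M a a' \<longleftrightarrow> (a, partner M a') \<in> E"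

fun path_gain :: "('a \<times> 'b) set \<Rightarrow> 'a list \<Rightarrow> int" where
  "path_gain M (x # y # zs) = gain M x y + path_gain M (y # zs)"
| "path_gain M _ = 0"

definition agent_path :: "('a \<times> 'b) set \<Rightarrow> 'a list \<Rightarrow> bool" where
  "agent_path M xs \<longleftrightarrow> xs \<noteq> [] \<and> distinct xs \<and> set xs \<subseteq> A \<and> successively (arc M) xs"

lemma path_gain_append: "path_gain M (xs @ y # zs) = path_gain M (xs @ [y]) + path_gain M (y # zs)"
proof (induction xs)
  case (Cons x xs)
  then show ?case by (cases xs) auto
qed simp

text \<open>Compares \<open>M\<close> with the matching that gives every \<open>a \<in> D\<close> the partner of \<open>\<sigma> a\<close> in \<open>M\<close>.\<close>

lemma swap_gain_le:
  assumes M: "assignment A B E M" and pop: "popular_with_penalty A E pref \<kappa> M"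
    and D: "D \<subseteq> A" and inj: "inj_on \<sigma> D" and ran: "\<sigma> ` D \<subseteq> A" and arcs: "\<And>a. a \<in> D \<Longrightarrow> arc M a (\<sigma> a)"
  shows "(\<Sum>a\<in>D. gain M a (\<sigma> a)) \<le> int (\<kappa> * card (A - D))"
proof -
  have ME: "matching E M" and dom: "Domain M = A"
    using M by (auto simp: assignment_def perfect_def)
  define N where "N = (\<lambda>a. (a, partner M (\<sigma> a))) ` D"
  have injp: "inj_on (partner M) A" using bij_betw_partner[OF ME] dom by (simp add: bij_betw_def)
  have N: "matching E N"
  proof (rule matchingI)
    show "N \<subseteq> E" using arcs by (auto simp: N_def arc_def)
  next
    fix a a' b assume "(a, b) \<in> N" "(a', b) \<in> N"
    then show "a = a'"
      using inj injp ran unfolding N_def inj_on_def by (auto simp: image_subset_iff)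
  qed (auto simp: N_def)
  have domN: "Domain N = D" by (auto simp: N_def)
  have pN: "partner N a = partner M (\<sigma> a)" if "a \<in> D" for a
    using that by (intro partner_eq[OF N]) (simp add: N_def)
  have "vote pref \<kappa> N M a = gain M a (\<sigma> a)" if "a \<in> D" for a
    using that D dom domN pN by (auto simp: vote_def gain_def pref_sign_def)
  moreover have "vote pref \<kappa> N M a = - int \<kappa>" if "a \<in> A - D" for a
    using that dom domN by (auto simp: vote_def)
  moreover have "(\<Sum>a\<in>A. vote pref \<kappa> N M a) \<le> 0"
    using pop N by (simp add: popular_with_penalty_def)
  moreover have "(\<Sum>a\<in>A. vote pref \<kappa> N M a) = (\<Sum>a\<in>D. vote pref \<kappa> N M a) + (\<Sum>a\<in>A - D. vote pref \<kappa> N M a)"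
    using sum.subset_diff[OF D, of "vote pref \<kappa> N M"] by simp
  ultimately show ?thesis by (simp add: mult.commute)
qed

text \<open>Turns a list into a successor map on all its agents but the last, so that the gain of
  the path becomes a sum over a set, the form required by \<open>swap_gain_le\<close>.\<close>

lemma path_successor:
  assumes "xs \<noteq> []" "distinct xs" "successively (arc M) xs"
  shows "\<exists>\<sigma>. bij_betw \<sigma> (set (butlast xs)) (set (tl xs)) \<and> (\<forall>a\<in>set (butlast xs). arc M a (\<sigma> a)) \<and>
    (\<Sum>a\<in>set (butlast xs). gain M a (\<sigma> a)) = path_gain M xs"
  using assms
proof (induction xs rule: induct_list012)
  case (3 x y zs)
  then obtain \<sigma> where \<sigma>: "bij_betw \<sigma> (set (butlast (y # zs))) (set zs)"
    "\<forall>a\<in>set (butlast (y # zs)). arc M a (\<sigma> a)"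
    "(\<Sum>a\<in>set (butlast (y # zs)). gain M a (\<sigma> a)) = path_gain M (y # zs)"
    by auto
  let ?S = "set (butlast (y # zs))"
  have x: "x \<notin> ?S" using 3(3-) in_set_butlastD[of x "y # zs"] 3 by auto
  have "bij_betw (\<sigma>(x := y)) ?S (set zs)"
    using \<sigma>(1) x by (subst bij_betw_cong[of _ _ \<sigma>]) auto
  moreover have "y \<notin> set zs" using 3 by simp
  ultimately have "bij_betw (\<sigma>(x := y)) (insert x ?S) (insert y (set zs))"
    using x notIn_Un_bij_betw[of x ?S "\<sigma>(x := y)" "set zs"] by simp
  moreover have "(\<Sum>a\<in>?S. gain M a ((\<sigma>(x := y)) a)) = (\<Sum>a\<in>?S. gain M a (\<sigma> a))"
    using x by (intro sum.cong) auto
  then have "(\<Sum>a\<in>insert x ?S. gain M a ((\<sigma>(x := y)) a)) = path_gain M (x # y # zs)"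
    using x \<sigma>(3) by simp
  moreover have "arc M x y" using 3 by simp
  then have "\<forall>a\<in>insert x ?S. arc M a ((\<sigma>(x := y)) a)" using \<sigma>(2) x by auto
  moreover have "set (butlast (x # y # zs)) = insert x ?S" "set (tl (x # y # zs)) = insert y (set zs)"
    by simp_all
  ultimately show ?case by (intro exI[of _ "\<sigma>(x := y)"]) (simp only: simp_thms)
qed (auto simp: bij_betw_def)

text \<open>Agents on the path take the partner of their successor and all others keep theirs. The
  last agent either stays unmatched, at a price of \<kappa>, or closes the cycle at no
  price.\<close>

lemma path_gain_bounds:
  assumes M: "assignment A B E M" and pop: "popular_with_penalty A E pref \<kappa> M"
    and xs: "agent_path M xs"
  shows path_gain_le: "path_gain M xs \<le> int \<kappa>"
    and cycle_gain_le: "arc M (last xs) (hd xs) \<Longrightarrow> path_gain M xs + gain M (last xs) (hd xs) \<le> 0"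
proof -
  have xs': "xs \<noteq> []" "distinct xs" "set xs \<subseteq> A" "successively (arc M) xs"
    using xs by (auto simp: agent_path_def)
  have ME: "matching E M" and dom: "Domain M = A"
    using M by (auto simp: assignment_def perfect_def)
  obtain \<sigma> where \<sigma>: "bij_betw \<sigma> (set (butlast xs)) (set (tl xs))"
    "\<And>a. a \<in> set (butlast xs) \<Longrightarrow> arc M a (\<sigma> a)"
    "(\<Sum>a\<in>set (butlast xs). gain M a (\<sigma> a)) = path_gain M xs"
    using path_successor[OF xs'(1,2,4)] by blast
  let ?S = "set (butlast xs)"
  obtain ys z where ys: "xs = ys @ [z]" using xs'(1) by (cases xs rule: rev_cases) auto
  obtain x zs where zs: "xs = x # zs" using xs'(1) by (cases xs) auto
  have S: "set xs = insert (last xs) ?S" "last xs \<notin> ?S"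
    using xs'(2) unfolding ys by auto
  have S': "set xs = insert (hd xs) (set (tl xs))" "hd xs \<notin> set (tl xs)"
    using xs'(2) unfolding zs by auto
  have idgain: "gain M a a = 0" and idarc: "arc M a a" if "a \<in> A" for a
  proof -
    have "(a, partner M a) \<in> E" using that partner_in[OF ME] dom matching_subset[OF ME] by blast
    then show "arc M a a" "gain M a a = 0"
      using pref_irrefl[of "partner M a" a] by (auto simp: arc_def gain_def pref_sign_def nbr_def)
  qed
  \<comment> \<open>A permutation of all agents, whether or not the closing arc exists. The bound
    for paths simply omits the last agent from the domain of the swap.\<close>
  define \<tau> where "\<tau> = (\<lambda>a. if a \<in> ?S then \<sigma> a else if a = last xs then hd xs else a)"
  have bS: "bij_betw \<tau> ?S (set (tl xs))"
    using \<sigma>(1) by (subst bij_betw_cong[of _ _ \<sigma>]) (auto simp: \<tau>_def)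
  have bxs: "bij_betw \<tau> (set xs) (set xs)"
  proof -
    have "\<tau> (last xs) = hd xs" using S(2) by (simp add: \<tau>_def)
    then have "bij_betw \<tau> (insert (last xs) ?S) (insert (hd xs) (set (tl xs)))"
      using notIn_Un_bij_betw[OF S(2) _ bS] S'(2) by simp
    then show ?thesis by (simp only: S(1)[symmetric] S'(1)[symmetric])
  qed
  have "bij_betw \<tau> (A - set xs) (A - set xs)"
    by (subst bij_betw_cong[of _ _ id]) (auto simp: \<tau>_def S(1))
  then have bA: "bij_betw \<tau> A A"
    using bij_betw_combine[OF bxs, of "A - set xs" "A - set xs"] xs'(3) by (simp add: Un_absorb1)
  have sum_id: "(\<Sum>a\<in>A - set xs. gain M a (\<tau> a)) = 0"
    using S(1) by (intro sum.neutral) (auto simp: \<tau>_def idgain)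
  have sumS: "(\<Sum>a\<in>?S. gain M a (\<tau> a)) = path_gain M xs"
    using \<sigma>(3) by (simp add: \<tau>_def)
  have arcs: "arc M a (\<tau> a)" if "a \<in> A" "a \<noteq> last xs" for a
    using that \<sigma>(2) idarc by (auto simp: \<tau>_def)
  have lastA: "last xs \<in> A" using xs' by auto
  have "(\<Sum>a\<in>A - {last xs}. gain M a (\<tau> a)) \<le> int (\<kappa> * card (A - (A - {last xs})))"
    using bA by (intro swap_gain_le[OF M pop]) (auto simp: bij_betw_def intro: inj_on_subset arcs)
  moreover have "A - (A - {last xs}) = {last xs}" using lastA by auto
  moreover have eq: "A - {last xs} = (A - set xs) \<union> ?S" using S xs'(3) by auto
  moreover have sumA: "(\<Sum>a\<in>A - {last xs}. gain M a (\<tau> a)) = path_gain M xs"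
    unfolding eq using S(1) sumS sum_id by (subst sum.union_disjoint) auto
  ultimately show "path_gain M xs \<le> int \<kappa>" by simp
  show "path_gain M xs + gain M (last xs) (hd xs) \<le> 0" if "arc M (last xs) (hd xs)"
  proof -
    have \<tau>l: "\<tau> (last xs) = hd xs" using S(2) by (simp add: \<tau>_def)
    have "arc M a (\<tau> a)" if "a \<in> A" for a
      using arcs[OF that] \<open>arc M (last xs) (hd xs)\<close> \<tau>l by (cases "a = last xs") simp_all
    then have "(\<Sum>a\<in>A. gain M a (\<tau> a)) \<le> int (\<kappa> * card (A - A))"
      using bA by (intro swap_gain_le[OF M pop]) (simp_all add: bij_betw_def)
    moreover have "(\<Sum>a\<in>A. gain M a (\<tau> a)) = gain M (last xs) (hd xs) + path_gain M xs"
      using sum.remove[OF finite_A lastA, of "\<lambda>a. gain M a (\<tau> a)"] sumA \<tau>l by simp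
    ultimately show ?thesis by simp
  qed
qed

text \<open>Longest simple paths obey the triangle inequality \<open>vstep\<close> because cycles
  gain nothing; read on a matched edge, \<open>vstep\<close> is the dual constraint.\<close>

lemma popular_assignment_levels:
  assumes M: "assignment A B E M" and pop: "popular_with_penalty A E pref \<kappa> M"
  obtains h where "matching (level_graph E pref h) M" "\<And>b. b \<in> B \<Longrightarrow> h b \<le> \<kappa>"
proof -
  have ME: "matching E M" and dom: "Domain M = A" "Range M = B"
    using M by (auto simp: assignment_def perfect_def)
  \<comment> \<open>Repetitions are excluded to make the set of paths finite, so that the maximum
    exists.\<close>
  define P where "P x = {xs. agent_path M xs \<and> hd xs = x}" for x
  have finP: "finite (P x)" for x
  proof -
    have "finite {xs. set xs \<subseteq> A \<and> length xs \<le> card A}" by (rule finite_lists_length_le) simp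
    moreover have "P x \<subseteq> {xs. set xs \<subseteq> A \<and> length xs \<le> card A}"
    proof
      fix xs assume "xs \<in> P x"
      then have "distinct xs" "set xs \<subseteq> A" by (simp_all add: P_def agent_path_def)
      then show "xs \<in> {xs. set xs \<subseteq> A \<and> length xs \<le> card A}"
        using card_mono[OF finite_A, of "set xs"] by (simp add: distinct_card)
    qed
    ultimately show ?thesis by (rule rev_finite_subset)
  qed
  have sP: "[x] \<in> P x" if "x \<in> A" for x using that by (simp add: P_def agent_path_def)
  define v where "v x = Max (path_gain M ` P x)" for x
  have v_ge: "path_gain M xs \<le> v x" if "xs \<in> P x" for x xs
    using that finP by (simp add: v_def)
  have v_in: "\<exists>xs\<in>P x. v x = path_gain M xs" if "x \<in> A" for x
  proof -
    have "v x \<in> path_gain M ` P x"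
      unfolding v_def using sP[OF that] by (intro Max_in finite_imageI finP) blast
    then show ?thesis by blast
  qed
  have v0: "0 \<le> v x" if "x \<in> A" for x using v_ge[OF sP[OF that]] by simp
  have vk: "v x \<le> int \<kappa>" if x: "x \<in> A" for x
  proof -
    obtain xs where "agent_path M xs" "v x = path_gain M xs"
      using v_in[OF x] unfolding P_def by blast
    then show ?thesis using path_gain_le[OF M pop] by simp
  qed
  have vstep: "gain M x y + v y \<le> v x" if xy: "x \<in> A" "y \<in> A" "arc M x y" for x y
  proof -
    obtain ys where ys: "agent_path M ys" "hd ys = y" "v y = path_gain M ys"
      using v_in[OF xy(2)] unfolding P_def by blast
    then obtain zs where zs: "ys = y # zs" by (cases ys) (auto simp: agent_path_def)
    show ?thesis
    proof (cases "x \<in> set ys")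
      case False
      then have "x # ys \<in> P x" using ys(1) xy unfolding zs by (simp add: P_def agent_path_def)
      then show ?thesis using v_ge[of "x # ys" x] ys zs by simp
    next
      \<comment> \<open>Prepending \<open>x\<close> would repeat it. The part of \<open>ys\<close>
        up to \<open>x\<close>, closed by the arc from \<open>x\<close> to \<open>y\<close>, is a
        cycle of gain at most 0, so the rest of \<open>ys\<close> from \<open>x\<close> on is
        already a good enough path.\<close>
      case True
      then obtain us ws where us: "ys = us @ x # ws" by (meson split_list)
      have p: "agent_path M (us @ x # ws)" using ys(1) us by simp
      have p1: "agent_path M (us @ [x])" and p2: "x # ws \<in> P x"
        using p by (auto simp: P_def agent_path_def successively_append_iff)
      have "hd (us @ [x]) = y" using ys(2) unfolding us by (cases us) simp_all
      then have "path_gain M (us @ [x]) + gain M x y \<le> 0"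
        using cycle_gain_le[OF M pop p1] xy(3) by simp
      moreover have "v y = path_gain M (us @ [x]) + path_gain M (x # ws)"
        unfolding ys(3) us by (rule path_gain_append)
      ultimately show ?thesis using v_ge[OF p2] by simp
    qed
  qed
  define inv_p where "inv_p = the_inv_into A (partner M)"
  have bij: "bij_betw (partner M) A B" using bij_betw_partner[OF ME] dom by simp
  have ip: "inv_p (partner M a) = a" if "a \<in> A" for a
    using that bij by (simp add: inv_p_def bij_betw_def the_inv_into_f_f)
  have ipB: "\<exists>a\<in>A. b = partner M a \<and> inv_p b = a" if "b \<in> B" for b
  proof -
    have "b \<in> partner M ` A" using that bij by (simp add: bij_betw_def)
    then show ?thesis using ip by blast
  qed
  \<comment> \<open>The conversion loses nothing: the path consisting of one agent has gain 0, so
    \<open>v\<close> is nonnegative.\<close>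
  define h where "h b = nat (v (inv_p b))" for b
  have "(a, b) \<in> level_graph E pref h" if "(a, b) \<in> M" for a b
  proof -
    have ab: "(a, b) \<in> E" "a \<in> A" "b = partner M a"
      using that ME matching_subset dom partner_eq[OF ME that] by (blast, blast, simp)
    have "pref_sign pref a b' b + int (h b') \<le> int (h b)" if b': "b' \<in> nbr E a" for b'
    proof -
      obtain a' where a': "a' \<in> A" "b' = partner M a'" "inv_p b' = a'"
        using ipB b' nbr_subset by blast
      have "gain M a a' + v a' \<le> v a"
        using vstep[of a a'] ab a' b' by (simp add: arc_def nbr_def)
      then show ?thesis
        using v0 ab a' ip by (simp add: h_def gain_def)
    qed
    then show ?thesis using ab by (simp add: level_graph_iff)
  qed
  then have "M \<subseteq> level_graph E pref h" by auto
  then have "matching (level_graph E pref h) M"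
    using ME by (simp add: matching_def)
  moreover have "h b \<le> \<kappa>" if "b \<in> B" for b
  proof -
    obtain a where "a \<in> A" "inv_p b = a" using ipB[OF \<open>b \<in> B\<close>] by blast
    then show ?thesis using vk[of a] by (simp add: h_def)
  qed
  ultimately show ?thesis using that by blast
qed

text \<open>By \<open>tight_raised\<close> only objects strictly below \<open>h\<close> are raised,
  so \<open>h\<close> remains an upper bound; rejection would need a level above \<kappa>.\<close>

lemma trunc_step_levels_bounded:
  assumes S: "matching (level_graph E pref h) S" "perfect A B S" and h: "\<And>b. b \<in> B \<Longrightarrow> h b \<le> \<kappa>"
    and reach: "(trunc_step A B E pref \<kappa>)\<^sup>*\<^sup>* initial c"
  shows "(case c of Running l \<Rightarrow> \<forall>b\<in>B. l b \<le> h b | Returned M \<Rightarrow> True | Rejected \<Rightarrow> False)"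
  using reach
proof (induction rule: rtranclp_induct)
  case base
  then show ?case by (simp add: initial_def)
next
  case (step c c')
  from step(2) show ?case
  proof cases
    case (raise l M)
    have "raise_unmatched B M l b \<le> h b" if "b \<in> B" for b
      using tight_raised[OF raise(4) S, of b] that step.IH raise(1)
      by (auto simp: raise_unmatched_def Suc_le_eq)
    then show ?thesis using raise by simp
  next
    case (reject l)
    then show ?thesis using step.IH h by fastforce
  qed simp
qed

lemma trunc_step_Returned:
  assumes "trunc_step A B E pref \<kappa> c (Returned M)"
  shows "assignment A B E M \<and> popular_with_penalty A E pref \<kappa> M"
  using assms
proof cases
  case (accept l)
  then have m: "matching (level_graph E pref l) M" by (simp add: maximum_matching_def)
  have "popular_with_penalty A E pref \<kappa> M"
    using accept by (intro level_matching_popular[OF m]) auto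
  then show ?thesis using accept by (simp add: assignment_def popular_with_penalty_def)
qed

lemma final_config_correct:
  assumes M: "assignment A B E M" and pop: "popular_with_penalty A E pref \<kappa> M"
    and reach: "(trunc_step A B E pref \<kappa>)\<^sup>*\<^sup>* initial c" and final: "final_config A B E pref \<kappa> c"
  shows "\<exists>M. c = Returned M \<and> assignment A B E M \<and> popular_with_penalty A E pref \<kappa> M"
proof -
  obtain h where h: "matching (level_graph E pref h) M" "\<And>b. b \<in> B \<Longrightarrow> h b \<le> \<kappa>"
    using popular_assignment_levels[OF M pop] by blast
  have "perfect A B M" using M by (simp add: assignment_def)
  note inv = trunc_step_levels_bounded[OF h(1) this h(2) reach]
  then obtain M' where c: "c = Returned M'"
    using final not_final_Running by (cases c) auto
  have "c \<noteq> initial" using c by (simp add: initial_def)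
  with reach obtain c' where "trunc_step A B E pref \<kappa> c' c"
    by (cases rule: rtranclp.cases) auto
  then show ?thesis using trunc_step_Returned[of \<kappa> c' M'] c by simp
qed

end

section \<open>A time-counting program logic\<close>

text \<open>Fixes the time at which \<open>Skip\<close> is first reached. Since
  \<open>ram_step\<close> idles on \<open>Skip\<close>, the state reached by \<open>ram_at\<close>
  would not determine this time.\<close>

fun runs :: "com \<Rightarrow> store \<Rightarrow> nat \<Rightarrow> store \<Rightarrow> bool" where
  "runs c s 0 s' \<longleftrightarrow> c = Skip \<and> s' = s"
| "runs c s (Suc t) s' \<longleftrightarrow> c \<noteq> Skip \<and> runs (fst (ram_step (c, s))) (snd (ram_step (c, s))) t s'"

lemma ram_at_0 [simp]: "ram_at c s 0 = (c, s)"
  by (simp add: ram_at_def)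

lemma ram_at_Suc: "ram_at c s (Suc t) = ram_at (fst (ram_step (c, s))) (snd (ram_step (c, s))) t"
  by (simp add: ram_at_def funpow_swap1 del: funpow.simps(2)) (simp add: funpow_swap1)

lemma ram_at_add: "ram_at c s (t + u) = ram_at (fst (ram_at c s t)) (snd (ram_at c s t)) u"
  by (induction t arbitrary: c s) (simp_all add: ram_at_Suc)

lemma runs_Seq_ram_at: "runs c1 s t s' \<Longrightarrow> ram_at (Seq c1 c2) s (Suc t) = (c2, s')"
proof (induction t arbitrary: c1 s)
  case 0
  then show ?case by (simp add: ram_at_Suc)
next
  case (Suc t)
  obtain c' s'' where c': "ram_step (c1, s) = (c', s'')" by fastforce
  have "ram_at (Seq c' c2) s'' (Suc t) = (c2, s')" using Suc c' by simp
  then show ?case using Suc.prems c' by (subst ram_at_Suc) simp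
qed

text \<open>The additional step is the one that discards the finished \<open>Skip\<close>.\<close>

lemma runs_Seq:
  "runs (Seq c1 c2) s t s' \<longleftrightarrow> (\<exists>t1 s1 t2. runs c1 s t1 s1 \<and> runs c2 s1 t2 s' \<and> t = t1 + 1 + t2)"
proof (induction t arbitrary: c1 s)
  case 0
  then show ?case by auto
next
  case (Suc t)
  show ?case
  proof (cases "c1 = Skip")
    case True
    then have "runs c1 s t1 s1 \<longleftrightarrow> t1 = 0 \<and> s1 = s" for t1 s1
      by (cases t1) auto
    then show ?thesis using True by simp
  next
    case False
    obtain c' s'' where c': "ram_step (c1, s) = (c', s'')" by fastforce
    have "runs c1 s t1 s1 \<longleftrightarrow> (\<exists>t0. t1 = Suc t0 \<and> runs c' s'' t0 s1)" for t1 s1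
      using False c' by (cases t1) auto
    then show ?thesis using False Suc.IH[of c' s''] c' by fastforce
  qed
qed

text \<open>The postcondition sees the exact running time. As the machine is deterministic,
  existence of a run is total correctness.\<close>

definition wp :: "com \<Rightarrow> (nat \<Rightarrow> store \<Rightarrow> bool) \<Rightarrow> store \<Rightarrow> bool" where
  "wp c Q s \<longleftrightarrow> (\<exists>t s'. runs c s t s' \<and> Q t s')"

lemma wp_Skip [simp]: "wp Skip Q s \<longleftrightarrow> Q 0 s"
proof -
  have "runs Skip s t s' \<longleftrightarrow> t = 0 \<and> s' = s" for t s'
    by (cases t) auto
  then show ?thesis by (simp add: wp_def)
qed

lemma wp_step: "c \<noteq> Skip \<Longrightarrow> wp c Q s \<longleftrightarrow> wp (fst (ram_step (c, s))) (\<lambda>t. Q (t + 1)) (snd (ram_step (c, s)))"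
proof -
  assume "c \<noteq> Skip"
  then have "runs c s t s' \<longleftrightarrow> (\<exists>u. t = Suc u \<and> runs (fst (ram_step (c, s))) (snd (ram_step (c, s))) u s')" for t s'
    by (cases t) auto
  then show ?thesis unfolding wp_def by auto
qed

lemma wp_Assign [simp]: "wp (Assign x is e) Q s \<longleftrightarrow> Q 1 (s(x := (s x)(map (aval s) is := aval s e)))"
  by (simp add: wp_step)

lemma wp_Seq [simp]: "wp (Seq c1 c2) Q s \<longleftrightarrow> wp c1 (\<lambda>t1. wp c2 (\<lambda>t2. Q (t1 + 1 + t2))) s"
  unfolding wp_def runs_Seq by blast

lemma wp_If [simp]:
  "wp (If b c1 c2) Q s \<longleftrightarrow>
     (bval s b \<longrightarrow> wp c1 (\<lambda>t. Q (t + 1)) s) \<and> (\<not> bval s b \<longrightarrow> wp c2 (\<lambda>t. Q (t + 1)) s)"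
  by (simp add: wp_step)

text \<open>Beyond its body an iteration takes two steps, for the test and for discarding the
  finished body.\<close>

lemma wp_While_unfold:
  "wp (While b c) Q s \<longleftrightarrow>
     (if bval s b then wp c (\<lambda>t. wp (While b c) (\<lambda>u. Q (t + 2 + u))) s else Q 1 s)"
  by (subst wp_step) (simp_all add: add.commute add.left_commute)

lemma wp_mono: "wp c Q s \<Longrightarrow> (\<And>t s'. Q t s' \<Longrightarrow> Q' t s') \<Longrightarrow> wp c Q' s"
  unfolding wp_def by blast

section \<open>Frame reasoning and loop rules\<close>

fun mods :: "com \<Rightarrow> string set" where
  "mods Skip = {}"
| "mods (Assign x is e) = {x}"
| "mods (Seq c1 c2) = mods c1 \<union> mods c2"
| "mods (If b c1 c2) = mods c1 \<union> mods c2"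
| "mods (While b c) = mods c"

definition agree :: "string set \<Rightarrow> store \<Rightarrow> store \<Rightarrow> bool" where
  "agree X s s' \<longleftrightarrow> (\<forall>y. y \<notin> X \<longrightarrow> s y = s' y)"

lemma agreeD: "agree X s s' \<Longrightarrow> y \<notin> X \<Longrightarrow> s y = s' y"
  by (simp add: agree_def)

lemma agree_refl [simp]: "agree X s s"
  by (simp add: agree_def)

lemma agree_trans: "agree X s s' \<Longrightarrow> agree X s' s'' \<Longrightarrow> agree X s s''"
  by (simp add: agree_def)

lemma agree_mono: "agree X s s' \<Longrightarrow> X \<subseteq> Y \<Longrightarrow> agree Y s s'"
  by (auto simp: agree_def)

lemma ram_step_mods:
  "mods (fst (ram_step (c, s))) \<subseteq> mods c \<and> agree (mods c) (snd (ram_step (c, s))) s"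
proof (induction c)
  case (Seq c1 c2)
  then show ?case by (auto simp: agree_def split: prod.splits)
qed (auto simp: agree_def)

lemma runs_mods: "runs c s t s' \<Longrightarrow> agree (mods c) s' s"
proof (induction t arbitrary: c s)
  case (Suc t)
  let ?c = "fst (ram_step (c, s))" and ?s = "snd (ram_step (c, s))"
  have "agree (mods ?c) s' ?s" using Suc by simp
  then have "agree (mods c) s' ?s" using ram_step_mods agree_mono by blast
  then show ?case using ram_step_mods agree_trans by blast
qed simp

text \<open>Adds to any specification that all other variables are unchanged, so specifications
  mention only what a command writes.\<close>

lemma wp_frame:
  assumes "wp c Q s" "\<And>t s'. Q t s' \<Longrightarrow> agree (mods c) s' s \<Longrightarrow> Q' t s'"
  shows "wp c Q' s"
  using assms runs_mods unfolding wp_def by blast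

text \<open>The number \<open>n\<close> in \<open>I n s\<close> is a time credit that pays for the remaining iterations.\<close>

lemma wp_While_credit:
  assumes "I n s0"
    and step: "\<And>n s. I n s \<Longrightarrow> bval s b \<Longrightarrow> agree (mods c) s s0 \<Longrightarrow>
      wp c (\<lambda>t s'. \<exists>n'. I n' s' \<and> t + 2 + n' \<le> n) s"
    and fin: "\<And>n' t s. I n' s \<Longrightarrow> \<not> bval s b \<Longrightarrow> agree (mods c) s s0 \<Longrightarrow> t + n' \<le> n + 1 \<Longrightarrow> Q t s"
  shows "wp (While b c) Q s0"
proof -
  have "wp (While b c) (\<lambda>t s'. \<exists>n'. I n' s' \<and> \<not> bval s' b \<and> agree (mods c) s' s0 \<and> t + n' \<le> n + 1) s"
    if "I n s" "agree (mods c) s s0" for n s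
    using that
  proof (induction n arbitrary: s rule: less_induct)
    case (less n)
    show ?case
    proof (cases "bval s b")
      case False
      then show ?thesis using less.prems by (subst wp_While_unfold) auto
    next
      case True
      from step[OF less.prems(1) True less.prems(2)]
      have "wp c (\<lambda>t. wp (While b c) (\<lambda>u s'. \<exists>n'. I n' s' \<and> \<not> bval s' b \<and> agree (mods c) s' s0 \<and> t + 2 + u + n' \<le> n + 1)) s"
      proof (rule wp_frame)
        fix t s' assume "\<exists>n'. I n' s' \<and> t + 2 + n' \<le> n" and a: "agree (mods c) s' s"
        then obtain n' where n': "I n' s'" "t + 2 + n' \<le> n" by blast
        have "agree (mods c) s' s0" using a less.prems agree_trans by blast
        with n' less.IH[of n' s']
        have "wp (While b c) (\<lambda>t s'. \<exists>n''. I n'' s' \<and> \<not> bval s' b \<and> agree (mods c) s' s0 \<and> t + n'' \<le> n' + 1) s'"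
          by simp
        then show "wp (While b c) (\<lambda>u s'. \<exists>n'. I n' s' \<and> \<not> bval s' b \<and> agree (mods c) s' s0 \<and> t + 2 + u + n' \<le> n + 1) s'"
          by (rule wp_mono) (use n' in fastforce)
      qed
      then show ?thesis using True by (subst wp_While_unfold) simp
    qed
  qed
  from this[OF assms(1) agree_refl] show ?thesis by (rule wp_mono) (auto intro: fin)
qed

lemma wp_While:
  assumes "I s0"
    and step: "\<And>s. I s \<Longrightarrow> bval s b \<Longrightarrow> agree (mods c) s s0 \<Longrightarrow>
      wp c (\<lambda>t s'. I s' \<and> t + 2 + \<mu> s' \<le> \<mu> s) s"
    and fin: "\<And>t s. I s \<Longrightarrow> \<not> bval s b \<Longrightarrow> agree (mods c) s s0 \<Longrightarrow> t + \<mu> s \<le> \<mu> s0 + 1 \<Longrightarrow> Q t s"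
  shows "wp (While b c) Q s0"
proof (rule wp_While_credit[where I = "\<lambda>n s. I s \<and> n = \<mu> s"])
  fix n s assume "I s \<and> n = \<mu> s" "bval s b" "agree (mods c) s s0"
  then show "wp c (\<lambda>t s'. \<exists>n'. (I s' \<and> n' = \<mu> s') \<and> t + 2 + n' \<le> n) s"
    using step[of s] by (auto elim: wp_mono)
qed (use assms in auto)

abbreviation V :: "string \<Rightarrow> aexp" where
  "V x \<equiv> Loc x []"

abbreviation Or :: "bexp \<Rightarrow> bexp \<Rightarrow> bexp" where
  "Or b1 b2 \<equiv> Not (And (Not b1) (Not b2))"

abbreviation Eq :: "aexp \<Rightarrow> aexp \<Rightarrow> bexp" where
  "Eq e1 e2 \<equiv> And (Not (Less e1 e2)) (Not (Less e2 e1))"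

abbreviation Seq_infix :: "com \<Rightarrow> com \<Rightarrow> com" (infixr ";;" 60) where
  "c1 ;; c2 \<equiv> Seq c1 c2"

definition For :: "string \<Rightarrow> aexp \<Rightarrow> com \<Rightarrow> com" where
  "For x e c = Assign x [] (Const 0) ;; While (Less (V x) e) (c ;; Assign x [] (Inc (V x)))"

definition upd :: "store \<Rightarrow> string \<Rightarrow> nat \<Rightarrow> store" where
  "upd s x v = s(x := (s x)([] := v))"

lemma mods_For [simp]: "mods (For x e c) = insert x (mods c)"
  by (auto simp: For_def)

text \<open>An amortised rule: \<open>f i\<close> is the budget of iteration \<open>i\<close>, and
  \<open>\<psi>\<close> carries savings from one iteration to the next. The 4 pays for the test, the
  increment and the discarding of two finished commands; the 3 for the initial assignment, its
  separator and the failing test.\<close>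

lemma wp_For_potential:
  assumes x: "x \<notin> mods c"
    and e: "\<And>s. agree (insert x (mods c)) s s0 \<Longrightarrow> aval s e = N"
    and init: "I 0 (upd s0 x 0)"
    and step: "\<And>i s. i < N \<Longrightarrow> I i s \<Longrightarrow> s x [] = i \<Longrightarrow> agree (insert x (mods c)) s s0 \<Longrightarrow>
      wp c (\<lambda>t s'. t + \<psi> (upd s' x (Suc i)) \<le> f i + \<psi> s \<and> I (Suc i) (upd s' x (Suc i))) s"
    and fin: "\<And>t s. I N s \<Longrightarrow> agree (insert x (mods c)) s s0 \<Longrightarrow>
      t + \<psi> s \<le> (\<Sum>i<N. f i + 4) + 3 + \<psi> (upd s0 x 0) \<Longrightarrow> Q t s"
  shows "wp (For x e c) Q s0"
proof -
  let ?b = "Less (V x) e" and ?c = "c ;; Assign x [] (Inc (V x))"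
  let ?F = "\<lambda>i. \<Sum>j\<in>{i..<N}. f j + 4"
  let ?I = "\<lambda>s. s x [] \<le> N \<and> I (s x []) s"
  let ?mu = "\<lambda>s. ?F (s x []) + \<psi> s"
  have ag: "agree (insert x (mods c)) s s0" if "agree (mods ?c) s (upd s0 x 0)" for s
    using that by (auto simp: agree_def upd_def)
  have "wp (While ?b ?c) (\<lambda>t. Q (2 + t)) (upd s0 x 0)"
  proof (rule wp_While[where I = ?I and \<mu> = ?mu])
    show "?I (upd s0 x 0)" using init by (simp add: upd_def)
  next
    fix s assume I: "?I s" and b: "bval s ?b" and a: "agree (mods ?c) s (upd s0 x 0)"
    have lt: "s x [] < N" using b e[OF ag[OF a]] by simp
    have F: "?F (s x []) = f (s x []) + 4 + ?F (Suc (s x []))"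
      using lt by (simp add: sum.atLeast_Suc_lessThan)
    have "wp c (\<lambda>t s'. t + \<psi> (upd s' x (Suc (s x []))) \<le> f (s x []) + \<psi> s
        \<and> I (Suc (s x [])) (upd s' x (Suc (s x [])))) s"
      using step[OF lt _ refl ag[OF a]] I by blast
    then have "wp c (\<lambda>t s'. ?I (upd s' x (Suc (s' x []))) \<and> t + 4 + ?mu (upd s' x (Suc (s' x []))) \<le> ?mu s) s"
    proof (rule wp_frame)
      fix t s' assume *: "t + \<psi> (upd s' x (Suc (s x []))) \<le> f (s x []) + \<psi> s
        \<and> I (Suc (s x [])) (upd s' x (Suc (s x [])))" and "agree (mods c) s' s"
      then have eq: "s' x [] = s x []" using x by (simp add: agreeD)
      have u: "upd s' x v x [] = v" for v by (simp add: upd_def)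
      show "?I (upd s' x (Suc (s' x []))) \<and> t + 4 + ?mu (upd s' x (Suc (s' x []))) \<le> ?mu s"
        unfolding u eq using * lt F by simp
    qed
    then show "wp ?c (\<lambda>t s'. ?I s' \<and> t + 2 + ?mu s' \<le> ?mu s) s"
      unfolding wp_Seq wp_Assign by (rule wp_mono) (simp add: upd_def)
  next
    fix t s assume I: "?I s" and b: "\<not> bval s ?b" and a: "agree (mods ?c) s (upd s0 x 0)"
      and t: "t + ?mu s \<le> ?mu (upd s0 x 0) + 1"
    have N: "s x [] = N" using b I e[OF ag[OF a]] by simp
    have 0: "upd s0 x 0 x [] = 0" by (simp add: upd_def)
    show "Q (2 + t) s"
    proof (rule fin[OF _ ag[OF a]])
      show "I N s" using I N by simp
      show "2 + t + \<psi> s \<le> (\<Sum>i<N. f i + 4) + 3 + \<psi> (upd s0 x 0)"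
        using t unfolding N 0 by (simp add: lessThan_atLeast0)
    qed
  qed
  then show ?thesis unfolding For_def by (simp add: upd_def)
qed

lemma wp_For:
  assumes "x \<notin> mods c"
    and "\<And>s. agree (insert x (mods c)) s s0 \<Longrightarrow> aval s e = N"
    and "I 0 (upd s0 x 0)"
    and "\<And>i s. i < N \<Longrightarrow> I i s \<Longrightarrow> s x [] = i \<Longrightarrow> agree (insert x (mods c)) s s0 \<Longrightarrow>
      wp c (\<lambda>t s'. t \<le> f i \<and> I (Suc i) (upd s' x (Suc i))) s"
    and "\<And>t s. I N s \<Longrightarrow> agree (insert x (mods c)) s s0 \<Longrightarrow> t \<le> (\<Sum>i<N. f i + 4) + 3 \<Longrightarrow> Q t s"
  shows "wp (For x e c) Q s0"
  by (rule wp_For_potential[where \<psi> = "\<lambda>_. 0" and I = I and N = N and f = f]) (use assms in auto)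

text \<open>Views an array as a function on numbers, so that the store-free invariants below apply
  to stores and an array write becomes a function update.\<close>

definition ar :: "(nat list \<Rightarrow> nat) \<Rightarrow> nat \<Rightarrow> nat" where
  "ar f = (\<lambda>i. f [i])"

lemma ar_apply [simp]: "ar f i = f [i]"
  by (simp add: ar_def)

lemma ar_upd [simp]: "ar (f([i] := v)) = (ar f)(i := v)"
  by (auto simp: ar_def)

section \<open>Bipartite matching by auction and augmentation\<close>

definition mate_edges :: "(nat \<Rightarrow> nat) \<Rightarrow> (nat \<times> nat) set" where
  "mate_edges mb = {(a, b). mb b = Suc a}"

text \<open>Only \<open>mb\<close> decides who is matched; \<open>mate\<close> may hold stale
  entries for other agents. The equation \<open>mate a = b\<close> is also what prevents an agent
  from owning two objects.\<close>

definition consistent :: "(nat \<times> nat) set \<Rightarrow> (nat \<Rightarrow> nat) \<Rightarrow> (nat \<Rightarrow> nat) \<Rightarrow> bool" where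
  "consistent H mb mate \<longleftrightarrow> (\<forall>a b. mb b = Suc a \<longrightarrow> (a, b) \<in> H \<and> mate a = b)"

lemma consistent_matching: "consistent H mb mate \<Longrightarrow> matching H (mate_edges mb)"
  by (rule matchingI) (auto simp: consistent_def mate_edges_def)

lemma Range_mate_edges: "Range (mate_edges mb) = {b. mb b \<noteq> 0}"
  by (auto simp: mate_edges_def Range_iff gr0_conv_Suc)

lemma card_mate_edges: "consistent H mb mate \<Longrightarrow> card (mate_edges mb) = card {b. mb b \<noteq> 0}"
  using card_Range_matching[OF consistent_matching] by (simp add: Range_mate_edges)

lemma consistent_insert:
  assumes "consistent H mb mate" "(x, b) \<in> H" "\<And>b. mb b \<noteq> Suc x"
  shows "consistent H (mb(b := Suc x)) (mate(x := b))"
  using assms by (auto simp: consistent_def)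

lemma consistent_delete: "consistent H mb mate \<Longrightarrow> consistent H (mb(b := 0)) mate"
  by (auto simp: consistent_def)

text \<open>The lists may contain more than the edges of \<open>H\<close>: they are those of the
  whole graph, while \<open>H\<close> is the subgraph selected by the flags.\<close>

locale bipartite_lists =
  fixes k :: nat and H :: "(nat \<times> nat) set" and dg :: "nat \<Rightarrow> nat" and nb :: "nat \<Rightarrow> nat \<Rightarrow> nat"
  assumes H_subset: "H \<subseteq> {..<k} \<times> {..<k}"
    and H_listed: "(a, b) \<in> H \<Longrightarrow> \<exists>i<dg a. nb a i = b"
begin

lemma H_less: "(a, b) \<in> H \<Longrightarrow> a < k \<and> b < k"
  using H_subset by auto

lemma matched_subset: "consistent H mb mate \<Longrightarrow> {b. mb b \<noteq> 0} \<subseteq> {..<k}"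
  unfolding consistent_def by (auto simp: gr0_conv_Suc dest: H_less)

lemma finite_matched: "consistent H mb mate \<Longrightarrow> finite {b. mb b \<noteq> 0}"
  using matched_subset finite_subset by blast

lemma card_matched_agents:
  assumes "consistent H mb mate" and S: "S \<subseteq> {b. mb b \<noteq> 0}"
  shows "card {a. \<exists>b\<in>S. mb b = Suc a} \<le> card S" "finite {a. \<exists>b\<in>S. mb b = Suc a}"
proof -
  have "finite S" using finite_matched[OF assms(1)] S finite_subset by blast
  moreover have "{a. \<exists>b\<in>S. mb b = Suc a} \<subseteq> (\<lambda>b. mb b - 1) ` S" by force
  ultimately show "card {a. \<exists>b\<in>S. mb b = Suc a} \<le> card S" "finite {a. \<exists>b\<in>S. mb b = Suc a}"
    by (blast intro: surj_card_le, blast intro: finite_subset)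
qed

section \<open>Auction with bounded prices\<close>

text \<open>
  \<open>pr b\<close> is the price of an object, \<open>d a\<close> a lower bound on the prices of the neighbours of \<open>a\<close>,
  \<open>pt a\<close> a position in the adjacency list before which all prices exceed \<open>d a\<close>.  The agents below
  \<open>n\<close> have been admitted; \<open>cur = Suc a\<close> if \<open>a\<close> is bidding, and an agent gives up at price \<open>L\<close>.
\<close>

definition auction ::
  "nat \<Rightarrow> nat \<Rightarrow> nat \<Rightarrow> (nat \<Rightarrow> nat) \<Rightarrow> (nat \<Rightarrow> nat) \<Rightarrow> (nat \<Rightarrow> nat) \<Rightarrow> (nat \<Rightarrow> nat) \<Rightarrow> (nat \<Rightarrow> nat) \<Rightarrow> bool"
  where
  "auction L n cur mb mate d pt pr \<longleftrightarrow> consistent H mb mate \<and>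
     (\<forall>a b. (a, b) \<in> H \<longrightarrow> d a \<le> pr b) \<and>
     (\<forall>a i. i < pt a \<longrightarrow> (a, nb a i) \<in> H \<longrightarrow> d a < pr (nb a i)) \<and>
     (\<forall>a<k. pt a \<le> dg a) \<and>
     (\<forall>a b. mb b = Suc a \<longrightarrow> pr b \<le> Suc (d a) \<and> a < n) \<and>
     (\<forall>b<k. 0 < pr b \<longrightarrow> mb b \<noteq> 0) \<and>
     (\<forall>a<n. cur \<noteq> Suc a \<longrightarrow> (\<forall>b. mb b \<noteq> Suc a) \<longrightarrow> L \<le> d a) \<and>
     cur \<le> n \<and> (\<forall>a b. cur = Suc a \<longrightarrow> mb b \<noteq> Suc a)"

lemma auctionD:
  assumes "auction L n cur mb mate d pt pr"
  shows "consistent H mb mate" and "\<And>a b. (a, b) \<in> H \<Longrightarrow> d a \<le> pr b"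
    and "\<And>a b. mb b = Suc a \<Longrightarrow> pr b \<le> Suc (d a)" and "\<And>a b. mb b = Suc a \<Longrightarrow> a < n"
    and "\<And>b. b < k \<Longrightarrow> 0 < pr b \<Longrightarrow> mb b \<noteq> 0"
    and "\<And>a. a < n \<Longrightarrow> cur \<noteq> Suc a \<Longrightarrow> d a < L \<Longrightarrow> \<exists>b. mb b = Suc a"
    and "\<And>a. a < k \<Longrightarrow> pt a \<le> dg a"
  using assms unfolding auction_def by (blast, blast, blast, blast, blast, meson not_le, blast)

lemma auction_init:
  assumes "\<And>b. mb b = 0" "\<And>a. a < k \<Longrightarrow> d a = 0" "\<And>a. a < k \<Longrightarrow> pt a = 0" "\<And>b. b < k \<Longrightarrow> pr b = 0"
  shows "auction L 0 0 mb mate d pt pr"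
  using assms by (auto simp: auction_def consistent_def dest!: H_less)

lemma auction_admit: "auction L n 0 mb mate d pt pr \<Longrightarrow> auction L (Suc n) (Suc n) mb mate d pt pr"
  unfolding auction_def by (auto simp: less_Suc_eq)

lemma auction_give_up:
  assumes a: "auction L n (Suc x) mb mate d pt pr" and "L \<le> d x"
  shows "auction L n 0 mb mate d pt pr"
proof -
  have "L \<le> d a'" if "a' < n" "\<forall>b. mb b \<noteq> Suc a'" for a'
    using a assms(2) that by (cases "a' = x") (simp_all add: auction_def)
  then show ?thesis using a by (simp add: auction_def)
qed

lemma auction_skip:
  assumes "auction L n (Suc x) mb mate d pt pr" "pt x < dg x"
    "(x, nb x (pt x)) \<notin> H \<or> d x < pr (nb x (pt x))"
  shows "auction L n (Suc x) mb mate d (pt(x := Suc (pt x))) pr"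
  using assms unfolding auction_def by (auto simp: less_Suc_eq)

text \<open>The pointer has passed the whole list, so every neighbour is priced above
  \<open>d x\<close> and the lower bound can grow by one.\<close>

lemma auction_lift:
  assumes a: "auction L n (Suc x) mb mate d pt pr" and pt: "\<not> pt x < dg x"
  shows "auction L n (Suc x) mb mate (d(x := Suc (d x))) (pt(x := 0)) pr"
proof -
  have "d x < pr b" if "(x, b) \<in> H" for b
  proof -
    obtain i where "i < dg x" "nb x i = b" using H_listed \<open>(x, b) \<in> H\<close> by blast
    moreover from this have "i < pt x" using pt by simp
    ultimately show ?thesis using a that by (auto simp: auction_def)
  qed
  then show ?thesis using a unfolding auction_def by (auto simp: Suc_le_eq le_SucI)
qed

text \<open>As \<open>d x\<close> bounds the prices from below, the price of \<open>b\<close> equals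
  \<open>d x\<close>. The displaced owner becomes the next bidder: \<open>mb b\<close> is already
  its code, and 0 if \<open>b\<close> was free.\<close>

lemma auction_take:
  assumes a: "auction L n (Suc x) mb mate d pt pr" and pt: "pt x < dg x"
    and b: "b = nb x (pt x)" and H: "(x, b) \<in> H" and pr: "\<not> d x < pr b"
  shows "auction L n (mb b) (mb(b := Suc x)) (mate(x := b)) d (pt(x := Suc (pt x))) (pr(b := Suc (pr b)))"
proof -
  have con: "consistent H mb mate" and free: "mb b' \<noteq> Suc x" and "Suc x \<le> n" for b'
    using a by (auto simp: auction_def)
  have prb: "pr b = d x" using auctionD(2)[OF a H] pr by simp
  have old: "\<forall>b'. b' \<noteq> b \<longrightarrow> mb b' \<noteq> mb b" if "mb b \<noteq> 0"
  proof (intro allI impI notI)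
    fix b' assume "b' \<noteq> b" "mb b' = mb b"
    moreover obtain m where "mb b = Suc m" using \<open>mb b \<noteq> 0\<close> by (auto simp: gr0_conv_Suc)
    ultimately show False using con unfolding consistent_def by metis
  qed
  have le: "mb b \<le> n"
    using a by (cases "mb b") (auto simp: auction_def Suc_le_eq)
  show ?thesis
    unfolding auction_def
  proof (intro conjI)
    show "consistent H (mb(b := Suc x)) (mate(x := b))"
      using con H free by (rule consistent_insert)
    show "\<forall>a b'. (a, b') \<in> H \<longrightarrow> d a \<le> (pr(b := Suc (pr b))) b'"
      using auctionD(2)[OF a] by (simp add: le_SucI)
    show "\<forall>a i. i < (pt(x := Suc (pt x))) a \<longrightarrow> (a, nb a i) \<in> H \<longrightarrow> d a < (pr(b := Suc (pr b))) (nb a i)"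
    proof (intro allI impI)
      fix a' i assume i: "i < (pt(x := Suc (pt x))) a'" and h: "(a', nb a' i) \<in> H"
      have old: "i < pt a' \<Longrightarrow> d a' < pr (nb a' i)" using a h by (simp add: auction_def)
      show "d a' < (pr(b := Suc (pr b))) (nb a' i)"
      proof (cases "i < pt a'")
        case True
        then show ?thesis using old by (cases "nb a' i = b") auto
      next
        case False
        then have "a' = x \<and> i = pt x" using i by (cases "a' = x") auto
        then show ?thesis using prb b by simp
      qed
    qed
    show "\<forall>a<n. mb b \<noteq> Suc a \<longrightarrow> (\<forall>b'. (mb(b := Suc x)) b' \<noteq> Suc a) \<longrightarrow> L \<le> d a"
    proof (intro allI impI)
      fix a' assume a': "a' < n" "mb b \<noteq> Suc a'" "\<forall>b'. (mb(b := Suc x)) b' \<noteq> Suc a'"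
      then have "a' \<noteq> x" "\<forall>b'. mb b' \<noteq> Suc a'" by (metis fun_upd_same, metis fun_upd_other)
      then show "L \<le> d a'" using a a' by (simp add: auction_def)
    qed
    show "\<forall>a b'. mb b = Suc a \<longrightarrow> (mb(b := Suc x)) b' \<noteq> Suc a"
      using old free by auto
  qed (use a le prb pt b \<open>Suc x \<le> n\<close> in \<open>auto simp: auction_def less_Suc_eq le_SucI less_SucI\<close>)
qed

text \<open>For every price still open to \<open>a\<close>, there are at most \<open>dg a\<close>
  pointer moves and one lift; \<open>pt a\<close> moves have been made at the current price.\<close>

definition auction_work :: "nat \<Rightarrow> (nat \<Rightarrow> nat) \<Rightarrow> (nat \<Rightarrow> nat) \<Rightarrow> nat" where
  "auction_work L d pt = (\<Sum>a<k. (L - d a) * Suc (dg a) - pt a)"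

lemma auction_work_less:
  assumes "x < k" "(L - d' x) * Suc (dg x) - pt' x < (L - d x) * Suc (dg x) - pt x"
    "\<And>a. a \<noteq> x \<Longrightarrow> d' a = d a \<and> pt' a = pt a"
  shows "auction_work L d' pt' < auction_work L d pt"
  unfolding auction_work_def
proof (rule sum_strict_mono_ex1)
  show "\<forall>a\<in>{..<k}. (L - d' a) * Suc (dg a) - pt' a \<le> (L - d a) * Suc (dg a) - pt a"
    using assms by (metis order_less_imp_le order_refl)
qed (use assms in auto)

lemma auction_work_advance:
  assumes "x < k" "d x < L" "pt x < dg x"
  shows "auction_work L d (pt(x := Suc (pt x))) < auction_work L d pt"
proof (rule auction_work_less[of x])
  obtain e where "L - d x = Suc e" using assms(2) by (metis Suc_diff_Suc)
  then show "(L - d x) * Suc (dg x) - (pt(x := Suc (pt x))) x < (L - d x) * Suc (dg x) - pt x"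
    using assms(3) by simp
qed (use assms in auto)

lemma auction_work_lift:
  assumes "x < k" "d x < L" "pt x \<le> dg x"
  shows "auction_work L (d(x := Suc (d x))) (pt(x := 0)) < auction_work L d pt"
proof (rule auction_work_less[of x])
  obtain e where "L - d x = Suc e" "L - Suc (d x) = e" using assms(2) by (metis Suc_diff_Suc)
  then show "(L - (d(x := Suc (d x))) x) * Suc (dg x) - (pt(x := 0)) x < (L - d x) * Suc (dg x) - pt x"
    using assms(3) by simp
qed (use assms in auto)

text \<open>
  For every price \<open>j\<close> with \<open>1 \<le> j \<le> L\<close>, the objects priced at least \<open>j\<close> and the agents matched at
  price at most \<open>j\<close> form a vertex cover that exceeds the matching by the number of objects priced
  exactly \<open>j\<close>; summing over \<open>j\<close> gives the bound.
\<close>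

lemma auction_deficiency:
  assumes a: "auction L k 0 mb mate d pt pr" and M: "matching H M"
  shows "L * card M \<le> L * card {b. mb b \<noteq> 0} + k"
proof -
  have con: "consistent H mb mate" using a by (simp add: auction_def)
  let ?S = "{b. mb b \<noteq> 0}"
  have finS: "finite ?S" using con by (rule finite_matched)
  have j: "card M \<le> card ?S + card {b\<in>{..<k}. pr b = j}" if j: "j \<in> {1..L}" for j
  proof -
    let ?T = "{b. mb b \<noteq> 0 \<and> pr b \<le> j}"
    define X where "X = {a. \<exists>b\<in>?T. mb b = Suc a}"
    define Y where "Y = {b\<in>{..<k}. j \<le> pr b}"
    have T: "?T \<subseteq> ?S" by auto
    have YS: "Y \<subseteq> ?S"
    proof
      fix b assume "b \<in> Y"
      then have "b < k" "0 < pr b" using j by (auto simp: Y_def)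
      then show "b \<in> ?S" using auctionD(5)[OF a] by simp
    qed
    have "card M \<le> card X + card Y"
    proof (rule card_matching_le_cover[OF M])
      show "finite X" using card_matched_agents(2)[OF con T] by (simp add: X_def)
      show "finite Y" by (simp add: Y_def)
      fix a' b assume "(a', b) \<in> M"
      then have ab: "(a', b) \<in> H" using M matching_subset by blast
      show "a' \<in> X \<or> b \<in> Y"
      proof (cases "j \<le> pr b")
        case True
        then show ?thesis using ab H_less by (auto simp: Y_def)
      next
        case False
        then have less: "d a' < j" using auctionD(2)[OF a ab] by simp
        then obtain b' where b': "mb b' = Suc a'"
          using auctionD(6)[OF a, of a'] j H_less[OF ab] by auto
        moreover have "pr b' \<le> j" using auctionD(3)[OF a b'] less by simp
        ultimately show ?thesis by (auto simp: X_def intro!: exI[of _ b'])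
      qed
    qed
    also have "card X \<le> card ?T" using card_matched_agents(1)[OF con T] by (simp add: X_def)
    also have "card ?T + card Y = card (?T \<union> Y) + card (?T \<inter> Y)"
      using finS T by (intro card_Un_Int) (auto simp: Y_def intro: finite_subset)
    also have "card (?T \<union> Y) \<le> card ?S" using finS T YS by (intro card_mono) auto
    also have "card (?T \<inter> Y) \<le> card {b\<in>{..<k}. pr b = j}"
      by (rule card_mono) (auto simp: Y_def)
    finally show ?thesis by simp
  qed
  have "(\<Sum>j\<in>{1..L}. card M) \<le> (\<Sum>j\<in>{1..L}. card ?S + card {b\<in>{..<k}. pr b = j})"
    by (rule sum_mono) (rule j)
  moreover have "(\<Sum>j\<in>{1..L}. card {b\<in>{..<k}. pr b = j}) \<le> k"
  proof -
    have "(\<Sum>j\<in>{1..L}. card {b\<in>{..<k}. pr b = j}) = card (\<Union>j\<in>{1..L}. {b\<in>{..<k}. pr b = j})"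
      by (subst card_UN_disjoint) auto
    also have "\<dots> \<le> card {..<k}" by (rule card_mono) auto
    finally show ?thesis by simp
  qed
  ultimately show ?thesis by (simp add: sum.distrib)
qed

section \<open>Augmenting paths by breadth-first search\<close>

text \<open>
  Breadth-first search for an augmenting path: the queue \<open>q\<close> holds agents, \<open>par b = Suc a\<close> if the
  object \<open>b\<close> was reached from \<open>a\<close>, and \<open>fnd = Suc b\<close> once an unmatched object \<open>b\<close> is reached.
\<close>

definition search ::
  "(nat \<Rightarrow> nat) \<Rightarrow> (nat \<Rightarrow> nat) \<Rightarrow> (nat \<Rightarrow> nat) \<Rightarrow> (nat \<Rightarrow> nat) \<Rightarrow> nat \<Rightarrow> nat \<Rightarrow> nat \<Rightarrow> nat \<Rightarrow> bool" where
  "search mb mate par q qt qh i fnd \<longleftrightarrow>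
     inj_on q {..<qt} \<and> (\<forall>j<qt. q j < k) \<and>
     (\<forall>a<k. mb (mate a) \<noteq> Suc a \<longrightarrow> (\<exists>j<qt. q j = a)) \<and>
     (\<forall>b<k. \<forall>a. par b = Suc a \<longrightarrow> (a, b) \<in> H \<and> (\<exists>j<qt. q j = a)) \<and>
     (\<forall>j<qt. mb (mate (q j)) = Suc (q j) \<longrightarrow> (\<exists>j'<j. par (mate (q j)) = Suc (q j'))) \<and>
     (\<forall>b<k. par b \<noteq> 0 \<longrightarrow> mb b = 0 \<and> fnd = Suc b \<or> (\<exists>a. mb b = Suc a \<and> (\<exists>j<qt. q j = a))) \<and>
     (\<forall>j<qh. \<forall>b. (q j, b) \<in> H \<longrightarrow> par b \<noteq> 0) \<and>
     (qh < qt \<longrightarrow> i \<le> dg (q qh) \<and>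
       (\<forall>i'<i. (q qh, nb (q qh) i') \<in> H \<longrightarrow> par (nb (q qh) i') \<noteq> 0)) \<and>
     qh \<le> qt \<and> (\<forall>b. fnd = Suc b \<longrightarrow> b < k \<and> par b \<noteq> 0 \<and> mb b = 0)"

lemma searchD:
  assumes "search mb mate par q qt qh i fnd"
  shows "\<And>a. a < k \<Longrightarrow> mb (mate a) \<noteq> Suc a \<Longrightarrow> \<exists>j<qt. q j = a"
    and "\<And>a b. b < k \<Longrightarrow> par b = Suc a \<Longrightarrow> (a, b) \<in> H \<and> (\<exists>j<qt. q j = a)"
    and "\<And>b. b < k \<Longrightarrow> par b \<noteq> 0 \<Longrightarrow>
      mb b = 0 \<and> fnd = Suc b \<or> (\<exists>a. mb b = Suc a \<and> (\<exists>j<qt. q j = a))"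
    and "\<And>j b. j < qh \<Longrightarrow> (q j, b) \<in> H \<Longrightarrow> par b \<noteq> 0"
    and "\<And>j. j < qt \<Longrightarrow> mb (mate (q j)) = Suc (q j) \<Longrightarrow> \<exists>j'<j. par (mate (q j)) = Suc (q j')"
    and "qh \<le> qt"
  using assms by (simp_all add: search_def)

lemma search_init:
  assumes "inj_on q {..<qt}" "q ` {..<qt} = {a\<in>{..<k}. mb (mate a) \<noteq> Suc a}" "\<And>b. b < k \<Longrightarrow> par b = 0"
  shows "search mb mate par q qt 0 0 0"
proof -
  have "q j < k \<and> mb (mate (q j)) \<noteq> Suc (q j)" if "j < qt" for j
    using assms(2) that by (metis (mono_tags, lifting) imageI lessThan_iff mem_Collect_eq)
  moreover have "\<exists>j<qt. q j = a" if "a < k" "mb (mate a) \<noteq> Suc a" for a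
  proof -
    have "a \<in> q ` {..<qt}" using that assms(2) by simp
    then show ?thesis by auto
  qed
  ultimately show ?thesis using assms(1,3) unfolding search_def by simp
qed

lemma search_skip:
  assumes "search mb mate par q qt qh i 0" "qh < qt" "i < dg (q qh)"
    "(q qh, nb (q qh) i) \<notin> H \<or> par (nb (q qh) i) \<noteq> 0"
  shows "search mb mate par q qt qh (Suc i) 0"
  using assms unfolding search_def by (simp add: less_Suc_eq)

lemma search_next:
  assumes s: "search mb mate par q qt qh i 0" and "qh < qt" "\<not> i < dg (q qh)"
  shows "search mb mate par q qt (Suc qh) 0 0"
proof -
  have "par b \<noteq> 0" if "(q qh, b) \<in> H" for b
  proof -
    obtain i' where "i' < dg (q qh)" "nb (q qh) i' = b" using H_listed \<open>(q qh, b) \<in> H\<close> by blast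
    moreover have "\<forall>i'<i. (q qh, nb (q qh) i') \<in> H \<longrightarrow> par (nb (q qh) i') \<noteq> 0"
      using s \<open>qh < qt\<close> by (simp add: search_def)
    ultimately show ?thesis using that \<open>\<not> i < dg (q qh)\<close> by auto
  qed
  then show ?thesis using s \<open>qh < qt\<close> unfolding search_def by (simp add: less_Suc_eq all_conj_distrib)
qed

lemma search_found:
  assumes s: "search mb mate par q qt qh i 0" and qh: "qh < qt" "i < dg (q qh)"
    and b: "b = nb (q qh) i" "(q qh, b) \<in> H" "par b = 0" "mb b = 0"
  shows "search mb mate (par(b := Suc (q qh))) q qt qh (Suc i) (Suc b)"
proof -
  have "b < k" using H_less b by blast
  have "mate (q j) \<noteq> b" if "mb (mate (q j)) = Suc (q j)" for j using b that by auto
  then show ?thesis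
    using s qh b \<open>b < k\<close> unfolding search_def by (auto simp: less_Suc_eq)
qed

text \<open>The owner \<open>a\<close> of \<open>b\<close> is not yet in the queue: a queued matched
  agent has an object with a parent, and \<open>b\<close> has none so far. This keeps the queue free
  of repetitions.\<close>

lemma search_push:
  assumes s: "search mb mate par q qt qh i 0" and con: "consistent H mb mate" and qh: "qh < qt" "i < dg (q qh)"
    and b: "b = nb (q qh) i" "(q qh, b) \<in> H" "par b = 0" "mb b = Suc a"
  shows "search mb mate (par(b := Suc (q qh))) (q(qt := a)) (Suc qt) qh (Suc i) 0"
proof -
  have bk: "b < k" using H_less b by blast
  have a: "a < k" "mate a = b" using con b(4) H_less by (auto simp: consistent_def)
  have new: "q j \<noteq> a" if j: "j < qt" for j
  proof
    assume "q j = a"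
    then obtain j' where "par b = Suc (q j')" using searchD(5)[OF s j] a b(4) by auto
    then show False using b by simp
  qed
  have mate_ne: "mate (q j) \<noteq> b" if "j < qt" "mb (mate (q j)) = Suc (q j)" for j
    using new[OF that(1)] that(2) b(4) by auto
  have ex_j: "\<exists>j<Suc qt. (q(qt := a)) j = a'" if "\<exists>j<qt. q j = a'" for a'
    using that by (metis fun_upd_other less_SucI less_irrefl)
  have "inj_on (q(qt := a)) {..<Suc qt}"
    using s new by (auto simp: search_def lessThan_Suc inj_on_def)
  moreover have "\<forall>j<Suc qt. mb (mate ((q(qt := a)) j)) = Suc ((q(qt := a)) j) \<longrightarrow>
      (\<exists>j'<j. (par(b := Suc (q qh))) (mate ((q(qt := a)) j)) = Suc ((q(qt := a)) j'))"
  proof (intro allI impI)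
    fix j assume j: "j < Suc qt" and m: "mb (mate ((q(qt := a)) j)) = Suc ((q(qt := a)) j)"
    show "\<exists>j'<j. (par(b := Suc (q qh))) (mate ((q(qt := a)) j)) = Suc ((q(qt := a)) j')"
    proof (cases "j = qt")
      case True
      then show ?thesis using a qh by (intro exI[of _ qh]) simp
    next
      case False
      then have "j < qt" "mb (mate (q j)) = Suc (q j)" using j m by auto
      then obtain j' where "j' < j" "par (mate (q j)) = Suc (q j')" using searchD(5)[OF s] by blast
      then show ?thesis using mate_ne[of j] \<open>j < qt\<close> \<open>mb (mate (q j)) = Suc (q j)\<close>
        by (intro exI[of _ j']) simp
    qed
  qed
  moreover have "\<forall>b'<k. \<forall>a'. (par(b := Suc (q qh))) b' = Suc a' \<longrightarrow> (a', b') \<in> H \<and> (\<exists>j<Suc qt. (q(qt := a)) j = a')"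
  proof (intro allI impI)
    fix b' a' assume b': "b' < k" "(par(b := Suc (q qh))) b' = Suc a'"
    have "(a', b') \<in> H \<and> (\<exists>j<qt. q j = a')"
      using searchD(2)[OF s, of b' a'] b' b(2) qh(1) by (cases "b' = b") auto
    then show "(a', b') \<in> H \<and> (\<exists>j<Suc qt. (q(qt := a)) j = a')" using ex_j by blast
  qed
  moreover have "\<forall>a'<k. mb (mate a') \<noteq> Suc a' \<longrightarrow> (\<exists>j<Suc qt. (q(qt := a)) j = a')"
    using searchD(1)[OF s] ex_j by blast
  moreover have "\<forall>b'<k. (par(b := Suc (q qh))) b' \<noteq> 0 \<longrightarrow> mb b' = 0 \<and> 0 = Suc b' \<or>
      (\<exists>a'. mb b' = Suc a' \<and> (\<exists>j<Suc qt. (q(qt := a)) j = a'))"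
  proof (intro allI impI)
    fix b' assume b': "b' < k" "(par(b := Suc (q qh))) b' \<noteq> 0"
    have "\<exists>a'. mb b' = Suc a' \<and> (a' = a \<or> (\<exists>j<qt. q j = a'))"
      using searchD(3)[OF s, of b'] b' b(4) by (cases "b' = b") auto
    then show "mb b' = 0 \<and> 0 = Suc b' \<or> (\<exists>a'. mb b' = Suc a' \<and> (\<exists>j<Suc qt. (q(qt := a)) j = a'))"
      using ex_j by (metis fun_upd_same lessI)
  qed
  moreover have "\<forall>j<Suc qt. (q(qt := a)) j < k" using s a by (auto simp: search_def less_Suc_eq)
  moreover have "qh \<noteq> qt" using qh by simp
  ultimately show ?thesis
    using s qh b unfolding search_def by (auto simp: less_Suc_eq)
qed

text \<open>Counts every agent not yet dequeued, whether queued or not; hence appending to the queue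
  leaves the measure unchanged.\<close>

definition search_work :: "(nat \<Rightarrow> nat) \<Rightarrow> nat \<Rightarrow> nat \<Rightarrow> nat" where
  "search_work q qh i = (\<Sum>a\<in>{..<k} - q ` {..<qh}. Suc (dg a)) - i"

lemma search_work_remove:
  assumes "search mb mate par q qt qh i fnd" "qh < qt"
  shows "(\<Sum>a\<in>{..<k} - q ` {..<qh}. Suc (dg a)) = Suc (dg (q qh)) + (\<Sum>a\<in>{..<k} - q ` {..<Suc qh}. Suc (dg a))"
proof -
  have inj: "inj_on q {..<qt}" using assms by (simp add: search_def)
  have "q qh \<notin> q ` {..<qh}"
  proof
    assume "q qh \<in> q ` {..<qh}"
    then obtain j where "j < qh" "q qh = q j" by auto
    then show False using inj_onD[OF inj, of qh j] assms(2) by simp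
  qed
  moreover have "q qh < k" using assms by (simp add: search_def)
  moreover have "{..<k} - q ` {..<Suc qh} = ({..<k} - q ` {..<qh}) - {q qh}"
    by (auto simp: lessThan_Suc)
  ultimately show ?thesis
    by (simp add: sum.remove[of "{..<k} - q ` {..<qh}" "q qh"])
qed

lemma search_work_step:
  assumes "search mb mate par q qt qh i fnd" "qh < qt"
  shows "i < dg (q qh) \<Longrightarrow> search_work q qh (Suc i) < search_work q qh i"
    and "\<not> i < dg (q qh) \<Longrightarrow> search_work q (Suc qh) 0 < search_work q qh i"
proof -
  have "i \<le> dg (q qh)" using assms by (simp add: search_def)
  then show "i < dg (q qh) \<Longrightarrow> search_work q qh (Suc i) < search_work q qh i"
    and "\<not> i < dg (q qh) \<Longrightarrow> search_work q (Suc qh) 0 < search_work q qh i"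
    using search_work_remove[OF assms] by (simp_all add: search_work_def)
qed

lemma search_work_cong: "qh \<le> qt \<Longrightarrow> search_work (q(qt := a)) qh i = search_work q qh i"
proof -
  assume "qh \<le> qt"
  then have "q(qt := a) ` {..<qh} = q ` {..<qh}" by (intro image_cong) auto
  then show ?thesis by (simp add: search_work_def)
qed

lemma search_queue_le: "search mb mate par q qt qh i fnd \<Longrightarrow> qt \<le> k"
  using card_inj_on_le[of q "{..<qt}" "{..<k}"] by (auto simp: search_def)

text \<open>The reached objects and the owners of the unreached matched objects cover
  \<open>H\<close>. No free object was reached, so this cover is no larger than the current
  matching.\<close>

lemma search_fail:
  assumes con: "consistent H mb mate" and s: "search mb mate par q qt qh i 0" and "\<not> qh < qt"
    and M: "matching H M"
  shows "card M \<le> card {b. mb b \<noteq> 0}"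
proof -
  let ?S = "{b. mb b \<noteq> 0}"
  define Y where "Y = {b\<in>{..<k}. par b \<noteq> 0}"
  define X where "X = {a. \<exists>b\<in>?S - Y. mb b = Suc a}"
  have qh: "qh = qt" using s \<open>\<not> qh < qt\<close> by (simp add: search_def)
  have finS: "finite ?S" using con by (rule finite_matched)
  have YS: "Y \<subseteq> ?S" using searchD(3)[OF s] by (fastforce simp: Y_def)
  have "card M \<le> card X + card Y"
  proof (rule card_matching_le_cover[OF M])
    show "finite X" using card_matched_agents(2)[OF con, of "?S - Y"] by (auto simp: X_def)
    show "finite Y" by (simp add: Y_def)
    fix a b assume "(a, b) \<in> M"
    then have ab: "(a, b) \<in> H" using M matching_subset by blast
    show "a \<in> X \<or> b \<in> Y"
    proof (cases "\<exists>j<qt. q j = a")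
      case True
      then have "par b \<noteq> 0" using searchD(4)[OF s] ab qh by blast
      then show ?thesis using H_less[OF ab] by (simp add: Y_def)
    next
      case False
      then have m: "mb (mate a) = Suc a" using searchD(1)[OF s] H_less[OF ab] by blast
      have "mate a \<notin> Y"
      proof
        assume "mate a \<in> Y"
        then obtain a' where "mb (mate a) = Suc a'" "\<exists>j<qt. q j = a'"
          using searchD(3)[OF s, of "mate a"] by (auto simp: Y_def)
        then show False using False m by simp
      qed
      then have "a \<in> X" unfolding X_def using m by (intro CollectI bexI[of _ "mate a"]) auto
      then show ?thesis ..
    qed
  qed
  also have "card X \<le> card (?S - Y)"
    using card_matched_agents(1)[OF con, of "?S - Y"] by (auto simp: X_def)
  also have "card (?S - Y) = card ?S - card Y" using YS by (intro card_Diff_subset) (simp add: Y_def)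
  finally show ?thesis using card_mono[OF finS YS] by simp
qed

section \<open>Augmentation along the parent pointers\<close>

definition flipping ::
  "nat \<Rightarrow> nat \<Rightarrow> (nat \<Rightarrow> nat) \<Rightarrow> (nat \<Rightarrow> nat) \<Rightarrow> (nat \<Rightarrow> nat) \<Rightarrow> (nat \<Rightarrow> nat) \<Rightarrow> bool" where
  "flipping J b mb mate par q \<longleftrightarrow> consistent H mb mate \<and> mb b = 0 \<and> b < k \<and>
     (\<exists>j<J. par b = Suc (q j)) \<and>
     (\<forall>j<J. mb (mate (q j)) = Suc (q j) \<longrightarrow> (\<exists>j'<j. par (mate (q j)) = Suc (q j'))) \<and>
     (\<forall>b<k. \<forall>a. par b = Suc a \<longrightarrow> (a, b) \<in> H) \<and> inj_on q {..<J}"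

lemma flipping_start:
  assumes "search mb mate par q qt qh i (Suc b)" "consistent H mb mate"
  shows "flipping qt b mb mate par q"
proof -
  have b: "b < k" "par b \<noteq> 0" "mb b = 0" using assms by (auto simp: search_def)
  then obtain a where "par b = Suc a" by (cases "par b") auto
  then obtain j where "j < qt" "par b = Suc (q j)" using searchD(2)[OF assms(1) b(1)] by blast
  moreover have "inj_on q {..<qt}" using assms(1) by (simp add: search_def)
  ultimately show ?thesis
    using assms(2) b searchD(2,5)[OF assms(1)] unfolding flipping_def by simp blast
qed

text \<open>The parent \<open>x\<close> is a root of the search: it takes \<open>b\<close> without
  giving anything back, so the matching grows.\<close>

lemma flipping_last:
  assumes f: "flipping J b mb mate par q" and x: "par b = Suc x" and free: "mb (mate x) \<noteq> Suc x"
  shows "consistent H (mb(b := Suc x)) (mate(x := b))"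
    and "card {b'. (mb(b := Suc x)) b' \<noteq> 0} = Suc (card {b'. mb b' \<noteq> 0})"
proof -
  have con: "consistent H mb mate" and b: "mb b = 0" "(x, b) \<in> H"
    using f x by (auto simp: flipping_def)
  have "mb b' \<noteq> Suc x" for b' using con free by (auto simp: consistent_def)
  then show "consistent H (mb(b := Suc x)) (mate(x := b))" using con b by (intro consistent_insert)
  have "{b'. (mb(b := Suc x)) b' \<noteq> 0} = insert b {b'. mb b' \<noteq> 0}" by auto
  then show "card {b'. (mb(b := Suc x)) b' \<noteq> 0} = Suc (card {b'. mb b' \<noteq> 0})"
    using finite_matched[OF con] b by simp
qed

text \<open>The agent \<open>x\<close> gives up its old object, which becomes the free one. Only
  \<open>x\<close> changes its partner, and the part of the chain still to be walked lies at queue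
  positions before that of \<open>x\<close>; restricting all conditions to positions below
  \<open>J\<close> therefore keeps them valid and bounds the walk.\<close>

lemma flipping_step:
  assumes f: "flipping J b mb mate par q" and x: "par b = Suc x" and m: "mb (mate x) = Suc x"
  shows "\<exists>J'<J. flipping J' (mate x) (mb(mate x := 0, b := Suc x)) (mate(x := b)) par q"
    and "card {b'. (mb(mate x := 0, b := Suc x)) b' \<noteq> 0} = card {b'. mb b' \<noteq> 0}"
proof -
  let ?y = "mate x" and ?mb = "mb(mate x := 0, b := Suc x)" and ?mate = "mate(x := b)"
  have con: "consistent H mb mate" and b: "mb b = 0" "(x, b) \<in> H" and inj: "inj_on q {..<J}"
    and par: "\<forall>b<k. \<forall>a. par b = Suc a \<longrightarrow> (a, b) \<in> H"
    and chain: "\<And>j. j < J \<Longrightarrow> mb (mate (q j)) = Suc (q j) \<Longrightarrow> \<exists>j'<j. par (mate (q j)) = Suc (q j')"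
    using f x by (auto simp: flipping_def)
  obtain j where j: "j < J" "q j = x" using f x by (auto simp: flipping_def)
  have yb: "?y \<noteq> b" using m b by auto
  have "mb b' = Suc x \<Longrightarrow> b' = ?y" for b' using con by (auto simp: consistent_def)
  then have "consistent H ?mb ?mate"
    using consistent_delete[OF con] b by (intro consistent_insert) auto
  moreover have "?mb ?y = 0" using yb by simp
  moreover have "(x, ?y) \<in> H" using con m unfolding consistent_def by blast
  then have "?y < k" using H_less by blast
  moreover have "\<exists>j'<j. par ?y = Suc (q j')" using chain[of j] j m by simp
  moreover have "\<forall>j1<j. ?mb (?mate (q j1)) = Suc (q j1) \<longrightarrow> (\<exists>j2<j1. par (?mate (q j1)) = Suc (q j2))"
  proof (intro allI impI)
    fix j1 assume j1: "j1 < j" and m1: "?mb (?mate (q j1)) = Suc (q j1)"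
    have ne: "q j1 \<noteq> x" using inj_onD[OF inj, of j1 j] j j1 by auto
    then have "mb (mate (q j1)) = Suc (q j1)" using m1 by (auto split: if_splits)
    then show "\<exists>j2<j1. par (?mate (q j1)) = Suc (q j2)" using chain[of j1] j1 j ne by simp
  qed
  moreover have "inj_on q {..<j}" using inj_on_subset[OF inj, of "{..<j}"] j by simp
  ultimately have "flipping j ?y ?mb ?mate par q" using par unfolding flipping_def by (intro conjI)
  then show "\<exists>J'<J. flipping J' ?y ?mb ?mate par q" using j by blast
  have "{b'. ?mb b' \<noteq> 0} = insert b ({b'. mb b' \<noteq> 0} - {?y})" using yb by auto
  then have "card {b'. ?mb b' \<noteq> 0} = Suc (card ({b'. mb b' \<noteq> 0} - {?y}))"
    using finite_matched[OF con] b by (simp only:) (rule card_insert_disjoint; simp)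
  also have "\<dots> = card {b'. mb b' \<noteq> 0}"
    using finite_matched[OF con] m by (intro card_Suc_Diff1) simp_all
  finally show "card {b'. ?mb b' \<noteq> 0} = card {b'. mb b' \<noteq> 0}" .
qed

end

section \<open>The program\<close>

text \<open>
  The current matching consists of the edges \<open>(a, b)\<close> with \<open>mb[b] = a + 1\<close>, where \<open>mb[b] = 0\<close> means that
  \<open>b\<close> is unmatched.  Entries \<open>mate[a]\<close> are never cleared: \<open>a\<close> is matched iff \<open>mb[mate[a]] = a + 1\<close>.
  As all arrays are initially zero, the first round treats every object as just raised.
  An entry \<open>fl[a,b]\<close> is nonzero iff the edge \<open>(a, b)\<close> is missing from the level graph.
\<close>

definition SQRT :: com where
  "SQRT = Assign ''o'' [] (Const 1) ;;
     For ''c'' (V ''size'')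
       (If (Less (V ''r'') (Const 1))
          (Assign ''w'' [] (Inc (V ''w'')) ;; Assign ''r'' [] (V ''o'') ;; Assign ''o'' [] (Inc (Inc (V ''o''))))
          Skip ;;
        Assign ''r'' [] (Dec (V ''r'')))"

lemma mods_SQRT [simp]: "mods SQRT = {''o'', ''c'', ''r'', ''w''}"
  by (auto simp: SQRT_def)

definition CHECK :: com where
  "CHECK = Assign ''rej'' [] (Const 0) ;;
     For ''b'' (V ''size'')
       (If (Less (V ''kappa'') (Loc ''level'' [V ''b''])) (Assign ''rej'' [] (Const 1)) Skip)"

lemma mods_CHECK [simp]: "mods CHECK = {''rej'', ''b''}"
  by (auto simp: CHECK_def)

definition INIT :: com where
  "INIT = For ''b'' (V ''size'') (Assign ''mb'' [V ''b''] (Const 0) ;; Assign ''pr'' [V ''b''] (Const 0)) ;;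
     For ''a'' (V ''size'') (Assign ''d'' [V ''a''] (Const 0) ;; Assign ''pt'' [V ''a''] (Const 0))"

lemma mods_INIT [simp]: "mods INIT = {''b'', ''mb'', ''pr'', ''a'', ''d'', ''pt''}"
  by (auto simp: INIT_def)

text \<open>The inequality w + level x > level y on natural numbers: the disjuncts are its
  thresholds for a sign of at least -1, at least 0 and equal to 1.\<close>

definition BLOCKS :: "string \<Rightarrow> string \<Rightarrow> bexp" where
  "BLOCKS x y =
     Or (Less (Inc (Loc ''level'' [V y])) (Loc ''level'' [V x]))
      (Or (And (Less (Loc ''level'' [V y]) (Loc ''level'' [V x]))
             (Less (Loc ''pref'' [V ''a'', V y, V x]) (Const 1)))
        (And (Not (Less (Loc ''level'' [V x]) (Loc ''level'' [V y])))
           (Less (Const 0) (Loc ''pref'' [V ''a'', V x, V y]))))"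

text \<open>Raising \<open>b\<close> may clear its own flag, which is recomputed from the whole
  list. For the other objects it can only create new obstructions, so their flags are merely
  set.\<close>

definition FLAG_OBJECT :: com where
  "FLAG_OBJECT = Assign ''fl'' [V ''a'', V ''b''] (Const 0) ;;
     For ''j'' (Loc ''deg'' [V ''a''])
       (Assign ''e'' [] (Loc ''adj'' [V ''a'', V ''j'']) ;;
        If (BLOCKS ''e'' ''b'') (Assign ''fl'' [V ''a'', V ''b''] (Const 1)) Skip ;;
        If (BLOCKS ''b'' ''e'') (Assign ''fl'' [V ''a'', V ''e''] (Const 1)) Skip)"

lemma mods_FLAG_OBJECT [simp]: "mods FLAG_OBJECT = {''fl'', ''j'', ''e''}"
  by (auto simp: FLAG_OBJECT_def)

definition FLAG_AGENT :: com where
  "FLAG_AGENT = For ''i'' (Loc ''deg'' [V ''a''])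
     (Assign ''b'' [] (Loc ''adj'' [V ''a'', V ''i'']) ;;
      If (Less (Loc ''mb'' [V ''b'']) (Const 1)) FLAG_OBJECT Skip)"

lemma mods_FLAG_AGENT [simp]: "mods FLAG_AGENT = {''i'', ''b'', ''fl'', ''j'', ''e''}"
  by (auto simp: FLAG_AGENT_def)

definition FLAGS :: com where
  "FLAGS = For ''a'' (V ''size'') FLAG_AGENT"

lemma mods_FLAGS [simp]: "mods FLAGS = {''a'', ''i'', ''b'', ''fl'', ''j'', ''e''}"
  by (auto simp: FLAGS_def)

section \<open>Matching phases of a round\<close>

definition BID :: com where
  "BID = Assign ''x'' [] (Dec (V ''cur'')) ;;
     If (Less (Loc ''d'' [V ''x'']) (V ''w''))
       (If (Less (Loc ''pt'' [V ''x'']) (Loc ''deg'' [V ''x'']))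
          (Assign ''b'' [] (Loc ''adj'' [V ''x'', Loc ''pt'' [V ''x'']]) ;;
           Assign ''pt'' [V ''x''] (Inc (Loc ''pt'' [V ''x''])) ;;
           If (And (Less (Loc ''fl'' [V ''x'', V ''b'']) (Const 1))
                 (Not (Less (Loc ''d'' [V ''x'']) (Loc ''pr'' [V ''b'']))))
             (Assign ''pr'' [V ''b''] (Inc (Loc ''pr'' [V ''b''])) ;;
              Assign ''cur'' [] (Loc ''mb'' [V ''b'']) ;;
              Assign ''mb'' [V ''b''] (Inc (V ''x'')) ;;
              Assign ''mate'' [V ''x''] (V ''b''))
             Skip)
          (Assign ''d'' [V ''x''] (Inc (Loc ''d'' [V ''x''])) ;;
           Assign ''pt'' [V ''x''] (Const 0)))
       (Assign ''cur'' [] (Const 0))"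

lemma mods_BID [simp]: "mods BID = {''x'', ''b'', ''pt'', ''pr'', ''cur'', ''mb'', ''mate'', ''d''}"
  by (auto simp: BID_def)

definition AUCTION :: com where
  "AUCTION = For ''a'' (V ''size'')
     (Assign ''cur'' [] (Inc (V ''a'')) ;; While (Less (Const 0) (V ''cur'')) BID)"

lemma mods_AUCTION [simp]:
  "mods AUCTION = {''a'', ''x'', ''b'', ''pt'', ''pr'', ''cur'', ''mb'', ''mate'', ''d''}"
  by (auto simp: AUCTION_def)

definition ROOTS :: com where
  "ROOTS = For ''b'' (V ''size'') (Assign ''par'' [V ''b''] (Const 0)) ;;
     Assign ''qt'' [] (Const 0) ;;
     For ''a'' (V ''size'')
       (If (Eq (Loc ''mb'' [Loc ''mate'' [V ''a'']]) (Inc (V ''a'')))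
          Skip
          (Assign ''q'' [V ''qt''] (V ''a'') ;; Assign ''qt'' [] (Inc (V ''qt''))))"

lemma mods_ROOTS [simp]: "mods ROOTS = {''b'', ''par'', ''qt'', ''a'', ''q''}"
  by (auto simp: ROOTS_def)

definition SCAN :: com where
  "SCAN = Assign ''x'' [] (Loc ''q'' [V ''qh'']) ;;
     If (Less (V ''i'') (Loc ''deg'' [V ''x'']))
       (Assign ''b'' [] (Loc ''adj'' [V ''x'', V ''i'']) ;;
        Assign ''i'' [] (Inc (V ''i'')) ;;
        If (And (Less (Loc ''fl'' [V ''x'', V ''b'']) (Const 1)) (Less (Loc ''par'' [V ''b'']) (Const 1)))
          (Assign ''par'' [V ''b''] (Inc (V ''x'')) ;;
           If (Less (Loc ''mb'' [V ''b'']) (Const 1))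
             (Assign ''fnd'' [] (Inc (V ''b'')))
             (Assign ''q'' [V ''qt''] (Dec (Loc ''mb'' [V ''b''])) ;;
              Assign ''qt'' [] (Inc (V ''qt''))))
          Skip)
       (Assign ''qh'' [] (Inc (V ''qh'')) ;; Assign ''i'' [] (Const 0))"

lemma mods_SCAN [simp]: "mods SCAN = {''x'', ''b'', ''i'', ''par'', ''fnd'', ''q'', ''qt'', ''qh''}"
  by (auto simp: SCAN_def)

text \<open>If \<open>x\<close> is a root, \<open>y\<close> comes from a stale entry; then
  \<open>mb[y]\<close> is not cleared and \<open>cont\<close> ends the loop.\<close>

definition FLIP :: com where
  "FLIP = Assign ''x'' [] (Dec (Loc ''par'' [V ''b''])) ;;
     Assign ''y'' [] (Loc ''mate'' [V ''x'']) ;;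
     If (Eq (Loc ''mb'' [V ''y'']) (Inc (V ''x'')))
       (Assign ''mb'' [V ''y''] (Const 0))
       (Assign ''cont'' [] (Const 0)) ;;
     Assign ''mb'' [V ''b''] (Inc (V ''x'')) ;;
     Assign ''mate'' [V ''x''] (V ''b'') ;;
     Assign ''b'' [] (V ''y'')"

lemma mods_FLIP [simp]: "mods FLIP = {''x'', ''y'', ''mb'', ''cont'', ''mate'', ''b''}"
  by (auto simp: FLIP_def)

definition AUGMENT :: com where
  "AUGMENT = ROOTS ;;
     Assign ''qh'' [] (Const 0) ;; Assign ''i'' [] (Const 0) ;; Assign ''fnd'' [] (Const 0) ;;
     While (And (Less (V ''qh'') (V ''qt'')) (Less (V ''fnd'') (Const 1))) SCAN ;;
     If (Less (Const 0) (V ''fnd''))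
       (Assign ''b'' [] (Dec (V ''fnd'')) ;; Assign ''cont'' [] (Const 1) ;;
        While (Less (Const 0) (V ''cont'')) FLIP)
       (Assign ''go'' [] (Const 0))"

lemma mods_AUGMENT [simp]:
  "mods AUGMENT = {''a'', ''b'', ''x'', ''y'', ''i'', ''par'', ''q'', ''qt'', ''qh'', ''fnd'', ''cont'', ''go'', ''mb'', ''mate''}"
  by (auto simp: AUGMENT_def)

definition SEARCH :: com where
  "SEARCH = Assign ''go'' [] (Const 1) ;; While (Less (Const 0) (V ''go'')) AUGMENT"

lemma mods_SEARCH [simp]: "mods SEARCH = mods AUGMENT"
  by (auto simp: SEARCH_def)

definition FINISH :: com where
  "FINISH = Assign ''ok'' [] (Const 1) ;;
     For ''b'' (V ''size'') (If (Less (Loc ''mb'' [V ''b'']) (Const 1)) (Assign ''ok'' [] (Const 0)) Skip) ;;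
     If (Less (Const 0) (V ''ok''))
       (Assign ''status'' [] (Const 1))
       (For ''b'' (V ''size'')
          (If (Less (Loc ''mb'' [V ''b'']) (Const 1))
             (Assign ''level'' [V ''b''] (Inc (Loc ''level'' [V ''b''])))
             Skip))"

lemma mods_FINISH [simp]: "mods FINISH = {''ok'', ''b'', ''status'', ''level''}"
  by (auto simp: FINISH_def)

text \<open>The order matters: \<open>FLAGS\<close> learns from the \<open>mb\<close> of the
  previous round which objects were raised, and \<open>INIT\<close> erases it.\<close>

definition ROUND :: com where
  "ROUND = FLAGS ;; INIT ;; AUCTION ;; SEARCH ;; FINISH"

definition STEP :: com where
  "STEP = CHECK ;; If (Less (Const 0) (V ''rej'')) (Assign ''status'' [] (Const 2)) ROUND"

definition MAIN :: com where
  "MAIN = While (Less (V ''status'') (Const 1)) STEP"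

section \<open>Verification of the program\<close>

definition inputs :: "string set" where
  "inputs = {''size'', ''kappa'', ''deg'', ''adj'', ''pref''}"

locale ram_instance =
  fixes k :: nat and E :: "(nat \<times> nat) set" and pref :: "(nat, nat) pref" and \<kappa> :: nat and s0 :: store
  assumes inst: "assignment_instance {..<k} {..<k} E pref" and enc: "encodes k E pref \<kappa> s0"

sublocale ram_instance \<subseteq> bipartite_prefs "{..<k}" "{..<k}" E pref
  by unfold_locales (rule inst)

context ram_instance
begin

definition dg :: "nat \<Rightarrow> nat" where
  "dg a = card (nbr E a)"

definition nb :: "nat \<Rightarrow> nat \<Rightarrow> nat" where
  "nb a i = s0 ''adj'' [a, i]"

definition inp :: "store \<Rightarrow> bool" where
  "inp s \<longleftrightarrow> (\<forall>y\<in>inputs. s y = s0 y)"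

lemma inp_simps:
  assumes "inp s"
  shows "s ''size'' [] = k" "s ''kappa'' [] = \<kappa>" "s ''adj'' [a, i] = nb a i"
    "a < k \<Longrightarrow> s ''deg'' [a] = dg a"
    "a < k \<Longrightarrow> b \<in> nbr E a \<Longrightarrow> b' \<in> nbr E a \<Longrightarrow> s ''pref'' [a, b, b'] = (if pref a b b' then 1 else 0)"
  using assms enc by (simp_all add: inp_def inputs_def encodes_def nb_def dg_def)

lemma nb_bij: "a < k \<Longrightarrow> bij_betw (nb a) {..<dg a} (nbr E a)"
  using enc by (simp add: encodes_def nb_def[abs_def] dg_def)

lemma nb_in: "a < k \<Longrightarrow> i < dg a \<Longrightarrow> nb a i \<in> nbr E a"
  using nb_bij bij_betwE by blast

lemma nb_less: "a < k \<Longrightarrow> i < dg a \<Longrightarrow> nb a i < k"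
  using nb_in nbr_subset by blast

lemma bipartite_lists: "H \<subseteq> E \<Longrightarrow> bipartite_lists k H dg nb"
proof
  assume H: "H \<subseteq> E"
  show "H \<subseteq> {..<k} \<times> {..<k}" using H E_subset by blast
  fix a b assume "(a, b) \<in> H"
  then have "a < k" "b \<in> nbr E a" using H E_subset by (auto simp: nbr_def)
  then show "\<exists>i<dg a. nb a i = b"
    using nb_bij[of a] unfolding bij_betw_def by (metis imageE lessThan_iff)
qed

lemma sum_dg: "(\<Sum>a<k. dg a) = card E"
proof -
  have "E = Sigma {..<k} (nbr E)" using E_subset by (auto simp: nbr_def)
  moreover have "card (Sigma {..<k} (nbr E)) = (\<Sum>a<k. dg a)" by (simp add: dg_def)
  ultimately show ?thesis by simp
qed

lemma wp_SQRT:
  assumes s: "inp s" "s ''r'' [] = 0" "s ''w'' [] = 0"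
  shows "wp SQRT (\<lambda>t s'. k \<le> s' ''w'' [] * s' ''w'' [] \<and> s' ''w'' [] * s' ''w'' [] \<le> k + 2 * s' ''w'' [] \<and>
    t \<le> 12 * k + 5) s"
  unfolding SQRT_def wp_Seq wp_Assign
proof (rule wp_For[where N = k and f = "\<lambda>_. 8" and
      I = "\<lambda>i s. s ''o'' [] = 2 * s ''w'' [] + 1 \<and> s ''w'' [] * s ''w'' [] = i + s ''r'' [] \<and> s ''r'' [] \<le> 2 * s ''w'' []"],
      goal_cases)
  case (4 i s')
  then show ?case by (auto simp: upd_def algebra_simps)
qed (use s in \<open>auto simp: inp_simps(1) upd_def agree_def inp_def inputs_def\<close>)

lemma wp_CHECK:
  assumes s: "inp s"
  shows "wp CHECK (\<lambda>t s'. s' ''rej'' [] = (if \<exists>b<k. \<kappa> < s ''level'' [b] then 1 else 0) \<and> t \<le> 6 * k + 5) s"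
  unfolding CHECK_def wp_Seq wp_Assign
proof (rule wp_For[where N = k and f = "\<lambda>_. 2" and
      I = "\<lambda>i s'. s' ''rej'' [] = (if \<exists>b<i. \<kappa> < s ''level'' [b] then 1 else 0)"], goal_cases)
  case (4 i s')
  note f = agreeD[OF 4(4)]
  show ?case using 4(2,3) inp_simps[OF s] by (auto simp: f upd_def less_Suc_eq)
qed (auto simp: upd_def agree_def inp_simps[OF s])

text \<open>The entries from \<open>k\<close> on are part of the claim because
  \<open>consistent\<close> ranges over all numbers.\<close>

lemma wp_INIT:
  assumes s: "inp s" and mb: "\<And>b. k \<le> b \<Longrightarrow> s ''mb'' [b] = 0"
  shows "wp INIT (\<lambda>t s'. (\<forall>b. s' ''mb'' [b] = 0) \<and> (\<forall>b<k. s' ''pr'' [b] = 0) \<and>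
     (\<forall>a<k. s' ''d'' [a] = 0 \<and> s' ''pt'' [a] = 0) \<and> t \<le> 14 * k + 7) s"
  unfolding INIT_def wp_Seq
proof (rule wp_For[where N = k and f = "\<lambda>_. 3" and
      I = "\<lambda>i s'. (\<forall>b<i. s' ''mb'' [b] = 0 \<and> s' ''pr'' [b] = 0) \<and> (\<forall>b\<ge>k. s' ''mb'' [b] = 0)"], goal_cases)
  case (4 i s')
  then show ?case by (auto simp: upd_def less_Suc_eq)
next
  case (5 t s1)
  note f = agreeD[OF 5(2)]
  show ?case
  proof (rule wp_For[where N = k and f = "\<lambda>_. 3" and
      I = "\<lambda>i s'. \<forall>b<i. s' ''d'' [b] = 0 \<and> s' ''pt'' [b] = 0"], goal_cases)
    case (4 i s')
    then show ?case by (auto simp: upd_def less_Suc_eq)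
  next
    case (5 u s2)
    note g = agreeD[OF 5(2)]
    have "s2 ''mb'' [b] = 0" for b using \<open>(\<forall>b<k. _ b) \<and> _\<close> by (cases "b < k") (auto simp: g)
    then show ?case using 5 \<open>(\<forall>b<k. _ b) \<and> _\<close> \<open>t \<le> _\<close> by (simp add: g)
  qed (use 5 in \<open>auto simp: upd_def agree_def inp_simps[OF s]\<close>)
qed (auto simp: upd_def agree_def inp_simps[OF s] mb)

section \<open>Exactness of the edge flags\<close>

definition blocks :: "(nat \<Rightarrow> nat) \<Rightarrow> nat \<Rightarrow> nat \<Rightarrow> nat \<Rightarrow> bool" where
  "blocks l a b' b \<longleftrightarrow> int (l b) < pref_sign pref a b' b + int (l b')"

lemma level_graph_blocks:
  "(a, b) \<in> level_graph E pref l \<longleftrightarrow> (a, b) \<in> E \<and> \<not> (\<exists>b'\<in>nbr E a. blocks l a b' b)"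
  by (auto simp: level_graph_iff blocks_def not_less)

lemma bval_BLOCKS:
  assumes "inp s" "s ''a'' [] < k" "s x [] \<in> nbr E (s ''a'' [])" "s y [] \<in> nbr E (s ''a'' [])"
  shows "bval s (BLOCKS x y) \<longleftrightarrow> blocks (ar (s ''level'')) (s ''a'' []) (s x []) (s y [])"
  using assms pref_asym[OF assms(3,4)] pref_asym[OF assms(4,3)]
  by (auto simp: BLOCKS_def blocks_def pref_sign_def inp_simps)

lemma wp_FLAG_OBJECT:
  assumes s: "inp s" and a: "s ''a'' [] = a" "a < k" and b: "s ''b'' [] = b" "b \<in> nbr E a"
    and l: "ar (s ''level'') = l"
  shows "wp FLAG_OBJECT (\<lambda>t s'. (\<forall>a' b'. a' \<noteq> a \<longrightarrow> s' ''fl'' [a', b'] = s ''fl'' [a', b']) \<and>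
     (s' ''fl'' [a, b] \<noteq> 0 \<longleftrightarrow> (\<exists>x\<in>nbr E a. blocks l a x b)) \<and>
     (\<forall>b'\<in>nbr E a. b' \<noteq> b \<longrightarrow> (s' ''fl'' [a, b'] \<noteq> 0 \<longleftrightarrow> s ''fl'' [a, b'] \<noteq> 0 \<or> blocks l a b b')) \<and>
     t \<le> 11 * dg a + 5) s"
  unfolding FLAG_OBJECT_def wp_Seq wp_Assign
proof (rule wp_For[where N = "dg a" and f = "\<lambda>_. 7" and
    I = "\<lambda>i s'. (\<forall>a' b'. a' \<noteq> a \<longrightarrow> s' ''fl'' [a', b'] = s ''fl'' [a', b']) \<and>
     (s' ''fl'' [a, b] \<noteq> 0 \<longleftrightarrow> (\<exists>j<i. blocks l a (nb a j) b)) \<and>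
     (\<forall>b'. b' \<noteq> b \<longrightarrow> (s' ''fl'' [a, b'] \<noteq> 0 \<longleftrightarrow>
        s ''fl'' [a, b'] \<noteq> 0 \<or> (\<exists>j<i. b' = nb a j \<and> blocks l a b b')))"], goal_cases)
  case (4 i s')
  note f = agreeD[OF 4(4)]
  have e: "nb a i \<in> nbr E a" using nb_in a(2) 4(1) by blast
  \<comment> \<open>When the scan meets \<open>b\<close> itself, it must leave the flag of
    \<open>b\<close> alone.\<close>
  have irr: "\<not> blocks l a b b" using pref_irrefl b by (simp add: blocks_def pref_sign_def)
  let ?s = "s'(''e'' := (s' ''e'')([] := nb a i))"
  have inp: "inp (?s(''fl'' := g))" for g
    using s by (auto simp: inp_def inputs_def f)
  have 1: "bval (?s(''fl'' := g)) (BLOCKS ''e'' ''b'') \<longleftrightarrow> blocks l a (nb a i) b"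
    and 2: "bval (?s(''fl'' := g)) (BLOCKS ''b'' ''e'') \<longleftrightarrow> blocks l a b (nb a i)" for g
    using bval_BLOCKS[OF inp, of g] a b e l by (simp_all add: f)
  have "inp ?s" using s by (auto simp: inp_def inputs_def f)
  from bval_BLOCKS[OF this] have 3: "bval ?s (BLOCKS ''e'' ''b'') \<longleftrightarrow> blocks l a (nb a i) b"
    "bval ?s (BLOCKS ''b'' ''e'') \<longleftrightarrow> blocks l a b (nb a i)"
    using a b e l by (simp_all add: f)
  have adj: "s ''adj'' [a, i] = nb a i" by (rule inp_simps(3)[OF s])
  let ?P = "blocks l a (nb a i) b" and ?P' = "blocks l a b (nb a i)"
  show ?case
  proof (rule wp_mono)
    show "wp (Assign ''e'' [] (Loc ''adj'' [V ''a'', V ''j'']) ;;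
        If (BLOCKS ''e'' ''b'') (Assign ''fl'' [V ''a'', V ''b''] (Const 1)) Skip ;;
        If (BLOCKS ''b'' ''e'') (Assign ''fl'' [V ''a'', V ''e''] (Const 1)) Skip)
      (\<lambda>t u. t \<le> 7 \<and> (\<forall>is. u ''fl'' is =
         (if ?P \<and> is = [a, b] \<or> ?P' \<and> is = [a, nb a i] then 1 else s' ''fl'' is))) s'"
      using 4(3) a b by (cases ?P; cases ?P') (simp_all add: f adj 1 2 3)
  next
    fix t u
    assume u: "t \<le> 7 \<and> (\<forall>is. u ''fl'' is =
      (if ?P \<and> is = [a, b] \<or> ?P' \<and> is = [a, nb a i] then 1 else s' ''fl'' is))"
    have eq: "u ''fl'' [a, b] \<noteq> 0 \<longleftrightarrow> s' ''fl'' [a, b] \<noteq> 0 \<or> ?P"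
      using u irr by (cases "nb a i = b") auto
    have ne: "u ''fl'' [a, b'] \<noteq> 0 \<longleftrightarrow> s' ''fl'' [a, b'] \<noteq> 0 \<or> (b' = nb a i \<and> ?P')" if "b' \<noteq> b" for b'
      using u that by auto
    have other: "u ''fl'' [a', b'] = s' ''fl'' [a', b']" if "a' \<noteq> a" for a' b'
      using u that by auto
    have fl: "upd u ''j'' (Suc i) ''fl'' = u ''fl''" by (simp add: upd_def)
    show "t \<le> 7 \<and> (\<forall>a' b'. a' \<noteq> a \<longrightarrow> upd u ''j'' (Suc i) ''fl'' [a', b'] = s ''fl'' [a', b']) \<and>
     (upd u ''j'' (Suc i) ''fl'' [a, b] \<noteq> 0 \<longleftrightarrow> (\<exists>j<Suc i. blocks l a (nb a j) b)) \<and>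
     (\<forall>b'. b' \<noteq> b \<longrightarrow> (upd u ''j'' (Suc i) ''fl'' [a, b'] \<noteq> 0 \<longleftrightarrow>
        s ''fl'' [a, b'] \<noteq> 0 \<or> (\<exists>j<Suc i. b' = nb a j \<and> blocks l a b b')))"
      unfolding fl using 4(2) other ne eq u by (simp add: less_Suc_eq ex_disj_distrib conj_disj_distribR) metis
  qed
next
  case (5 t s')
  have nbr: "nbr E a = nb a ` {..<dg a}" using nb_bij[OF a(2)] by (simp add: bij_betw_def)
  show ?case using 5(1,3) unfolding nbr by auto
qed (use a b inp_simps[OF s] in \<open>auto simp: upd_def agree_def\<close>)

text \<open>
  Between two updates only the levels of the unmatched objects (\<open>mb b = 0\<close>) have been raised, so
  among the other objects the flags are still exact.
\<close>

definition flags_partial :: "(nat \<Rightarrow> nat) \<Rightarrow> (nat \<Rightarrow> bool) \<Rightarrow> (nat list \<Rightarrow> nat) \<Rightarrow> nat \<Rightarrow> bool" where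
  "flags_partial l ok fl a \<longleftrightarrow> (\<forall>b\<in>nbr E a. ok b \<longrightarrow>
     (fl [a, b] \<noteq> 0 \<longrightarrow> (\<exists>b'\<in>nbr E a. blocks l a b' b)) \<and>
     (\<forall>b'\<in>nbr E a. ok b' \<longrightarrow> blocks l a b' b \<longrightarrow> fl [a, b] \<noteq> 0))"

text \<open>The set of objects among which the flags are exact grows along the list: a raised object
  joins it once its own flag and its effect on the others are recorded.\<close>

lemma wp_FLAG_AGENT:
  assumes s: "inp s" and a: "s ''a'' [] = a" "a < k" and l: "ar (s ''level'') = l"
    and p: "flags_partial l (\<lambda>b. s ''mb'' [b] \<noteq> 0) (s ''fl'') a"
  shows "wp FLAG_AGENT (\<lambda>t s'. (\<forall>a' b'. a' \<noteq> a \<longrightarrow> s' ''fl'' [a', b'] = s ''fl'' [a', b']) \<and>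
     flags_partial l (\<lambda>_. True) (s' ''fl'') a \<and>
     t \<le> (\<Sum>i<dg a. 7 + 16 * (if s ''mb'' [nb a i] = 0 then dg a else 0)) + 3) s"
  unfolding FLAG_AGENT_def
proof (rule wp_For[where N = "dg a" and f = "\<lambda>i. 3 + 16 * (if s ''mb'' [nb a i] = 0 then dg a else 0)" and
    I = "\<lambda>i s'. (\<forall>a' b'. a' \<noteq> a \<longrightarrow> s' ''fl'' [a', b'] = s ''fl'' [a', b']) \<and>
     flags_partial l (\<lambda>b. s ''mb'' [b] \<noteq> 0 \<or> (\<exists>j<i. b = nb a j)) (s' ''fl'') a"], goal_cases)
  case 3
  then show ?case using p by (auto simp: flags_partial_def upd_def)
next
  case (4 i s')
  note f = agreeD[OF 4(4)]
  let ?b = "nb a i"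
  have b: "?b \<in> nbr E a" using nb_in a(2) 4(1) by blast
  have adj: "s ''adj'' [a, i] = nb a i" by (rule inp_simps(3)[OF s])
  have inp: "inp (s'(''b'' := g))" for g using s by (auto simp: inp_def inputs_def f)
  show ?case
  proof (cases "s ''mb'' [?b] = 0")
    case False
    then have ok: "(s ''mb'' [b] \<noteq> 0 \<or> (\<exists>j<Suc i. b = nb a j)) \<longleftrightarrow> (s ''mb'' [b] \<noteq> 0 \<or> (\<exists>j<i. b = nb a j))" for b
      by (auto simp: less_Suc_eq)
    have "flags_partial l (\<lambda>b. s ''mb'' [b] \<noteq> 0 \<or> (\<exists>j<Suc i. b = nb a j)) (s' ''fl'') a"
      using 4(2) unfolding ok by blast
    then show ?thesis
      using 4(2,3) a False by (simp add: f adj upd_def)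
  next
    case True
    let ?s = "s'(''b'' := (s' ''b'')([] := ?b))"
    have "wp FLAG_OBJECT (\<lambda>t s''. 3 + t \<le> 3 + 16 * dg a \<and>
       (\<forall>a' b'. a' \<noteq> a \<longrightarrow> s'' ''fl'' [a', b'] = s ''fl'' [a', b']) \<and>
       flags_partial l (\<lambda>b. s ''mb'' [b] \<noteq> 0 \<or> (\<exists>j<Suc i. b = nb a j)) (s'' ''fl'') a) ?s"
      (is "wp _ ?Q _")
    proof (rule wp_mono[OF wp_FLAG_OBJECT[OF inp, where a = a and b = ?b and l = l]])
      fix t s'' assume q: "(\<forall>a' b'. a' \<noteq> a \<longrightarrow> s'' ''fl'' [a', b'] = ?s ''fl'' [a', b']) \<and>
        (s'' ''fl'' [a, ?b] \<noteq> 0 \<longleftrightarrow> (\<exists>x\<in>nbr E a. blocks l a x ?b)) \<and>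
        (\<forall>b'\<in>nbr E a. b' \<noteq> ?b \<longrightarrow> (s'' ''fl'' [a, b'] \<noteq> 0 \<longleftrightarrow> ?s ''fl'' [a, b'] \<noteq> 0 \<or> blocks l a ?b b')) \<and>
        t \<le> 11 * dg a + 5"
      have q1: "s'' ''fl'' [a, ?b] \<noteq> 0 \<longleftrightarrow> (\<exists>x\<in>nbr E a. blocks l a x ?b)"
        and q2: "\<And>b'. b' \<in> nbr E a \<Longrightarrow> b' \<noteq> ?b \<Longrightarrow>
          s'' ''fl'' [a, b'] \<noteq> 0 \<longleftrightarrow> s' ''fl'' [a, b'] \<noteq> 0 \<or> blocks l a ?b b'"
        using q by simp_all
      \<comment> \<open>Allows the constant to be absorbed: 11 * dg a + 5 \<le> 16 * dg a.\<close>
      have "dg a \<noteq> 0" using 4(1) by simp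
      have "flags_partial l (\<lambda>b. s ''mb'' [b] \<noteq> 0 \<or> (\<exists>j<Suc i. b = nb a j)) (s'' ''fl'') a"
        unfolding flags_partial_def
      proof (intro ballI impI)
        fix b' assume b': "b' \<in> nbr E a" "s ''mb'' [b'] \<noteq> 0 \<or> (\<exists>j<Suc i. b' = nb a j)"
        show "(s'' ''fl'' [a, b'] \<noteq> 0 \<longrightarrow> (\<exists>b''\<in>nbr E a. blocks l a b'' b')) \<and>
           (\<forall>b''\<in>nbr E a. s ''mb'' [b''] \<noteq> 0 \<or> (\<exists>j<Suc i. b'' = nb a j) \<longrightarrow>
              blocks l a b'' b' \<longrightarrow> s'' ''fl'' [a, b'] \<noteq> 0)"
        proof (cases "b' = ?b")
          case True
          then show ?thesis using q1 by blast
        next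
          case False
          then have old: "s ''mb'' [b'] \<noteq> 0 \<or> (\<exists>j<i. b' = nb a j)"
            using b'(2) by (auto simp: less_Suc_eq)
          have "(s' ''fl'' [a, b'] \<noteq> 0 \<longrightarrow> (\<exists>b''\<in>nbr E a. blocks l a b'' b')) \<and>
             (\<forall>b''\<in>nbr E a. s ''mb'' [b''] \<noteq> 0 \<or> (\<exists>j<i. b'' = nb a j) \<longrightarrow>
              blocks l a b'' b' \<longrightarrow> s' ''fl'' [a, b'] \<noteq> 0)"
            using 4(2) b'(1) old unfolding flags_partial_def by blast
          then show ?thesis
            unfolding q2[OF b'(1) False] using b by (auto simp: less_Suc_eq)
        qed
      qed
      then show "?Q t s''" using q 4(2) \<open>dg a \<noteq> 0\<close> by auto
    qed (use a b l in \<open>simp_all add: f\<close>)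
    note * = this
    show ?thesis
      using True 4(3) a by (simp add: f adj) (rule wp_mono[OF *], simp add: upd_def)
  qed
next
  case (5 t s')
  have nbr: "b \<in> nbr E a \<Longrightarrow> \<exists>j<dg a. b = nb a j" for b
    using nb_bij[OF a(2)] by (auto simp: bij_betw_def)
  have "flags_partial l (\<lambda>_. True) (s' ''fl'') a"
    unfolding flags_partial_def
  proof (intro ballI impI)
    fix b assume b: "b \<in> nbr E a"
    show "(s' ''fl'' [a, b] \<noteq> 0 \<longrightarrow> (\<exists>b'\<in>nbr E a. blocks l a b' b)) \<and>
      (\<forall>b'\<in>nbr E a. True \<longrightarrow> blocks l a b' b \<longrightarrow> s' ''fl'' [a, b] \<noteq> 0)"
      using 5(1)[THEN conjunct2, unfolded flags_partial_def, rule_format, OF b] nbr[OF b] nbr by simp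
  qed
  then show ?case using 5(1,3) by (simp add: add.commute add.left_commute)
qed (use a inp_simps[OF s] in \<open>auto simp: upd_def agree_def\<close>)

text \<open>Despite its name the surviving subgraph: a nonzero flag removes an edge.\<close>

definition flagged :: "store \<Rightarrow> (nat \<times> nat) set" where
  "flagged s = {(a, b) \<in> E. s ''fl'' [a, b] = 0}"

definition raised_work :: "(nat \<Rightarrow> nat) \<Rightarrow> nat" where
  "raised_work mb = (\<Sum>a<k. \<Sum>i<dg a. if mb (nb a i) = 0 then dg a else 0)"

lemma wp_FLAGS:
  assumes s: "inp s" and l: "ar (s ''level'') = l"
    and p: "\<And>a. a < k \<Longrightarrow> flags_partial l (\<lambda>b. s ''mb'' [b] \<noteq> 0) (s ''fl'') a"
  shows "wp FLAGS (\<lambda>t s'. flagged s' = level_graph E pref l \<and>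
     t \<le> 7 * card E + 16 * raised_work (ar (s ''mb'')) + 7 * k + 3) s"
  unfolding FLAGS_def
proof (rule wp_For[where N = k and
    f = "\<lambda>a. (\<Sum>i<dg a. 7 + 16 * (if s ''mb'' [nb a i] = 0 then dg a else 0)) + 3" and
    I = "\<lambda>i s'. (\<forall>a b. i \<le> a \<longrightarrow> s' ''fl'' [a, b] = s ''fl'' [a, b]) \<and>
      (\<forall>a<i. flags_partial l (\<lambda>_. True) (s' ''fl'') a)"], goal_cases)
  case (4 i s')
  note f = agreeD[OF 4(4)]
  have inp: "inp s'" using s by (auto simp: inp_def inputs_def f)
  have p': "flags_partial l (\<lambda>b. s' ''mb'' [b] \<noteq> 0) (s' ''fl'') i"
    using p[OF 4(1)] 4(2) by (simp add: flags_partial_def f)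
  show ?case
  proof (rule wp_mono[OF wp_FLAG_AGENT[OF inp 4(3) 4(1) _ p']], goal_cases)
    case 1
    then show ?case using l by (simp add: f)
  next
    case (2 t s'')
    then show ?case using 4(2) by (auto simp: upd_def f less_Suc_eq flags_partial_def)
  qed
next
  case (5 t s')
  have "(a, b) \<in> flagged s' \<longleftrightarrow> (a, b) \<in> level_graph E pref l" for a b
  proof (cases "(a, b) \<in> E")
    case True
    then have "a < k" "b \<in> nbr E a" using E_subset by (auto simp: nbr_def)
    then have "s' ''fl'' [a, b] \<noteq> 0 \<longleftrightarrow> (\<exists>b'\<in>nbr E a. blocks l a b' b)"
      using 5(1) unfolding flags_partial_def by blast
    then show ?thesis using True by (auto simp: flagged_def level_graph_blocks)
  qed (simp add: flagged_def level_graph_blocks)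
  then have "flagged s' = level_graph E pref l" by auto
  moreover have "(\<Sum>a<k. (\<Sum>i<dg a. 7 + 16 * (if s ''mb'' [nb a i] = 0 then dg a else 0)) + 3 + 4)
      = 7 * (\<Sum>a<k. dg a) + 16 * raised_work (ar (s ''mb'')) + 7 * k"
    by (simp add: raised_work_def sum.distrib sum_distrib_left mult.commute)
  ultimately show ?case using 5(3) unfolding sum_dg by simp
qed (use inp_simps[OF s] in \<open>auto simp: upd_def agree_def\<close>)

end

section \<open>Auction phase on a fixed graph\<close>

locale ram_matching = ram_instance +
  fixes H :: "(nat \<times> nat) set"
  assumes H_E: "H \<subseteq> E"

sublocale ram_matching \<subseteq> bipartite_lists k H dg nb
  by (rule bipartite_lists[OF H_E])

context ram_matching
begin

lemma flag_test:
  assumes "flagged s = H" "a < k" "i < dg a"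
  shows "s ''fl'' [a, nb a i] = 0 \<longleftrightarrow> (a, nb a i) \<in> H"
  using assms nb_in[of a i] by (auto simp: flagged_def nbr_def)

abbreviation auction_state :: "nat \<Rightarrow> nat \<Rightarrow> nat \<Rightarrow> store \<Rightarrow> bool" where
  "auction_state L n cur s \<equiv> auction L n cur (ar (s ''mb'')) (ar (s ''mate'')) (ar (s ''d'')) (ar (s ''pt'')) (ar (s ''pr''))"

abbreviation work :: "nat \<Rightarrow> store \<Rightarrow> nat" where
  "work L s \<equiv> auction_work L (ar (s ''d'')) (ar (s ''pt''))"

text \<open>The unit added while somebody is bidding pays for giving up, the one move that leaves
  the work unchanged.\<close>

lemma wp_BID:
  assumes s: "inp s" "flagged s = H" "s ''w'' [] = L" and n: "n \<le> k"
    and a: "auction_state L n (s ''cur'' []) s" and cur: "s ''cur'' [] \<noteq> 0"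
  shows "wp BID (\<lambda>t s'. auction_state L n (s' ''cur'' []) s' \<and> t \<le> 16 \<and>
     work L s' + (if s' ''cur'' [] = 0 then 0 else 1) < work L s + 1) s"
proof -
  obtain x where x: "s ''cur'' [] = Suc x" using cur not0_implies_Suc by blast
  note a = a[unfolded x]
  have xk: "x < k" using a n by (auto simp: auction_def)
  note inp = inp_simps[OF s(1)]
  have ptle: "s ''pt'' [x] \<le> dg x" using auctionD(7)[OF a xk] by simp
  show ?thesis
  proof (cases "s ''d'' [x] < L")
    case False
    then have "auction_state L n 0 s" using auction_give_up[OF a] by simp
    then show ?thesis using False s(3) unfolding BID_def by (simp add: x)
  next
    case d: True
    show ?thesis
    proof (cases "s ''pt'' [x] < dg x")
      case False
      have "auction L n (Suc x) (ar (s ''mb'')) (ar (s ''mate''))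
        ((ar (s ''d''))(x := Suc (s ''d'' [x]))) ((ar (s ''pt''))(x := 0)) (ar (s ''pr''))"
        using auction_lift[OF a] False by simp
      moreover have "auction_work L ((ar (s ''d''))(x := Suc (s ''d'' [x]))) ((ar (s ''pt''))(x := 0)) < work L s"
        using auction_work_lift[OF xk, of "ar (s ''d'')" L "ar (s ''pt'')"] d ptle by simp
      ultimately show ?thesis using False d s(3) xk unfolding BID_def by (simp add: x inp)
    next
      case pt: True
      let ?b = "nb x (s ''pt'' [x])"
      note fl = flag_test[OF s(2) xk pt]
      have w: "auction_work L (ar (s ''d'')) ((ar (s ''pt''))(x := Suc (s ''pt'' [x]))) < work L s"
        using auction_work_advance[OF xk, of "ar (s ''d'')" L "ar (s ''pt'')"] d pt by simp
      show ?thesis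
      proof (cases "(x, ?b) \<in> H \<and> \<not> s ''d'' [x] < s ''pr'' [?b]")
        case True
        have "auction L n (s ''mb'' [?b]) ((ar (s ''mb''))(?b := Suc x)) ((ar (s ''mate''))(x := ?b))
          (ar (s ''d'')) ((ar (s ''pt''))(x := Suc (s ''pt'' [x]))) ((ar (s ''pr''))(?b := Suc (s ''pr'' [?b])))"
          using auction_take[OF a, of ?b] True pt by simp
        then show ?thesis using True d pt w s(3) xk unfolding BID_def by (simp add: x inp fl)
      next
        case False
        have "auction L n (Suc x) (ar (s ''mb'')) (ar (s ''mate''))
          (ar (s ''d'')) ((ar (s ''pt''))(x := Suc (s ''pt'' [x]))) (ar (s ''pr''))"
          using auction_skip[OF a] False pt by auto
        then show ?thesis using False d pt w s(3) xk unfolding BID_def by (auto simp: x inp fl)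
      qed
    qed
  qed
qed

lemma wp_AUCTION:
  assumes s: "inp s" "flagged s = H" "s ''w'' [] = L"
    and init: "\<And>b. s ''mb'' [b] = 0" "\<And>a. a < k \<Longrightarrow> s ''d'' [a] = 0" "\<And>a. a < k \<Longrightarrow> s ''pt'' [a] = 0"
      "\<And>b. b < k \<Longrightarrow> s ''pr'' [b] = 0"
  shows "wp AUCTION (\<lambda>t s'. consistent H (ar (s' ''mb'')) (ar (s' ''mate'')) \<and>
     (\<forall>M. matching H M \<longrightarrow> L * card M \<le> L * card {b. s' ''mb'' [b] \<noteq> 0} + k) \<and>
     t \<le> 25 * k + 3 + 18 * (L * (card E + k))) s"
  unfolding AUCTION_def
proof (rule wp_For_potential[where N = k and f = "\<lambda>_. 21" and \<psi> = "\<lambda>s. 18 * work L s" and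
      I = "\<lambda>n s'. auction_state L n 0 s'"], goal_cases)
  case 3
  show ?case using auction_init[of "ar (s ''mb'')" "ar (s ''d'')" "ar (s ''pt'')" "ar (s ''pr'')"] init
    by (simp add: upd_def)
next
  case (4 n s1)
  note f = agreeD[OF 4(4)]
  have inp: "inp s1" "flagged s1 = H" "s1 ''w'' [] = L"
    using s by (auto simp: inp_def inputs_def f flagged_def)
  let ?s = "s1(''cur'' := (s1 ''cur'')([] := Suc n))"
  have "wp (While (Less (Const 0) (V ''cur'')) BID)
    (\<lambda>t s2. auction_state L (Suc n) 0 s2 \<and> t + 18 * work L s2 \<le> 18 * work L s1 + 19) ?s"
  \<comment> \<open>The factor 18 is 16 for \<open>BID\<close> plus 2 for the loop; the 19 in the
    claim pays for the unit of the current bidder and the failing test.\<close>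
  proof (rule wp_While[where I = "\<lambda>s. auction_state L (Suc n) (s ''cur'' []) s" and
        \<mu> = "\<lambda>s. 18 * (work L s + (if s ''cur'' [] = 0 then 0 else 1))"], goal_cases)
    case 1
    show ?case using auction_admit[OF 4(2)] by simp
  next
    case (2 s2)
    note g = agreeD[OF 2(3)]
    have inp2: "inp s2" "flagged s2 = H" "s2 ''w'' [] = L"
      using inp by (auto simp: inp_def inputs_def g flagged_def)
    show ?case
      using wp_BID[OF inp2 _ 2(1)] 4(1) 2(2) by (auto elim!: wp_mono)
  next
    case (3 t s2)
    then show ?case by simp
  qed
  then show ?case
    unfolding wp_Seq wp_Assign using 4(3) by (auto simp: upd_def elim!: wp_mono)
next
  case (5 t s1)
  have "work L (upd s ''a'' 0) = (\<Sum>a<k. L * Suc (dg a))"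
    unfolding auction_work_def by (rule sum.cong) (simp_all add: init upd_def)
  also have "\<dots> = L * (card E + k)"
    unfolding sum_dg[symmetric] by (simp add: sum.distrib sum_distrib_left algebra_simps)
  finally have "t \<le> 25 * k + 3 + 18 * (L * (card E + k))" using 5(3) by simp
  moreover have "L * card M \<le> L * card {b. s1 ''mb'' [b] \<noteq> 0} + k" if "matching H M" for M
    using auction_deficiency[OF 5(1) that] by simp
  ultimately show ?case using auctionD(1)[OF 5(1)] by blast
qed (use inp_simps[OF s(1)] in \<open>auto simp: upd_def agree_def\<close>)

section \<open>Search phase on a fixed graph\<close>

abbreviation search_state :: "nat \<Rightarrow> nat \<Rightarrow> nat \<Rightarrow> store \<Rightarrow> bool" where
  "search_state qh i fnd s \<equiv>
     search (ar (s ''mb'')) (ar (s ''mate'')) (ar (s ''par'')) (ar (s ''q'')) (s ''qt'' []) qh i fnd"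

lemma wp_ROOTS:
  assumes s: "inp s"
  shows "wp ROOTS (\<lambda>t s'. search_state 0 0 0 s' \<and> t \<le> 14 * k + 9) s"
  unfolding ROOTS_def wp_Seq
proof (rule wp_For[where N = k and f = "\<lambda>_. 1" and
      I = "\<lambda>i s'. \<forall>b<i. s' ''par'' [b] = 0"], goal_cases)
  case (4 i s')
  then show ?case by (auto simp: upd_def less_Suc_eq)
next
  case (5 t s1)
  note f = agreeD[OF 5(2)]
  show ?case
    unfolding wp_Assign
  proof (rule wp_For[where N = k and f = "\<lambda>_. 4" and
      I = "\<lambda>i s'. inj_on (ar (s' ''q'')) {..<s' ''qt'' []} \<and>
        ar (s' ''q'') ` {..<s' ''qt'' []} = {a\<in>{..<i}. s ''mb'' [s ''mate'' [a]] \<noteq> Suc a}"], goal_cases)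
    case (4 i s')
    note g = agreeD[OF 4(4)]
    have new: "ar (s' ''q'') j \<noteq> i" if "j < s' ''qt'' []" for j
    proof -
      have "ar (s' ''q'') j \<in> ar (s' ''q'') ` {..<s' ''qt'' []}" using that by blast
      then show ?thesis using 4(2) by auto
    qed
    show ?case
    proof (cases "s ''mb'' [s ''mate'' [i]] = Suc i")
      case True
      then have "{a\<in>{..<Suc i}. s ''mb'' [s ''mate'' [a]] \<noteq> Suc a} = {a\<in>{..<i}. s ''mb'' [s ''mate'' [a]] \<noteq> Suc a}"
        by (auto simp: less_Suc_eq)
      then show ?thesis using True 4(2,3) by (simp add: f g upd_def)
    next
      case False
      let ?q = "ar (s' ''q'')" and ?n = "s' ''qt'' []"
      have "inj_on (?q(?n := i)) {..<Suc ?n}"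
        using 4(2) new by (auto simp: lessThan_Suc inj_on_def)
      moreover have "(?q(?n := i)) ` {..<Suc ?n} = insert i (?q ` {..<?n})"
        by (auto simp: lessThan_Suc)
      moreover have "{a\<in>{..<Suc i}. s ''mb'' [s ''mate'' [a]] \<noteq> Suc a}
        = insert i {a\<in>{..<i}. s ''mb'' [s ''mate'' [a]] \<noteq> Suc a}"
        using False by (auto simp: less_Suc_eq)
      ultimately show ?thesis
        using False 4(2,3) by (simp add: f g upd_def neq_iff[symmetric] del: ar_apply)
    qed
  next
    case (5 u s2)
    note g = agreeD[OF 5(2)]
    have "search_state 0 0 0 s2"
      using 5(1) \<open>\<forall>b<k. s1 ''par'' [b] = 0\<close> by (intro search_init) (simp_all add: f g)
    then show ?case using 5(3) \<open>t \<le> _\<close> by simp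
  qed (auto simp: upd_def agree_def f inp_simps[OF s])
qed (auto simp: upd_def agree_def inp_simps[OF s])

lemma wp_SCAN:
  assumes s: "inp s" "flagged s = H" and con: "consistent H (ar (s ''mb'')) (ar (s ''mate''))"
    and st: "search_state (s ''qh'' []) (s ''i'' []) 0 s" and qh: "s ''qh'' [] < s ''qt'' []"
    and fnd: "s ''fnd'' [] = 0"
  shows "wp SCAN (\<lambda>t s'. search_state (s' ''qh'' []) (s' ''i'' []) (s' ''fnd'' []) s' \<and> t \<le> 14 \<and>
    search_work (ar (s' ''q'')) (s' ''qh'' []) (s' ''i'' []) <
    search_work (ar (s ''q'')) (s ''qh'' []) (s ''i'' [])) s"
proof -
  define x i where "x = s ''q'' [s ''qh'' []]" and "i = s ''i'' []"
  have xk: "x < k" using st qh by (simp add: search_def x_def)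
  note inp = inp_simps[OF s(1)]
  note st = st[folded i_def]
  note work = search_work_step[OF st qh, simplified, folded x_def]
  show ?thesis
  proof (cases "i < dg x")
    case False
    then show ?thesis
      using search_next[OF st qh] work(2) xk fnd unfolding SCAN_def
      by (simp add: x_def[symmetric] i_def[symmetric] inp)
  next
    case i: True
    let ?b = "nb x i"
    note fl = flag_test[OF s(2) xk i]
    show ?thesis
    proof (cases "(x, ?b) \<in> H \<and> s ''par'' [?b] = 0")
      case False
      then show ?thesis
        using search_skip[OF st qh] work(1) i xk fnd unfolding SCAN_def
        by (auto simp: x_def[symmetric] i_def[symmetric] inp fl)
    next
      case new: True
      show ?thesis
      proof (cases "s ''mb'' [?b]")
        case 0
        then show ?thesis
          using search_found[OF st qh, of ?b] work(1) i xk fnd new unfolding SCAN_def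
          by (simp add: x_def[symmetric] i_def[symmetric] inp fl)
      next
        case (Suc a)
        have "search_work ((ar (s ''q''))(s ''qt'' [] := a)) (s ''qh'' []) (Suc i)
          < search_work (ar (s ''q'')) (s ''qh'' []) i"
          using work(1) i qh by (simp add: search_work_cong)
        then show ?thesis
          using search_push[OF st con qh, of ?b a] i xk fnd new Suc unfolding SCAN_def
          by (simp add: x_def[symmetric] i_def[symmetric] inp fl)
      qed
    qed
  qed
qed

abbreviation flip_state :: "nat \<Rightarrow> store \<Rightarrow> bool" where
  "flip_state J s \<equiv> flipping J (s ''b'' []) (ar (s ''mb'')) (ar (s ''mate'')) (ar (s ''par'')) (ar (s ''q''))"

text \<open>The bound \<open>J\<close> on queue positions is not stored by the program, so it is
  kept in the time credit, as a multiple of 15.\<close>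

lemma wp_FLIP_loop:
  assumes "flip_state J s" "s ''cont'' [] = 1"
  shows "wp (While (Less (Const 0) (V ''cont'')) FLIP)
    (\<lambda>t s'. consistent H (ar (s' ''mb'')) (ar (s' ''mate'')) \<and>
      card {b. s' ''mb'' [b] \<noteq> 0} = Suc (card {b. s ''mb'' [b] \<noteq> 0}) \<and> t \<le> 15 * J + 1) s"
proof (rule wp_While_credit[where n = "15 * J" and I = "\<lambda>n s'.
    if s' ''cont'' [] = 0 then n = 0 \<and> consistent H (ar (s' ''mb'')) (ar (s' ''mate'')) \<and>
      card {b. s' ''mb'' [b] \<noteq> 0} = Suc (card {b. s ''mb'' [b] \<noteq> 0})
    else 15 dvd n \<and> flip_state (n div 15) s' \<and> s' ''cont'' [] = 1 \<and>
      card {b. s' ''mb'' [b] \<noteq> 0} = card {b. s ''mb'' [b] \<noteq> 0}"], goal_cases)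
  case 1
  then show ?case using assms by simp
next
  case (2 n s')
  then obtain J where J: "n = 15 * J" "flip_state J s'" "s' ''cont'' [] = 1"
    "card {b. s' ''mb'' [b] \<noteq> 0} = card {b. s ''mb'' [b] \<noteq> 0}"
    by (auto split: if_splits elim!: dvdE)
  then obtain j where "j < J" "s' ''par'' [s' ''b'' []] = Suc (s' ''q'' [j])" by (auto simp: flipping_def)
  then obtain x where x: "s' ''par'' [s' ''b'' []] = Suc x" and J0: "1 \<le> J" by auto
  then have x': "ar (s' ''par'') (s' ''b'' []) = Suc x" by simp
  show ?case
  proof (cases "s' ''mb'' [s' ''mate'' [x]] = Suc x")
    case True
    then have "\<exists>J'<J. flipping J' (s' ''mate'' [x])
        ((ar (s' ''mb''))(s' ''mate'' [x] := 0, s' ''b'' [] := Suc x))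
        ((ar (s' ''mate''))(x := s' ''b'' [])) (ar (s' ''par'')) (ar (s' ''q''))"
      using flipping_step(1)[OF J(2), of x] x by simp
    then obtain J' where "J' < J" and f: "flipping J' (s' ''mate'' [x])
        ((ar (s' ''mb''))(s' ''mate'' [x] := 0, s' ''b'' [] := Suc x))
        ((ar (s' ''mate''))(x := s' ''b'' [])) (ar (s' ''par'')) (ar (s' ''q''))"
      by blast
    have "card {b'. ((ar (s' ''mb''))(s' ''mate'' [x] := 0, s' ''b'' [] := Suc x)) b' \<noteq> 0}
        = card {b. s ''mb'' [b] \<noteq> 0}"
      using flipping_step(2)[OF J(2) x'] True J(4) by simp
    moreover have "{b'. ((ar (s' ''mb''))(s' ''mate'' [x] := 0, s' ''b'' [] := Suc x)) b' \<noteq> 0}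
      = {b'. ((s' ''mb'')([s' ''mate'' [x]] := 0, [s' ''b'' []] := Suc x)) [b'] \<noteq> 0}" by auto
    ultimately show ?thesis
      using True f J(1,3) \<open>J' < J\<close> unfolding FLIP_def
      by (auto simp: x intro!: exI[of _ "15 * J'"])
  next
    case False
    have "consistent H ((ar (s' ''mb''))(s' ''b'' [] := Suc x)) ((ar (s' ''mate''))(x := s' ''b'' []))"
      using flipping_last(1)[OF J(2) x'] False by simp
    moreover have "card {b'. ((ar (s' ''mb''))(s' ''b'' [] := Suc x)) b' \<noteq> 0}
        = Suc (card {b. s ''mb'' [b] \<noteq> 0})"
      using flipping_last(2)[OF J(2) x'] False J(4) by simp
    moreover have "{b'. ((ar (s' ''mb''))(s' ''b'' [] := Suc x)) b' \<noteq> 0}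
      = {b'. ((s' ''mb'')([s' ''b'' []] := Suc x)) [b'] \<noteq> 0}" by auto
    ultimately show ?thesis
      using False J(1,3) J0 unfolding FLIP_def by (auto simp: x)
  qed
next
  case (3 n t s')
  then show ?case by simp
qed

lemma wp_AUGMENT:
  assumes s: "inp s" "flagged s = H" and con: "consistent H (ar (s ''mb'')) (ar (s ''mate''))"
  shows "wp AUGMENT (\<lambda>t s'. consistent H (ar (s' ''mb'')) (ar (s' ''mate'')) \<and>
     (s' ''go'' [] = s ''go'' [] \<and> card {b. s' ''mb'' [b] \<noteq> 0} = Suc (card {b. s ''mb'' [b] \<noteq> 0}) \<or>
      s' ''go'' [] = 0 \<and> (\<forall>M. matching H M \<longrightarrow> card M \<le> card {b. s' ''mb'' [b] \<noteq> 0})) \<and>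
     t \<le> 60 * (k + card E) + 30) s"
  unfolding AUGMENT_def wp_Seq
proof (rule wp_frame[OF wp_ROOTS[OF s(1)]], goal_cases)
  case (1 t1 s1)
  note f = agreeD[OF 1(2), simplified]
  let ?s = "s1(''qh'' := (s1 ''qh'')([] := 0), ''i'' := (s1 ''i'')([] := 0), ''fnd'' := (s1 ''fnd'')([] := 0))"
  have work: "search_work (ar (s1 ''q'')) 0 0 = k + card E"
    by (simp add: search_work_def sum_dg[symmetric] sum_Suc)
  have "wp (While (And (Less (V ''qh'') (V ''qt'')) (Less (V ''fnd'') (Const 1))) SCAN)
    (\<lambda>t s2. search_state (s2 ''qh'' []) (s2 ''i'' []) (s2 ''fnd'' []) s2 \<and>
       (s2 ''fnd'' [] = 0 \<longrightarrow> \<not> s2 ''qh'' [] < s2 ''qt'' []) \<and> agree (mods SCAN) s2 ?s \<and>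
       t \<le> 16 * (k + card E) + 1) ?s"
  proof (rule wp_While[where I = "\<lambda>s. search_state (s ''qh'' []) (s ''i'' []) (s ''fnd'' []) s" and
        \<mu> = "\<lambda>s. 16 * search_work (ar (s ''q'')) (s ''qh'' []) (s ''i'' [])"], goal_cases)
    case 1
    show ?case using \<open>search_state 0 0 0 s1 \<and> _\<close> by simp
  next
    case (2 s2)
    note g = agreeD[OF 2(3), simplified]
    have inp2: "inp s2" "flagged s2 = H"
      using s by (auto simp: inp_def inputs_def g f flagged_def)
    have con2: "consistent H (ar (s2 ''mb'')) (ar (s2 ''mate''))"
      using con by (simp add: g f)
    from 2 have "wp SCAN (\<lambda>t s'. search_state (s' ''qh'' []) (s' ''i'' []) (s' ''fnd'' []) s' \<and> t \<le> 14 \<and>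
      search_work (ar (s' ''q'')) (s' ''qh'' []) (s' ''i'' []) <
      search_work (ar (s2 ''q'')) (s2 ''qh'' []) (s2 ''i'' [])) s2"
      by (intro wp_SCAN[OF inp2 con2]) simp_all
    then show ?case by (rule wp_mono) auto
  next
    case (3 t s2)
    then show ?case using work by auto
  qed
  note loop = this
  show ?case
    unfolding wp_Assign
  proof (simp, rule wp_mono[OF loop[simplified]], goal_cases)
    case (1 t s2)
    note g = agreeD[OF 1[THEN conjunct2, THEN conjunct2, THEN conjunct1], simplified]
    have con2: "consistent H (ar (s2 ''mb'')) (ar (s2 ''mate''))"
      using con by (simp add: g f)
    have st: "search_state (s2 ''qh'' []) (s2 ''i'' []) (s2 ''fnd'' []) s2" using 1 by simp
    have qt: "s2 ''qt'' [] \<le> k" using search_queue_le[OF st] .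
    have t1: "t1 \<le> 14 * k + 9" using \<open>search_state 0 0 0 s1 \<and> _\<close> by simp
    show ?case
    proof (cases "s2 ''fnd'' []")
      case 0
      then show ?thesis
        using search_fail[OF con2, of "ar (s2 ''par'')" "ar (s2 ''q'')" "s2 ''qt'' []" "s2 ''qh'' []" "s2 ''i'' []"]
          1 con2 t1 by simp
    next
      case (Suc b)
      let ?s2 = "s2(''b'' := (s2 ''b'')([] := b), ''cont'' := (s2 ''cont'')([] := 1))"
      have flip: "flip_state (s2 ''qt'' []) ?s2"
        using flipping_start[OF st[unfolded Suc] con2] by simp
      have cont: "?s2 ''cont'' [] = 1" by simp
      from wp_FLIP_loop[OF flip cont]
      have "wp (While (Less (Const 0) (V ''cont'')) FLIP)
        (\<lambda>t s'. consistent H (ar (s' ''mb'')) (ar (s' ''mate'')) \<and>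
          card {b. s' ''mb'' [b] \<noteq> 0} = Suc (card {b. s2 ''mb'' [b] \<noteq> 0}) \<and> t \<le> 15 * k + 1 \<and>
          s' ''go'' [] = s2 ''go'' []) ?s2"
        by (rule wp_frame) (use qt in \<open>auto simp: agree_def\<close>)
      then show ?thesis
        using Suc by (simp, elim wp_mono) (use 1 t1 in \<open>simp add: g f\<close>)
    qed
  qed
qed

lemma wp_SEARCH:
  assumes s: "inp s" "flagged s = H" and con: "consistent H (ar (s ''mb'')) (ar (s ''mate''))"
    and bound: "\<And>M. matching H M \<Longrightarrow> card M \<le> card {b. s ''mb'' [b] \<noteq> 0} + L"
  shows "wp SEARCH (\<lambda>t s'. consistent H (ar (s' ''mb'')) (ar (s' ''mate'')) \<and>
     (\<forall>M. matching H M \<longrightarrow> card M \<le> card {b. s' ''mb'' [b] \<noteq> 0}) \<and>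
     t \<le> (60 * (k + card E) + 32) * (L + 1) + 3) s"
proof -
  \<comment> \<open>One more than the largest size possible, so that the credit also covers the
    last, unsuccessful search after up to \<open>L\<close> augmentations.\<close>
  define C where "C = card {b. s ''mb'' [b] \<noteq> 0} + L + 1"
  define T where "T = 60 * (k + card E) + 32"
  let ?n = "\<lambda>s. card {b. s ''mb'' [b] \<noteq> 0}"
  have less: "?n s' < C" if "consistent H (ar (s' ''mb'')) (ar (s' ''mate''))" for s' :: store
    using bound[OF consistent_matching[OF that]] card_mate_edges[OF that] by (simp add: C_def)
  show ?thesis
    unfolding SEARCH_def wp_Seq wp_Assign
  proof (rule wp_While[where I = "\<lambda>s. consistent H (ar (s ''mb'')) (ar (s ''mate'')) \<and>
        (s ''go'' [] = 0 \<longrightarrow> (\<forall>M. matching H M \<longrightarrow> card M \<le> ?n s))" and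
        \<mu> = "\<lambda>s. if s ''go'' [] = 0 then 0 else T * (C - ?n s)"], goal_cases)
    case 1
    show ?case using con by simp
  next
    case (2 s2)
    note g = agreeD[OF 2(3), simplified]
    have inp2: "inp s2" "flagged s2 = H"
      using s by (auto simp: inp_def inputs_def g flagged_def)
    have con2: "consistent H (ar (s2 ''mb'')) (ar (s2 ''mate''))" using 2 by blast
    show ?case
    proof (rule wp_mono[OF wp_AUGMENT[OF inp2 con2]], goal_cases)
      case (1 t s3)
      then have t: "t + 2 \<le> T" by (simp add: T_def)
      have con3: "consistent H (ar (s3 ''mb'')) (ar (s3 ''mate''))" using 1 by blast
      obtain e where e: "C - ?n s2 = Suc e" using less[OF con2] by (metis Suc_diff_Suc)
      show ?case
      proof (cases "s3 ''go'' [] = 0")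
        case True
        then show ?thesis using 1 2(2) t less[OF con2] e by auto
      next
        case False
        then have "?n s3 = Suc (?n s2)" using 1 by auto
        then have "C - ?n s3 = e" using e by simp
        then show ?thesis using 1 2(2) t e False by auto
      qed
    qed
  next
    case (3 t s2)
    then show ?case by (simp add: C_def T_def)
  qed
qed

end

section \<open>A complete round\<close>

context ram_instance
begin

lemma wp_FINISH:
  assumes s: "inp s"
  shows "wp FINISH (\<lambda>t s'.
     (if \<forall>b<k. s ''mb'' [b] \<noteq> 0 then s' ''status'' [] = 1
      else s' ''status'' [] = s ''status'' [] \<and>
        (\<forall>b. s' ''level'' [b] = (if b < k \<and> s ''mb'' [b] = 0 then s ''level'' [b] + 1 else s ''level'' [b]))) \<and>
     t \<le> 12 * k + 12) s"
  unfolding FINISH_def wp_Seq wp_Assign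
proof (rule wp_For[where N = k and f = "\<lambda>_. 2" and
      I = "\<lambda>i s'. s' ''ok'' [] = (if \<forall>b<i. s ''mb'' [b] \<noteq> 0 then 1 else 0)"], goal_cases)
  case (4 i s')
  note f = agreeD[OF 4(4)]
  show ?case using 4(2,3) by (auto simp: f upd_def less_Suc_eq)
next
  case (5 t s1)
  note f = agreeD[OF 5(2), simplified]
  have loop: "wp (For ''b'' (V ''size'')
          (If (Less (Loc ''mb'' [V ''b'']) (Const 1))
             (Assign ''level'' [V ''b''] (Inc (Loc ''level'' [V ''b''])))
             Skip))
     (\<lambda>t s'. (\<forall>b. s' ''level'' [b] = (if b < k \<and> s ''mb'' [b] = 0 then s ''level'' [b] + 1 else s ''level'' [b])) \<and>
        s' ''status'' [] = s ''status'' [] \<and> t \<le> 6 * k + 3) s1"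
  proof (rule wp_For[where N = k and f = "\<lambda>_. 2" and
      I = "\<lambda>i s'. \<forall>b. s' ''level'' [b] = (if b < i \<and> s ''mb'' [b] = 0 then s ''level'' [b] + 1 else s ''level'' [b])"],
      goal_cases)
    case (4 i s')
    note g = agreeD[OF 4(4)]
    show ?case using 4(2,3) by (auto simp: f g upd_def less_Suc_eq)
  next
    case (5 u s2)
    note g = agreeD[OF 5(2), simplified]
    show ?case using 5(1,3) by (simp add: f g)
  qed (auto simp: upd_def agree_def f inp_simps[OF s])
  show ?case
  proof (cases "\<forall>b<k. s ''mb'' [b] \<noteq> 0")
    case True
    then show ?thesis using 5(1,3) by simp
  next
    case False
    have "s1 ''ok'' [] = 0" using 5(1) False by (simp only: if_False)
    then show ?thesis
      using 5(3) unfolding wp_If if_not_P[OF False] by (auto simp del: One_nat_def intro!: wp_mono[OF loop])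
  qed
qed (auto simp: upd_def agree_def inp_simps[OF s])

lemma in_Range_mate_edges_iff: "b \<in> Range (mate_edges mb) \<longleftrightarrow> mb b \<noteq> 0"
  by (simp add: Range_mate_edges)

definition loop_state :: "nat \<Rightarrow> (nat \<Rightarrow> nat) \<Rightarrow> store \<Rightarrow> bool" where
  "loop_state L l s \<longleftrightarrow> inp s \<and> s ''status'' [] = 0 \<and> s ''w'' [] = L \<and> ar (s ''level'') = l \<and>
     (\<forall>b\<ge>k. s ''mb'' [b] = 0) \<and> (\<forall>a<k. flags_partial l (\<lambda>b. s ''mb'' [b] \<noteq> 0) (s ''fl'') a)"

text \<open>Covers everything except the flag updates for raised objects, which are amortised over
  the whole run.\<close>

definition round_time :: "nat \<Rightarrow> nat" where
  "round_time L = 120 * (k + card E + 1) * (L + 1)"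

lemma wp_ROUND:
  assumes s: "loop_state L l s" and L: "k \<le> L * L"
  shows "wp ROUND (\<lambda>t s'. (\<exists>M. maximum_matching (level_graph E pref l) M \<and>
      (if perfect {..<k} {..<k} M then s' ''status'' [] = 1 \<and> M = {(a, s' ''mate'' [a]) |a. a < k}
       else loop_state L (raise_unmatched {..<k} M l) s' \<and> (\<forall>b. s' ''mb'' [b] = 0 \<longleftrightarrow> b \<notin> Range M))) \<and>
     t \<le> round_time L + 16 * raised_work (ar (s ''mb''))) s"
proof -
  define H where "H = level_graph E pref l"
  interpret ram_matching k E pref \<kappa> s0 H
    by unfold_locales (simp add: H_def level_graph_subset)
  have s': "inp s" "ar (s ''level'') = l" "s ''w'' [] = L" "\<And>b. k \<le> b \<Longrightarrow> s ''mb'' [b] = 0"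
    "\<And>a. a < k \<Longrightarrow> flags_partial l (\<lambda>b. s ''mb'' [b] \<noteq> 0) (s ''fl'') a" "s ''status'' [] = 0"
    using s by (auto simp: loop_state_def)
  show ?thesis
    unfolding ROUND_def wp_Seq
  proof (rule wp_frame[OF wp_FLAGS[OF s'(1,2,5)]], goal_cases)
    case (2 t1 s1)
    note f1 = agreeD[OF 2(2), simplified]
    note F1 = 2(1)
    have i1: "inp s1" "flagged s1 = H" using s'(1) F1 by (auto simp: inp_def inputs_def f1 H_def)
    have mb1: "\<And>b. k \<le> b \<Longrightarrow> s1 ''mb'' [b] = 0" using s'(4) by (simp add: f1)
    show ?case
    proof (rule wp_frame[OF wp_INIT[OF i1(1) mb1]], goal_cases)
      case (2 t2 s2)
      note f2 = agreeD[OF 2(2), simplified]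
      note F2 = 2(1)
      have i2: "inp s2" "flagged s2 = H" "s2 ''w'' [] = L"
        using s'(3) i1 by (auto simp: inp_def inputs_def flagged_def f2 f1)
      show ?case
      proof (rule wp_frame[OF wp_AUCTION[OF i2]], goal_cases)
        case (5 t3 s3)
        note f3 = agreeD[OF 5(2), simplified]
        note F3 = 5(1)
        have i3: "inp s3" "flagged s3 = H"
          using i2 by (auto simp: inp_def inputs_def flagged_def f3)
        have bound: "card M \<le> card {b. s3 ''mb'' [b] \<noteq> 0} + L" if M: "matching H M" for M
        \<comment> \<open>The factor \<open>L\<close> cannot be cancelled if it is 0, but then
          \<open>k = 0\<close> and there are no edges.\<close>
        proof (cases "L = 0")
          case True
          then have "H = {}" using L H_subset by auto
          then show ?thesis using M by (simp add: matching_def)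
        next
          case False
          have "L * card M \<le> L * card {b. s3 ''mb'' [b] \<noteq> 0} + k" using F3 M by blast
          also have "\<dots> \<le> L * (card {b. s3 ''mb'' [b] \<noteq> 0} + L)" using L by (simp add: algebra_simps)
          finally show ?thesis using False by simp
        qed
        show ?case
        proof (rule wp_frame[OF wp_SEARCH[OF i3 _ bound]], goal_cases)
          case 1
          then show ?case using F3 by blast
        next
          case (3 t4 s4)
          note f4 = agreeD[OF 3(2), simplified]
          note F4 = 3(1)
          have i4: "inp s4" using i3 by (auto simp: inp_def inputs_def f4)
          define M where "M = mate_edges (ar (s4 ''mb''))"
          have con: "consistent H (ar (s4 ''mb'')) (ar (s4 ''mate''))" using F4 by blast
          have M: "matching H M" unfolding M_def using con by (rule consistent_matching)
          have ME: "matching E M" using M H_E by (rule matching_mono)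
          have max: "maximum_matching (level_graph E pref l) M"
            using M F4 card_mate_edges[OF con] by (simp add: maximum_matching_def H_def M_def)
          have ran: "b \<in> Range M \<longleftrightarrow> s4 ''mb'' [b] \<noteq> 0" for b by (simp add: M_def in_Range_mate_edges_iff)
          have perf: "perfect {..<k} {..<k} M \<longleftrightarrow> (\<forall>b<k. s4 ''mb'' [b] \<noteq> 0)"
            unfolding perfect_iff_Range[OF ME] by (simp only: subset_iff lessThan_iff ran)
          have time: "t1 + 1 + (t2 + 1 + (t3 + 1 + (t4 + 1 + t5))) \<le> round_time L + 16 * raised_work (ar (s ''mb''))"
            if "t5 \<le> 12 * k + 12" for t5
            using that F1 F2 F3 F4 by (simp add: round_time_def algebra_simps)
          show ?case
          proof (rule wp_frame[OF wp_FINISH[OF i4]], goal_cases)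
            case (1 t5 s5)
            note f5 = agreeD[OF 1(2), simplified]
            have t5: "t5 \<le> 12 * k + 12" using 1(1) by blast
            have res: "if perfect {..<k} {..<k} M then s5 ''status'' [] = 1 \<and> M = {(a, s5 ''mate'' [a]) |a. a < k}
               else loop_state L (raise_unmatched {..<k} M l) s5 \<and> (\<forall>b. s5 ''mb'' [b] = 0 \<longleftrightarrow> b \<notin> Range M)"
            proof (cases "perfect {..<k} {..<k} M")
              case True
              then have "Domain M = {..<k}" by (simp add: perfect_def)
              then have "M = {(a, s4 ''mate'' [a]) |a. a < k}"
                using con unfolding M_def mate_edges_def consistent_def by auto
              moreover have "s5 ''status'' [] = 1" using 1(1) True unfolding perf by simp
              ultimately show ?thesis using True by (simp add: f5)
            next
              case False
              define l' where "l' = raise_unmatched {..<k} M l"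
              have lev: "s5 ''level'' [b] = (if b < k \<and> s4 ''mb'' [b] = 0 then s4 ''level'' [b] + 1 else s4 ''level'' [b])"
                and st: "s5 ''status'' [] = s4 ''status'' []" for b
                using 1(1) False unfolding perf by (simp_all only: if_False)
              have l: "s4 ''level'' [b] = l b" for b using s'(2) by (auto simp: f4 f3 f2 f1)
              have l'b: "l' b = (if b < k \<and> s4 ''mb'' [b] = 0 then l b + 1 else l b)" for b
                using ran by (simp add: l'_def raise_unmatched_def)
              have "ar (s5 ''level'') = l'" using lev l l'b by (auto simp: ar_def)
              moreover have "inp s5" using i4 by (auto simp: inp_def inputs_def f5)
              moreover have "s5 ''status'' [] = 0" "s5 ''w'' [] = L"
                using s' st by (simp_all add: f5 f4 f3 f2 f1)
              moreover have "s5 ''mb'' [b] = 0" if "k \<le> b" for b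
              proof (rule ccontr)
                assume "s5 ''mb'' [b] \<noteq> 0"
                then have "b \<in> Range M" using ran by (simp add: f5)
                then show False using Range_matching[OF ME] that by auto
              qed
              \<comment> \<open>Matched objects keep their levels. So among them the obstructions
                are those of \<open>l\<close>, and an obstruction by a raised object persists
                because its level only grew.\<close>
              moreover have "flags_partial l' (\<lambda>b. s5 ''mb'' [b] \<noteq> 0) (s5 ''fl'') a" if a: "a < k" for a
                unfolding flags_partial_def
              proof (intro ballI impI)
                fix b assume b: "b \<in> nbr E a" "s5 ''mb'' [b] \<noteq> 0"
                have "s5 ''fl'' [a, b] \<noteq> 0 \<longleftrightarrow> (a, b) \<notin> flagged s1"
                  using b by (auto simp: flagged_def nbr_def f5 f4 f3 f2)
                then have fl: "s5 ''fl'' [a, b] \<noteq> 0 \<longleftrightarrow> (\<exists>b'\<in>nbr E a. blocks l a b' b)"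
                  using F1 b by (auto simp: level_graph_blocks nbr_def)
                have same: "l' b = l b" if "s5 ''mb'' [b] \<noteq> 0" for b using that l'b by (simp add: f5)
                have le: "l b \<le> l' b" for b using l'b by simp
                show "(s5 ''fl'' [a, b] \<noteq> 0 \<longrightarrow> (\<exists>b'\<in>nbr E a. blocks l' a b' b)) \<and>
                  (\<forall>b'\<in>nbr E a. s5 ''mb'' [b'] \<noteq> 0 \<longrightarrow> blocks l' a b' b \<longrightarrow> s5 ''fl'' [a, b] \<noteq> 0)"
                proof (intro conjI impI ballI)
                  assume "s5 ''fl'' [a, b] \<noteq> 0"
                  then obtain b' where "b' \<in> nbr E a" "blocks l a b' b" using fl by blast
                  then show "\<exists>b'\<in>nbr E a. blocks l' a b' b"
                    using same[OF b(2)] le[of b'] by (auto simp: blocks_def intro!: bexI[of _ b'])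
                next
                  fix b' assume "b' \<in> nbr E a" "s5 ''mb'' [b'] \<noteq> 0" "blocks l' a b' b"
                  then show "s5 ''fl'' [a, b] \<noteq> 0"
                    unfolding fl using same b(2) by (auto simp: blocks_def)
                qed
              qed
              moreover have "\<forall>b. s5 ''mb'' [b] = 0 \<longleftrightarrow> b \<notin> Range M" using ran by (simp add: f5)
              ultimately show ?thesis using False by (simp add: loop_state_def l'_def)
            qed
            show ?case using res max time[OF t5] by blast
          qed
        qed
      qed (use F2 in simp_all)
    qed
  qed (use s' in simp_all)
qed

section \<open>Simulation of complete runs\<close>

definition run_from :: "(nat \<Rightarrow> nat) \<Rightarrow> store \<Rightarrow> nat \<Rightarrow> bool" where
  "run_from l s T \<longleftrightarrow> (\<exists>r c \<tau>. c 0 = Running l \<and>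
     (\<forall>i<r. trunc_step {..<k} {..<k} E pref \<kappa> (c i) (c (Suc i))) \<and>
     final_config {..<k} {..<k} E pref \<kappa> (c r) \<and>
     (\<forall>i<r. \<tau> i < \<tau> (Suc i)) \<and> \<tau> r = T \<and> fst (ram_at MAIN s T) = Skip \<and>
     (\<forall>i\<le>r. represents k (snd (ram_at MAIN s (\<tau> i))) (c i)))"

lemma MAIN_iteration:
  assumes "s ''status'' [] = 0" "runs STEP s t s'"
  shows "ram_at MAIN s (t + 2) = (MAIN, s')"
  using runs_Seq_ram_at[OF assms(2), of MAIN] assms(1)
  by (simp add: ram_at_Suc MAIN_def del: runs.simps)

lemma MAIN_exit:
  assumes "s ''status'' [] \<noteq> 0"
  shows "ram_at MAIN s 1 = (Skip, s)"
  using assms by (simp add: ram_at_Suc MAIN_def)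

lemma run_from_stop:
  assumes s: "s ''status'' [] = 0" "ar (s ''level'') = l" and run: "runs STEP s t s'"
    and s': "s' ''status'' [] \<noteq> 0" "represents k s' c'"
    and step: "trunc_step {..<k} {..<k} E pref \<kappa> (Running l) c'" "final_config {..<k} {..<k} E pref \<kappa> c'"
  shows "run_from l s (t + 3)"
proof -
  \<comment> \<open>Two steps surround the body of the loop, and the third is the failing test that
    halts \<open>MAIN\<close>.\<close>
  have at: "ram_at MAIN s (t + 3) = (Skip, s')"
    using ram_at_add[of MAIN s "t + 2" 1] MAIN_iteration[OF s(1) run] MAIN_exit[of s', OF s'(1)]
    by (simp add: eval_nat_numeral)
  have "represents k s (Running l)" using s by auto
  then show ?thesis
    unfolding run_from_def using at s' step
    by (intro exI[of _ 1] exI[of _ "\<lambda>i. if i = 0 then Running l else c'"]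
        exI[of _ "\<lambda>i. if i = 0 then 0 else t + 3"]) (auto simp: le_Suc_eq)
qed

text \<open>Runs are described from the loop head with arbitrary levels so that a round can be
  prepended; the later snapshots are shifted by the time of that round.\<close>

lemma run_from_continue:
  assumes s: "s ''status'' [] = 0" "ar (s ''level'') = l" and run: "runs STEP s t s'"
    and step: "trunc_step {..<k} {..<k} E pref \<kappa> (Running l) (Running l')" and rest: "run_from l' s' T"
  shows "run_from l s (t + 2 + T)"
proof -
  from rest obtain r c \<tau> where r: "c 0 = Running l'"
    "\<forall>i<r. trunc_step {..<k} {..<k} E pref \<kappa> (c i) (c (Suc i))"
    "final_config {..<k} {..<k} E pref \<kappa> (c r)"
    "\<forall>i<r. \<tau> i < \<tau> (Suc i)" "\<tau> r = T" "fst (ram_at MAIN s' T) = Skip"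
    "\<forall>i\<le>r. represents k (snd (ram_at MAIN s' (\<tau> i))) (c i)"
    unfolding run_from_def by blast
  have at: "ram_at MAIN s (t + 2 + u) = ram_at MAIN s' u" for u
    using ram_at_add[of MAIN s "t + 2" u] MAIN_iteration[OF s(1) run] by simp
  have rep: "represents k s (Running l)" using s by auto
  let ?c = "case_nat (Running l) c" and ?\<tau> = "case_nat 0 (\<lambda>i. t + 2 + \<tau> i)"
  show ?thesis
    unfolding run_from_def
  proof (intro exI[of _ "Suc r"] exI[of _ ?c] exI[of _ ?\<tau>] conjI allI impI)
    fix i assume "i < Suc r"
    then show "trunc_step {..<k} {..<k} E pref \<kappa> (?c i) (?c (Suc i))" "?\<tau> i < ?\<tau> (Suc i)"
      using r step by (auto split: nat.split)
  next
    fix i assume "i \<le> Suc r"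
    then show "represents k (snd (ram_at MAIN s (?\<tau> i))) (?c i)"
      using r(7) rep by (cases i) (simp_all only: nat.case at Suc_le_mono ram_at_0 snd_conv)
  qed (use r at in simp_all)
qed

section \<open>Amortised cost of the flag updates\<close>

text \<open>
  Each incidence of an object pays for one flag update at every level \<open>0, \<dots>, \<kappa>\<close>; the update at the
  current level is still due if the object is unmatched, that is, if it has just been raised.
\<close>

definition update_debt :: "(nat \<Rightarrow> nat) \<Rightarrow> (nat \<Rightarrow> nat) \<Rightarrow> nat" where
  "update_debt l mb = (\<Sum>a<k. \<Sum>i<dg a. dg a * (if mb (nb a i) = 0 then \<kappa> + 1 - l (nb a i) else \<kappa> - l (nb a i)))"

lemma raised_work_le_debt:
  assumes "\<And>b. b < k \<Longrightarrow> l b \<le> \<kappa>"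
  shows "raised_work mb \<le> update_debt l mb"
  unfolding raised_work_def update_debt_def
proof (intro sum_mono)
  fix a i assume "a \<in> {..<k}" "i \<in> {..<dg a}"
  then have "l (nb a i) \<le> \<kappa>" using assms nb_less by simp
  then show "(if mb (nb a i) = 0 then dg a else 0)
      \<le> dg a * (if mb (nb a i) = 0 then \<kappa> + 1 - l (nb a i) else \<kappa> - l (nb a i))"
    by (auto simp: Suc_diff_le)
qed

text \<open>After the round the debt of an incidence is \<open>\<kappa> - l\<close> times the degree
  in either case: a raised object has one level less to go but a new update due. The old debt
  exceeds this exactly by the updates just carried out.\<close>

lemma update_debt_raise:
  assumes le: "\<And>b. b < k \<Longrightarrow> l b \<le> \<kappa>" and mb': "\<And>b. mb' b = 0 \<longleftrightarrow> b \<notin> Range M"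
  shows "update_debt (raise_unmatched {..<k} M l) mb' + raised_work mb \<le> update_debt l mb"
  unfolding update_debt_def raised_work_def sum.distrib[symmetric]
proof (intro sum_mono)
  fix a i assume "a \<in> {..<k}" "i \<in> {..<dg a}"
  then have "nb a i < k" "l (nb a i) \<le> \<kappa>" using le nb_less by simp_all
  then show "dg a * (if mb' (nb a i) = 0 then \<kappa> + 1 - raise_unmatched {..<k} M l (nb a i)
        else \<kappa> - raise_unmatched {..<k} M l (nb a i)) + (if mb (nb a i) = 0 then dg a else 0)
      \<le> dg a * (if mb (nb a i) = 0 then \<kappa> + 1 - l (nb a i) else \<kappa> - l (nb a i))"
    using mb' by (auto simp: raise_unmatched_def Suc_diff_le)
qed

text \<open>The sum of squared degrees is at most k * card E, since one factor is at most k.\<close>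

lemma update_debt_initial: "update_debt (\<lambda>_. 0) mb \<le> (\<kappa> + 1) * (k * card E)"
proof -
  have dg: "dg a \<le> k" for a
    using card_mono[OF finite_lessThan nbr_subset] by (simp add: dg_def)
  have "update_debt (\<lambda>_. 0) mb \<le> (\<Sum>a<k. \<Sum>i<dg a. k * (\<kappa> + 1))"
    unfolding update_debt_def by (intro sum_mono mult_mono dg) auto
  also have "\<dots> = k * (\<kappa> + 1) * card E"
    unfolding sum_dg[symmetric] by (simp add: sum_distrib_left mult.commute)
  finally show ?thesis by (simp add: algebra_simps)
qed

text \<open>\<open>\<rho>\<close> bounds the number of remaining rounds.\<close>

lemma run_from_exists:
  fixes \<rho> :: "(nat \<Rightarrow> nat) \<Rightarrow> nat"
  assumes \<rho>: "\<And>l M. (\<forall>b\<in>{..<k}. l b < \<kappa> + 1) \<Longrightarrow> matching E M \<Longrightarrow> \<not> perfect {..<k} {..<k} M \<Longrightarrow>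
      \<rho> (raise_unmatched {..<k} M l) < \<rho> l"
    and L: "k \<le> L * L" and s: "loop_state L l s"
  shows "\<exists>T. run_from l s T \<and>
    T \<le> (\<rho> l + 1) * (round_time L + 6 * k + 12) + 16 * update_debt l (ar (s ''mb''))"
  using s
proof (induction "\<rho> l" arbitrary: l s rule: less_induct)
  case less
  note s = less.prems
  have s': "inp s" "s ''status'' [] = 0" "ar (s ''level'') = l" "s ''kappa'' [] = \<kappa>"
    using s inp_simps by (auto simp: loop_state_def)
  have lev: "s ''level'' [b] = l b" for b using s'(3) by auto
  \<comment> \<open>Checking the levels and dispatching the round takes at most 6 * k + 9 steps, and
    \<open>MAIN\<close> adds at most 3. The same amount covers a final check that rejects.\<close>
  let ?K = "round_time L + 6 * k + 12"
  show ?case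
  proof (cases "\<exists>b<k. \<kappa> < l b")
    case True
    have "wp STEP (\<lambda>t s'. s' ''status'' [] = 2 \<and> t \<le> 6 * k + 9) s"
      unfolding STEP_def wp_Seq
      by (rule wp_mono[OF wp_CHECK[OF s'(1)]]) (use True lev in simp)
    then obtain t u where t: "runs STEP s t u" "u ''status'' [] = 2" "t \<le> 6 * k + 9"
      unfolding wp_def by blast
    have "trunc_step {..<k} {..<k} E pref \<kappa> (Running l) Rejected"
      using True by (intro trunc_step.reject) (auto simp: Suc_le_eq)
    then have "run_from l s (t + 3)"
      using t final_Rejected by (intro run_from_stop[OF s'(2,3) t(1), of Rejected]) simp_all
    then show ?thesis using t by (intro exI[of _ "t + 3"]) auto
  next
    case False
    then have le: "\<And>b. b < k \<Longrightarrow> l b \<le> \<kappa>"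
      by (meson not_less)
    then have le': "\<forall>b\<in>{..<k}. l b < \<kappa> + 1"
      by (simp add: less_Suc_eq_le)
    have "wp STEP (\<lambda>t s'. (\<exists>M. maximum_matching (level_graph E pref l) M \<and>
      (if perfect {..<k} {..<k} M then s' ''status'' [] = 1 \<and> M = {(a, s' ''mate'' [a]) |a. a < k}
       else loop_state L (raise_unmatched {..<k} M l) s' \<and> (\<forall>b. s' ''mb'' [b] = 0 \<longleftrightarrow> b \<notin> Range M))) \<and>
      t \<le> 6 * k + 9 + round_time L + 16 * raised_work (ar (s ''mb''))) s"
      unfolding STEP_def wp_Seq
    proof (rule wp_frame[OF wp_CHECK[OF s'(1)]], goal_cases)
      case (1 t s1)
      note f = agreeD[OF 1(2), simplified]
      have "s1 ''rej'' [] = 0" using 1(1) False lev by simp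
      moreover have "loop_state L l s1" using s by (simp add: loop_state_def inp_def inputs_def f)
      from wp_ROUND[OF this L]
      have "wp ROUND (\<lambda>u s'. (\<exists>M. maximum_matching (level_graph E pref l) M \<and>
        (if perfect {..<k} {..<k} M then s' ''status'' [] = 1 \<and> M = {(a, s' ''mate'' [a]) |a. a < k}
         else loop_state L (raise_unmatched {..<k} M l) s' \<and> (\<forall>b. s' ''mb'' [b] = 0 \<longleftrightarrow> b \<notin> Range M))) \<and>
        t + 1 + (u + 1) \<le> 6 * k + 9 + round_time L + 16 * raised_work (ar (s ''mb''))) s1"
        by (rule wp_mono) (use 1(1) in \<open>simp add: f\<close>)
      ultimately show ?case by (simp only: wp_If bval.simps aval.simps list.map less_irrefl simp_thms)
    qed
    then obtain t u M where t: "runs STEP s t u" "maximum_matching (level_graph E pref l) M"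
      "if perfect {..<k} {..<k} M then u ''status'' [] = 1 \<and> M = {(a, u ''mate'' [a]) |a. a < k}
       else loop_state L (raise_unmatched {..<k} M l) u \<and> (\<forall>b. u ''mb'' [b] = 0 \<longleftrightarrow> b \<notin> Range M)"
      "t \<le> 6 * k + 9 + round_time L + 16 * raised_work (ar (s ''mb''))"
      unfolding wp_def by blast
    have ME: "matching E M"
      using t(2) level_graph_subset matching_mono unfolding maximum_matching_def by blast
    show ?thesis
    proof (cases "perfect {..<k} {..<k} M")
      case True
      have "trunc_step {..<k} {..<k} E pref \<kappa> (Running l) (Returned M)"
        using le' t(2) True by (rule trunc_step.accept)
      moreover have "u ''status'' [] = 1" "M = {(a, u ''mate'' [a]) |a. a < k}"
        using t(3) True by simp_all
      ultimately have "run_from l s (t + 3)"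
        using final_Returned by (intro run_from_stop[OF s'(2,3) t(1), of "Returned M"]) simp_all
      moreover have "t + 3 \<le> (\<rho> l + 1) * ?K + 16 * update_debt l (ar (s ''mb''))"
        using t(4) raised_work_le_debt[of l "ar (s ''mb'')", OF le] by simp
      ultimately show ?thesis by blast
    next
      case False
      define l' where "l' = raise_unmatched {..<k} M l"
      have u: "loop_state L l' u" "\<And>b. ar (u ''mb'') b = 0 \<longleftrightarrow> b \<notin> Range M"
        using t(3) False by (simp_all add: l'_def)
      have dec: "\<rho> l' < \<rho> l" unfolding l'_def using le' ME False by (rule \<rho>)
      obtain T where T: "run_from l' u T" "T \<le> (\<rho> l' + 1) * ?K + 16 * update_debt l' (ar (u ''mb''))"
        using less.hyps[OF dec u(1)] by blast
      have "trunc_step {..<k} {..<k} E pref \<kappa> (Running l) (Running l')"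
        unfolding l'_def using le' t(2) False by (rule trunc_step.raise)
      then have "run_from l s (t + 2 + T)" using s'(2,3) t(1) T(1) by (intro run_from_continue)
      moreover have "t + 2 + T \<le> (\<rho> l + 1) * ?K + 16 * update_debt l (ar (s ''mb''))"
      proof -
        have "16 * update_debt l' (ar (u ''mb'')) + 16 * raised_work (ar (s ''mb'')) \<le> 16 * update_debt l (ar (s ''mb''))"
          using update_debt_raise[of l "ar (u ''mb'')" M, OF le u(2), of "ar (s ''mb'')"] unfolding l'_def by linarith
        moreover have "(\<rho> l' + 1) * ?K + ?K \<le> (\<rho> l + 1) * ?K"
        proof -
          have "(\<rho> l' + 1) * ?K + ?K = (\<rho> l' + 2) * ?K" by simp
          also have "\<dots> \<le> (\<rho> l + 1) * ?K" using dec by (intro mult_right_mono) auto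
          finally show ?thesis .
        qed
        ultimately show ?thesis using t(4) T(2) by linarith
      qed
      ultimately show ?thesis by blast
    qed
  qed
qed

lemma executes_program:
  fixes \<rho> :: "(nat \<Rightarrow> nat) \<Rightarrow> nat"
  assumes \<rho>: "\<And>l M. (\<forall>b\<in>{..<k}. l b < \<kappa> + 1) \<Longrightarrow> matching E M \<Longrightarrow> \<not> perfect {..<k} {..<k} M \<Longrightarrow>
      \<rho> (raise_unmatched {..<k} M l) < \<rho> l"
  shows "\<exists>T L. executes_within (SQRT ;; MAIN) k E pref \<kappa> s0 T \<and> L * L \<le> k + 2 * L \<and>
    T \<le> 12 * k + 6 + (\<rho> (\<lambda>_. 0) + 1) * (round_time L + 6 * k + 12) + 16 * ((\<kappa> + 1) * (k * card E))"
proof -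
  have zero: "s0 x is = 0" if "x \<notin> inputs" for x "is"
    using enc that by (auto simp: encodes_def inputs_def)
  have "inp s0" by (simp add: inp_def)
  moreover have "s0 ''r'' [] = 0" "s0 ''w'' [] = 0" by (simp_all add: zero inputs_def)
  ultimately have "wp SQRT (\<lambda>t s'. k \<le> s' ''w'' [] * s' ''w'' [] \<and> s' ''w'' [] * s' ''w'' [] \<le> k + 2 * s' ''w'' [] \<and>
    t \<le> 12 * k + 5 \<and> agree {''o'', ''c'', ''r'', ''w''} s' s0) s0"
    by (intro wp_frame[OF wp_SQRT]) simp_all
  then obtain t s L where t: "runs SQRT s0 t s" "s ''w'' [] = L" "k \<le> L * L" "L * L \<le> k + 2 * L"
      "t \<le> 12 * k + 5" "agree {''o'', ''c'', ''r'', ''w''} s s0"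
    unfolding wp_def by blast
  note f = agreeD[OF t(6), simplified]
  have "loop_state L (\<lambda>_. 0) s"
    using t(2) by (auto simp: loop_state_def inp_def inputs_def f zero ar_def flags_partial_def)
  from run_from_exists[OF \<rho> t(3) this] obtain T where T: "run_from (\<lambda>_. 0) s T"
    "T \<le> (\<rho> (\<lambda>_. 0) + 1) * (round_time L + 6 * k + 12) + 16 * update_debt (\<lambda>_. 0) (ar (s ''mb''))"
    by blast
  have at: "ram_at (SQRT ;; MAIN) s0 (Suc t + u) = ram_at MAIN s u" for u
    using ram_at_add[of "SQRT ;; MAIN" s0 "Suc t" u] runs_Seq_ram_at[OF t(1), of MAIN] by simp
  from T(1) obtain r c \<tau> where r: "c 0 = Running (\<lambda>_. 0)"
    "\<forall>i<r. trunc_step {..<k} {..<k} E pref \<kappa> (c i) (c (Suc i))"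
    "final_config {..<k} {..<k} E pref \<kappa> (c r)"
    "\<forall>i<r. \<tau> i < \<tau> (Suc i)" "\<tau> r = T" "fst (ram_at MAIN s T) = Skip"
    "\<forall>i\<le>r. represents k (snd (ram_at MAIN s (\<tau> i))) (c i)"
    unfolding run_from_def by blast
  have "executes_within (SQRT ;; MAIN) k E pref \<kappa> s0 (Suc t + T)"
    unfolding executes_within_def
  proof (intro conjI exI[of _ r] exI[of _ c] exI[of _ "\<lambda>i. Suc t + \<tau> i"])
    show "halted_at (SQRT ;; MAIN) s0 (Suc t + T)"
      unfolding halted_at_def at by (rule r(6))
    show "\<forall>i\<le>r. represents k (snd (ram_at (SQRT ;; MAIN) s0 (Suc t + \<tau> i))) (c i)"
      unfolding at by (rule r(7))
  qed (use r in \<open>simp_all add: initial_def\<close>)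
  moreover have "Suc t + T \<le> 12 * k + 6 + (\<rho> (\<lambda>_. 0) + 1) * (round_time L + 6 * k + 12)
      + 16 * ((\<kappa> + 1) * (k * card E))"
    using t(5) T(2) update_debt_initial[of "ar (s ''mb'')"] by linarith
  ultimately show ?thesis using t(4) by blast
qed

section \<open>Number of rounds and total time\<close>

lemma rounds_bound:
  assumes "E \<noteq> {}" "1 \<le> \<kappa>"
  obtains \<rho> :: "(nat \<Rightarrow> nat) \<Rightarrow> nat" where
    "\<And>l M. (\<forall>b\<in>{..<k}. l b < \<kappa> + 1) \<Longrightarrow> matching E M \<Longrightarrow> \<not> perfect {..<k} {..<k} M \<Longrightarrow>
      \<rho> (raise_unmatched {..<k} M l) < \<rho> l"
    "(\<rho> (\<lambda>_. 0) + 1) * (k + card E) \<le> 6 * \<kappa> * k * card E"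
proof -
  have m: "1 \<le> card E" using assms(1) by (simp add: Suc_le_eq card_gt_0_iff)
  have k: "1 \<le> k" using assms(1) E_subset by (cases k) auto
  show thesis
  proof (cases "k \<le> card E")
    \<comment> \<open>A round is charged k + card E rather than card E. Here this is at most 2 *
      card E, and the sum of all missing levels is an adequate measure.\<close>
    case True
    show thesis
    proof (rule that[of "\<lambda>l. \<Sum>b<k. \<kappa> + 1 - l b"])
      fix l :: "nat \<Rightarrow> nat" and M
      assume "\<forall>b\<in>{..<k}. l b < \<kappa> + 1" "matching E M" "\<not> perfect {..<k} {..<k} M"
      then show "(\<Sum>b<k. \<kappa> + 1 - raise_unmatched {..<k} M l b) < (\<Sum>b<k. \<kappa> + 1 - l b)"
        using unmatched_object level_deficit_decreases by metis
    next
      have "k * (\<kappa> + 1) + 1 \<le> k * (2 * \<kappa>) + k * \<kappa>"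
        using k assms(2) by (intro add_mono mult_mono) (auto simp: Suc_le_eq)
      then have "(\<Sum>b<k. \<kappa> + 1 - 0) + 1 \<le> 3 * \<kappa> * k" by simp
      then have "((\<Sum>b<k. \<kappa> + 1 - 0) + 1) * (k + card E) \<le> (3 * \<kappa> * k) * (2 * card E)"
        using True by (intro mult_mono) auto
      then show "((\<Sum>b<k. \<kappa> + 1 - 0) + 1) * (k + card E) \<le> 6 * \<kappa> * k * card E" by simp
    qed
  next
    \<comment> \<open>Now k dominates, so the measure must not contribute another factor k; it
      watches one object without edges.\<close>
    case False
    have "card (Range E) \<le> card E" unfolding Range_snd by (rule card_image_le) simp
    then have "\<not> {..<k} \<subseteq> Range E"
      using False card_mono[of "Range E" "{..<k}"] by (auto simp: Range_snd)
    then obtain b where b: "b < k" "b \<notin> Range E" by auto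
    show thesis
    proof (rule that[of "\<lambda>l. \<kappa> + 1 - l b"])
      fix l :: "nat \<Rightarrow> nat" and M
      assume "\<forall>b\<in>{..<k}. l b < \<kappa> + 1" "matching E M" "\<not> perfect {..<k} {..<k} M"
      moreover have "b \<notin> Range M" if "matching E M" using that matching_subset b by blast
      moreover have "l b \<le> \<kappa>" using calculation(1) b by (simp add: less_Suc_eq_le)
      ultimately show "\<kappa> + 1 - raise_unmatched {..<k} M l b < \<kappa> + 1 - l b"
        using b by (simp add: raise_unmatched_def)
    next
      have "k + card E \<le> 2 * k" using False by simp
      also have "\<dots> \<le> 2 * k * card E" using m by simp
      finally have "(\<kappa> + 1 - 0 + 1) * (k + card E) \<le> (3 * \<kappa>) * (2 * k * card E)"
        using assms(2) by (intro mult_mono) auto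
      then show "(\<kappa> + 1 - 0 + 1) * (k + card E) \<le> 6 * \<kappa> * k * card E" by simp
    qed
  qed
qed

lemma time_bound:
  assumes E: "E \<noteq> {}" and \<kappa>: "1 \<le> \<kappa>" and L: "L * L \<le> k + 2 * L"
    and R: "R * (k + card E) \<le> 6 * \<kappa> * k * card E"
    and T: "T \<le> 12 * k + 6 + R * (round_time L + 6 * k + 12) + 16 * ((\<kappa> + 1) * (k * card E))"
  shows "real T \<le> 10000 * real \<kappa> * real (card E) * real (k + k) powr (3 / 2)"
proof -
  define m where "m = card E"
  have m: "1 \<le> m" using E by (simp add: m_def Suc_le_eq card_gt_0_iff)
  have k: "1 \<le> k" using E E_subset by (cases k) auto
  define x where "x = sqrt (real (k + k))"
  have x2: "x * x = 2 * real k" by (simp add: x_def)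
  have "x \<ge> sqrt 1" unfolding x_def using k by (intro real_sqrt_le_mono) simp
  then have x1: "1 \<le> x" by simp
  \<comment> \<open>The hypothesis gives (L - 1)^2 \<le> k + 1, whereas L + 1 > 4 * x would give L -
    1 > 2 * x, and (2 * x)^2 is 8 * k.\<close>
  have Lx: "real L + 1 \<le> 4 * x"
  proof (rule ccontr)
    assume "\<not> real L + 1 \<le> 4 * x"
    then have "2 * x < real L - 1" using x1 by simp
    then have "(2 * x) * (2 * x) < (real L - 1) * (real L - 1)"
      using x1 by (intro mult_strict_mono) auto
    also have "\<dots> = real (L * L) - 2 * real L + 1" by (simp add: algebra_simps)
    also have "\<dots> \<le> real (k + 2 * L) - 2 * real L + 1" using L by (simp only: of_nat_le_iff add_mono diff_mono)
    finally show False using x2 k by simp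
  qed
  have round: "real (round_time L + 6 * k + 12) \<le> 1040 * real (k + m) * x"
  proof -
    have "round_time L + 6 * k + 12 \<le> 260 * (k + m) * (L + 1)"
    proof -
      have "120 * (k + m + 1) * (L + 1) \<le> 240 * (k + m) * (L + 1)"
        using k by (intro mult_right_mono) auto
      moreover have "6 * k + 12 \<le> 20 * (k + m) * (L + 1)"
      proof -
        have "6 * k + 12 \<le> 20 * (k + m) * 1" using k m by simp
        also have "\<dots> \<le> 20 * (k + m) * (L + 1)" by (intro mult_left_mono) auto
        finally show ?thesis .
      qed
      ultimately show ?thesis by (simp add: round_time_def m_def algebra_simps)
    qed
    then have "real (round_time L + 6 * k + 12) \<le> real (260 * (k + m) * (L + 1))"
      by (simp only: of_nat_le_iff)
    also have "\<dots> = 260 * real (k + m) * (real L + 1)" by (simp add: algebra_simps)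
    also have "\<dots> \<le> 260 * real (k + m) * (4 * x)" using Lx by (intro mult_left_mono) auto
    finally show ?thesis by (simp add: algebra_simps)
  qed
  let ?B = "real \<kappa> * real k * real m"
  have "real R * real (round_time L + 6 * k + 12) \<le> real R * (1040 * real (k + m) * x)"
    using round by (intro mult_left_mono) auto
  also have "\<dots> = 1040 * x * real (R * (k + m))" by simp
  also have "\<dots> \<le> 1040 * x * real (6 * \<kappa> * k * m)"
    using R x1 unfolding m_def by (intro mult_left_mono) (auto simp only: of_nat_le_iff)
  also have "\<dots> = 6240 * (?B * x)" by simp
  finally have 1: "real R * real (round_time L + 6 * k + 12) \<le> 6240 * (?B * x)" .
  have Bx: "?B \<le> ?B * x" using mult_left_mono[OF x1, of ?B] by simp
  have "real (12 * k + 6) \<le> 18 * real k" using k by simp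
  also have "\<dots> \<le> 18 * ?B"
  proof -
    have "k * 1 \<le> k * (\<kappa> * m)" using \<kappa> m by (intro mult_left_mono) (auto simp: Suc_le_eq)
    then have "real (k * 1) \<le> real (k * (\<kappa> * m))" by (simp only: of_nat_le_iff)
    then show ?thesis by (simp add: algebra_simps)
  qed
  finally have 2: "real (12 * k + 6) \<le> 18 * (?B * x)" using Bx by linarith
  have "real (16 * ((\<kappa> + 1) * (k * m))) \<le> 32 * ?B"
  proof -
    have "(\<kappa> + 1) * (k * m) \<le> (2 * \<kappa>) * (k * m)" using \<kappa> by (intro mult_right_mono) auto
    then have "real ((\<kappa> + 1) * (k * m)) \<le> real ((2 * \<kappa>) * (k * m))" by (simp only: of_nat_le_iff)
    then show ?thesis by (simp add: algebra_simps)
  qed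
  then have 3: "real (16 * ((\<kappa> + 1) * (k * m))) \<le> 32 * (?B * x)" using Bx by linarith
  have "real T \<le> real (12 * k + 6 + R * (round_time L + 6 * k + 12) + 16 * ((\<kappa> + 1) * (k * m)))"
    using T unfolding m_def by (simp only: of_nat_le_iff)
  also have "\<dots> = real (12 * k + 6) + real R * real (round_time L + 6 * k + 12) + real (16 * ((\<kappa> + 1) * (k * m)))"
    by simp
  also have "\<dots> \<le> 18 * (?B * x) + 6240 * (?B * x) + 32 * (?B * x)" using 1 2 3 by linarith
  \<comment> \<open>The sum is 6290; the rounded constant is halved in the next line, where k + k,
    the number of vertices, replaces k.\<close>
  also have "\<dots> \<le> 20000 * (?B * x)" using x1 by simp
  also have "\<dots> = 10000 * real \<kappa> * real m * (real (k + k) * x)" by (simp add: algebra_simps)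
  also have "real (k + k) * x = real (k + k) powr (3 / 2)"
  proof -
    have "real (k + k) powr (3 / 2) = real (k + k) powr (1 + 1 / 2)" by simp
    also have "\<dots> = real (k + k) powr 1 * real (k + k) powr (1 / 2)" by (rule powr_add)
    also have "\<dots> = real (k + k) * x" by (simp add: x_def powr_half_sqrt)
    finally show ?thesis by simp
  qed
  finally show ?thesis by (simp add: m_def)
qed

end

theorem theorem11:
  "(\<forall>(A :: 'a set) (B :: 'b set) (E :: ('a \<times> 'b) set) (pref :: ('a, 'b) pref) (\<kappa> :: nat).
      assignment_instance A B E pref \<and> 1 \<le> \<kappa> \<longrightarrow>
        termip (trunc_step A B E pref \<kappa>) initial \<and>
        ((\<exists>M. assignment A B E M \<and> popular_with_penalty A E pref \<kappa> M) \<longrightarrow>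
          (\<forall>c. (trunc_step A B E pref \<kappa>)\<^sup>*\<^sup>* initial c \<and> final_config A B E pref \<kappa> c \<longrightarrow>
            (\<exists>M. c = Returned M \<and> assignment A B E M \<and> popular_with_penalty A E pref \<kappa> M)))) \<and>
   (\<exists>(P :: com) (C :: real).
      \<forall>(k :: nat) (E :: (nat \<times> nat) set) (pref :: (nat, nat) pref) (\<kappa> :: nat) (s :: store).
        assignment_instance {..<k} {..<k} E pref \<and> 1 \<le> \<kappa> \<and> encodes k E pref \<kappa> s \<longrightarrow>
          (\<exists>T. executes_within P k E pref \<kappa> s T \<and>
               (E \<noteq> {} \<longrightarrow>
                 real T \<le> C * real \<kappa> * real (card E) *
                   real (card {..<k} + card {..<k}) powr (3 / 2))))"
proof (intro conjI allI impI)
  fix A :: "'a set" and B :: "'b set" and E pref and \<kappa> :: nat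
  assume "assignment_instance A B E pref \<and> 1 \<le> \<kappa>"
  then interpret bipartite_prefs A B E pref by unfold_locales simp
  show "termip (trunc_step A B E pref \<kappa>) initial" by (rule termip_trunc_step)
  fix c
  assume "\<exists>M. assignment A B E M \<and> popular_with_penalty A E pref \<kappa> M"
    "(trunc_step A B E pref \<kappa>)\<^sup>*\<^sup>* initial c \<and> final_config A B E pref \<kappa> c"
  then show "\<exists>M. c = Returned M \<and> assignment A B E M \<and> popular_with_penalty A E pref \<kappa> M"
    using final_config_correct by blast
next
  show "\<exists>(P :: com) (C :: real).
      \<forall>(k :: nat) (E :: (nat \<times> nat) set) (pref :: (nat, nat) pref) (\<kappa> :: nat) (s :: store).
        assignment_instance {..<k} {..<k} E pref \<and> 1 \<le> \<kappa> \<and> encodes k E pref \<kappa> s \<longrightarrow>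
          (\<exists>T. executes_within P k E pref \<kappa> s T \<and>
               (E \<noteq> {} \<longrightarrow>
                 real T \<le> C * real \<kappa> * real (card E) *
                   real (card {..<k} + card {..<k}) powr (3 / 2)))"
  proof (intro exI[of _ "SQRT ;; MAIN"] exI[of _ "10000 :: real"] allI impI)
    fix k :: nat and E :: "(nat \<times> nat) set" and pref :: "(nat, nat) pref" and \<kappa> :: nat and s :: store
    assume a: "assignment_instance {..<k} {..<k} E pref \<and> 1 \<le> \<kappa> \<and> encodes k E pref \<kappa> s"
    then interpret ram_instance k E pref \<kappa> s by unfold_locales simp_all
    show "\<exists>T. executes_within (SQRT ;; MAIN) k E pref \<kappa> s T \<and>
      (E \<noteq> {} \<longrightarrow> real T \<le> 10000 * real \<kappa> * real (card E) *
         real (card {..<k} + card {..<k}) powr (3 / 2))"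
    \<comment> \<open>Without edges only a halting run has to be exhibited, for which the sum of
      missing levels suffices as a measure.\<close>
    proof (cases "E = {}")
      case True
      have "(\<Sum>b<k. \<kappa> + 1 - raise_unmatched {..<k} M l b) < (\<Sum>b<k. \<kappa> + 1 - l b)"
        if "\<forall>b\<in>{..<k}. l b < \<kappa> + 1" "matching E M" "\<not> perfect {..<k} {..<k} M" for l M
        using that unmatched_object level_deficit_decreases by metis
      from executes_program[of "\<lambda>l. \<Sum>b<k. \<kappa> + 1 - l b", OF this] show ?thesis
        using True by blast
    next
      case False
      obtain \<rho> :: "(nat \<Rightarrow> nat) \<Rightarrow> nat" where \<rho>:
        "\<And>l M. (\<forall>b\<in>{..<k}. l b < \<kappa> + 1) \<Longrightarrow> matching E M \<Longrightarrow> \<not> perfect {..<k} {..<k} M \<Longrightarrow>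
          \<rho> (raise_unmatched {..<k} M l) < \<rho> l"
        "(\<rho> (\<lambda>_. 0) + 1) * (k + card E) \<le> 6 * \<kappa> * k * card E"
        using rounds_bound[OF False] a by blast
      obtain T L where "executes_within (SQRT ;; MAIN) k E pref \<kappa> s T" "L * L \<le> k + 2 * L"
        "T \<le> 12 * k + 6 + (\<rho> (\<lambda>_. 0) + 1) * (round_time L + 6 * k + 12) + 16 * ((\<kappa> + 1) * (k * card E))"
        using executes_program[OF \<rho>(1)] by blast
      then show ?thesis using time_bound[OF False _ _ \<rho>(2)] a by auto
    qed
  qed
qed

end
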